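(* The umbilical surfaces of $\mathbb{H}^2\times\mathbb{R}$ are (locally) the following: (i) the totally geodesic surfaces, namely the horizontal planes $z=c$, $c\in\mathbb{R}$, and the vertical cylinders $\gamma\times\mathbb{R}$ over the geodesics $\gamma$ of $\mathbb{H}^2$; (ii) the surfaces given as the graph $z=f(x,y)$ of a function $$f(x,y)=\arctan\Big(\frac{\lambda(x,y)}{\sqrt{j-\lambda(x,y)^2}}\Big)+c,\qquad c\in\mathbb{R},$$ where $$\lambda(x,y)=\frac{1}{y}\Big[\frac{c_1}{2}(x^2+y^2)+c_2\,x-c_3\Big],\qquad c_1,c_2,c_3\in\mathbb{R},$$ and $$j=1-c_2^2-2\,c_1\,c_3>0,$$ the function $f$ being considered where it is defined, i.e. on $\{(x,y)\in\mathbb{H}^2 : \lambda(x,y)^2<j\}$. That is: every surface listed in (i) and (ii) is umbilical; and conversely, every umbilical surface $\mathcal{M}$ in $\mathbb{H}^2\times\mathbb{R}$ contains an open dense subset each of whose connected components is an open piece of one of the surfaces listed in (i) or (ii).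
   Context: $\mathbb{H}^2$ is the upper half-plane $\{(x,y)\in\mathbb{R}^2 : y>0\}$ with the hyperbolic metric $(dx^2+dy^2)/y^2$. The product $\mathbb{H}^2\times\mathbb{R}$ carries the metric $g=\frac{dx^2+dy^2}{y^2}+dz^2$, with coordinates $(x,y,z)$. Surfaces are smooth regular surfaces. A surface $\mathcal{M}$ is umbilical if, for each $p\in\mathcal{M}$ and each unit normal vector field $\xi$ defined in a neighborhood $U$ of $p$ in $\mathcal{M}$, there is a function $\lambda:U\to\mathbb{R}$ such that the shape operator satisfies $A_\xi=\lambda I$ on $U$. A surface is totally geodesic if its second fundamental form vanishes identically. *)

theory Defs
  imports "HOL-Analysis.Analysis"
begin

section \<open>Smooth maps\<close>

text \<open>For an open set \<open>S\<close> in a Euclidean space, \<open>Ck_on S f n\<close> says that \<open>f\<close> is of class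
  \<open>C^n\<close> on \<open>S\<close>: all iterated directional derivatives up to order \<open>n\<close> exist, as derivatives of
  Frechet differentiable maps, and are continuous.\<close>

primrec Ck_on :: "'a::real_normed_vector set \<Rightarrow> ('a \<Rightarrow> 'b::real_normed_vector) \<Rightarrow> nat \<Rightarrow> bool" where
  "Ck_on S f 0 \<longleftrightarrow> continuous_on S f"
| "Ck_on S f (Suc n) \<longleftrightarrow>
     (\<forall>x\<in>S. f differentiable (at x)) \<and> (\<forall>v. Ck_on S (\<lambda>x. frechet_derivative f (at x) v) n)"

definition smooth_on :: "'a::real_normed_vector set \<Rightarrow> ('a \<Rightarrow> 'b::real_normed_vector) \<Rightarrow> bool" where
  "smooth_on S f \<longleftrightarrow> (\<forall>n. Ck_on S f n)"


section \<open>Riemannian metrics in coordinates\<close>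

text \<open>A Riemannian metric on an open subset of \<open>R^n\<close> is given by its coefficient matrix
  \<open>G p $ i $ j\<close> at each point \<open>p\<close>.\<close>

type_synonym 'n metric_coeffs = "real^'n \<Rightarrow> real^'n^'n"

definition metric_inner :: "'n::finite metric_coeffs \<Rightarrow> real^'n \<Rightarrow> real^'n \<Rightarrow> real^'n \<Rightarrow> real" where
  "metric_inner G p v w = (\<Sum>i\<in>UNIV. \<Sum>j\<in>UNIV. G p $ i $ j * v $ i * w $ j)"

definition coord_deriv :: "'n::finite \<Rightarrow> (real^'n \<Rightarrow> real) \<Rightarrow> real^'n \<Rightarrow> real" where
  "coord_deriv i h p = frechet_derivative h (at p) (axis i 1)"

text \<open>\<open>christoffel G p k i j\<close> is the Christoffel symbol with upper index \<open>k\<close> and lower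
  indices \<open>i\<close>, \<open>j\<close> of the Levi-Civita connection.\<close>

definition christoffel :: "'n::finite metric_coeffs \<Rightarrow> real^'n \<Rightarrow> 'n \<Rightarrow> 'n \<Rightarrow> 'n \<Rightarrow> real" where
  "christoffel G p k i j = 1/2 * (\<Sum>l\<in>UNIV. matrix_inv (G p) $ k $ l *
     (coord_deriv i (\<lambda>q. G q $ j $ l) p + coord_deriv j (\<lambda>q. G q $ i $ l) p
      - coord_deriv l (\<lambda>q. G q $ i $ j) p))"

definition christoffel_form :: "'n::finite metric_coeffs \<Rightarrow> real^'n \<Rightarrow> real^'n \<Rightarrow> real^'n \<Rightarrow> real^'n" where
  "christoffel_form G p v w = (\<chi> k. \<Sum>i\<in>UNIV. \<Sum>j\<in>UNIV. christoffel G p k i j * v $ i * w $ j)"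

text \<open>Levi-Civita covariant derivative in the direction \<open>v\<close>, tangent to \<open>M\<close> at \<open>p\<close>, of a vector
  field \<open>\<xi>\<close> defined only along the submanifold \<open>M\<close>. The Frechet derivative relative to \<open>M\<close> is
  uniquely determined on vectors tangent to \<open>M\<close>, although not on other vectors, where the value
  is meaningless.\<close>

definition cov_deriv_along ::
    "'n::finite metric_coeffs \<Rightarrow> (real^'n) set \<Rightarrow> (real^'n \<Rightarrow> real^'n) \<Rightarrow> real^'n \<Rightarrow> real^'n \<Rightarrow> real^'n" where
  "cov_deriv_along G M \<xi> p v =
     frechet_derivative \<xi> (at p within M) v + christoffel_form G p v (\<xi> p)"

text \<open>Complete geodesics in the open set \<open>D\<close>, i.e. regular solutions \<open>c\<close> of the geodesic equation
  defined on the whole real line.\<close>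

definition complete_geodesic :: "'n::finite metric_coeffs \<Rightarrow> (real^'n) set \<Rightarrow> (real \<Rightarrow> real^'n) \<Rightarrow> bool" where
  "complete_geodesic G D c \<longleftrightarrow> (\<exists>c' c''. \<forall>t. c t \<in> D \<and> c' t \<noteq> 0 \<and>
     (c has_vector_derivative c' t) (at t) \<and> (c' has_vector_derivative c'' t) (at t) \<and>
     c'' t + christoffel_form G (c t) (c' t) (c' t) = 0)"


section \<open>The hyperbolic plane and its product with the line\<close>

definition H2 :: "(real^2) set" where
  "H2 = {p. p $ 2 > 0}"

definition H2_metric :: "2 metric_coeffs" where
  "H2_metric p = (\<chi> i j. if i = j then 1 / (p $ 2)\<^sup>2 else 0)"

definition H2R :: "(real^3) set" where
  "H2R = {p. p $ 2 > 0}"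

definition H2R_metric :: "3 metric_coeffs" where
  "H2R_metric p = (\<chi> i j. if i \<noteq> j then 0 else if i = 3 then 1 else 1 / (p $ 2)\<^sup>2)"

text \<open>Point sets of the (complete) geodesics of the hyperbolic plane.\<close>

definition H2_geodesics :: "(real^2) set set" where
  "H2_geodesics = {range c | c. complete_geodesic H2_metric H2 c}"


section \<open>Surfaces\<close>

definition local_param :: "(real^3) set \<Rightarrow> (real^2) set \<Rightarrow> (real^2 \<Rightarrow> real^3) \<Rightarrow> bool" where
  "local_param M V X \<longleftrightarrow> open V \<and> smooth_on V X \<and>
     openin (top_of_set M) (X ` V) \<and> (\<exists>Y. homeomorphism V (X ` V) X Y) \<and>
     (\<forall>u\<in>V. inj (frechet_derivative X (at u)))"

definition regular_surface :: "(real^3) set \<Rightarrow> bool" where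
  "regular_surface M \<longleftrightarrow> M \<subseteq> H2R \<and> (\<forall>p\<in>M. \<exists>V X. local_param M V X \<and> p \<in> X ` V)"

definition tangent_plane :: "(real^3) set \<Rightarrow> real^3 \<Rightarrow> (real^3) set" where
  "tangent_plane M p =
     {frechet_derivative X (at u) w | V X u w. local_param M V X \<and> u \<in> V \<and> X u = p}"

definition smooth_along :: "(real^3) set \<Rightarrow> (real^3 \<Rightarrow> real^3) \<Rightarrow> bool" where
  "smooth_along M \<xi> \<longleftrightarrow> (\<forall>p\<in>M. \<exists>V X. local_param M V X \<and> p \<in> X ` V \<and> smooth_on V (\<xi> \<circ> X))"

definition unit_normal_field :: "(real^3) set \<Rightarrow> (real^3 \<Rightarrow> real^3) \<Rightarrow> bool" where
  "unit_normal_field M \<xi> \<longleftrightarrow> smooth_along M \<xi> \<and>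
     (\<forall>p\<in>M. metric_inner H2R_metric p (\<xi> p) (\<xi> p) = 1 \<and>
       (\<forall>v\<in>tangent_plane M p. metric_inner H2R_metric p (\<xi> p) v = 0))"

text \<open>No tangential projection is needed in the shape operator: the covariant derivative of a unit
  normal field in a tangent direction is itself tangent.\<close>

definition shape_operator :: "(real^3) set \<Rightarrow> (real^3 \<Rightarrow> real^3) \<Rightarrow> real^3 \<Rightarrow> real^3 \<Rightarrow> real^3" where
  "shape_operator M \<xi> p v = - cov_deriv_along H2R_metric M \<xi> p v"

definition second_fundamental_form ::
    "(real^3) set \<Rightarrow> (real^3 \<Rightarrow> real^3) \<Rightarrow> real^3 \<Rightarrow> real^3 \<Rightarrow> real^3 \<Rightarrow> real" where
  "second_fundamental_form M \<xi> p v w = metric_inner H2R_metric p (shape_operator M \<xi> p v) w"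

definition umbilical :: "(real^3) set \<Rightarrow> bool" where
  "umbilical M \<longleftrightarrow> regular_surface M \<and>
     (\<forall>p\<in>M. \<forall>U \<xi>. openin (top_of_set M) U \<and> p \<in> U \<and> unit_normal_field U \<xi> \<longrightarrow>
       (\<exists>lam::real^3 \<Rightarrow> real. \<forall>q\<in>U. \<forall>v\<in>tangent_plane U q. shape_operator U \<xi> q v = lam q *\<^sub>R v))"

definition totally_geodesic :: "(real^3) set \<Rightarrow> bool" where
  "totally_geodesic M \<longleftrightarrow> regular_surface M \<and>
     (\<forall>U \<xi>. openin (top_of_set M) U \<and> unit_normal_field U \<xi> \<longrightarrow>
       (\<forall>q\<in>U. \<forall>v\<in>tangent_plane U q. \<forall>w\<in>tangent_plane U q.
          second_fundamental_form U \<xi> q v w = 0))"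


section \<open>The model surfaces\<close>

definition horizontal_plane :: "real \<Rightarrow> (real^3) set" where
  "horizontal_plane c = {p \<in> H2R. p $ 3 = c}"

definition vertical_cylinder :: "(real^2) set \<Rightarrow> (real^3) set" where
  "vertical_cylinder \<gamma> = {p. (vector [p $ 1, p $ 2] :: real^2) \<in> \<gamma>}"

definition umb_lambda :: "real \<Rightarrow> real \<Rightarrow> real \<Rightarrow> real \<Rightarrow> real \<Rightarrow> real" where
  "umb_lambda c1 c2 c3 x y = 1 / y * (c1 / 2 * (x\<^sup>2 + y\<^sup>2) + c2 * x - c3)"

definition umb_j :: "real \<Rightarrow> real \<Rightarrow> real \<Rightarrow> real" where
  "umb_j c1 c2 c3 = 1 - c2\<^sup>2 - 2 * c1 * c3"

definition umb_fun :: "real \<Rightarrow> real \<Rightarrow> real \<Rightarrow> real \<Rightarrow> real \<Rightarrow> real \<Rightarrow> real" where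
  "umb_fun c c1 c2 c3 x y =
     arctan (umb_lambda c1 c2 c3 x y / sqrt (umb_j c1 c2 c3 - (umb_lambda c1 c2 c3 x y)\<^sup>2)) + c"

definition umb_graph :: "real \<Rightarrow> real \<Rightarrow> real \<Rightarrow> real \<Rightarrow> (real^3) set" where
  "umb_graph c c1 c2 c3 =
     {p \<in> H2R. (umb_lambda c1 c2 c3 (p $ 1) (p $ 2))\<^sup>2 < umb_j c1 c2 c3 \<and>
               p $ 3 = umb_fun c c1 c2 c3 (p $ 1) (p $ 2)}"

definition planes_and_cylinders :: "(real^3) set set" where
  "planes_and_cylinders = range horizontal_plane \<union> vertical_cylinder ` H2_geodesics"

definition umb_graphs :: "(real^3) set set" where
  "umb_graphs = {umb_graph c c1 c2 c3 | c c1 c2 c3. umb_j c1 c2 c3 > 0}"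

text \<open>\<open>M\<close> is locally one of the surfaces in \<open>F\<close>: an open dense subset of \<open>M\<close> has the property that
  each of its connected components is an open piece of a member of \<open>F\<close>.\<close>

definition locally_one_of :: "(real^3) set set \<Rightarrow> (real^3) set \<Rightarrow> bool" where
  "locally_one_of F M \<longleftrightarrow> (\<exists>W. openin (top_of_set M) W \<and> M \<subseteq> closure W \<and>
     (\<forall>C\<in>components W. \<exists>S\<in>F. openin (top_of_set S) C))"

end

theory Submission
  imports Defs
begin

text \<open>Write the unit normal of a surface as \<open>N = a y \<partial>\<^sub>x + b y \<partial>\<^sub>y + \<nu> \<partial>\<^sub>z\<close>. With the coframe
  \<open>\<theta>\<^sub>1 = dx / y\<close>, \<open>\<theta>\<^sub>2 = dy / y\<close>, \<open>\<theta>\<^sub>3 = dz\<close> restricted to the surface, the condition that the shape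
  operator is multiplication by \<open>\<lambda>\<close> reads \<open>da = (b - \<lambda>) \<theta>\<^sub>1\<close>, \<open>db = - a \<theta>\<^sub>1 - \<lambda> \<theta>\<^sub>2\<close>, \<open>d\<nu> = - \<lambda> \<theta>\<^sub>3\<close>.
  Where \<open>\<nu> \<noteq> 0\<close>, exterior differentiation gives \<open>d\<lambda> = \<nu> dz\<close>, and where \<open>\<nu> = 0\<close> on an open set one finds
  \<open>\<lambda> = 0\<close>. In both cases \<open>c\<^sub>1 = (\<lambda> - b) / y\<close>, \<open>c\<^sub>2 = - a - c\<^sub>1 x\<close> and
  \<open>c\<^sub>3 = c\<^sub>1 (x\<^sup>2 + y\<^sup>2) / 2 + c\<^sub>2 x - \<lambda> y\<close> are constants and \<open>\<lambda>\<^sup>2 + \<nu>\<^sup>2 = 1 - c\<^sub>2\<^sup>2 - 2 c\<^sub>1 c\<^sub>3 = j\<close>. If \<open>\<nu> = 0\<close>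
  this is the equation of a cylinder over a geodesic; if \<open>\<nu> > 0\<close> then \<open>z - arctan (\<lambda> / \<nu>)\<close> is a further
  constant. Conversely these formulas define unit normals that satisfy the equations.\<close>

section \<open>Functions of class C^n\<close>

text \<open>Umbilicity supplies \<lambda> as an arbitrary function, so it must be shown smooth
  before anything is differentiated. Since
  \<open>d\<theta>\<^sub>1 = \<theta>\<^sub>1 \<and> \<theta>\<^sub>2\<close> and
  \<open>d\<theta>\<^sub>2 = 0\<close> for the exterior product \<and>, the equations for da and db
  yield \<open>d\<lambda> \<and> \<theta>\<^sub>1 = b \<theta>\<^sub>1 \<and>
  \<theta>\<^sub>2\<close> and \<open>d\<lambda> \<and> \<theta>\<^sub>2 = - a \<theta>\<^sub>1
  \<and> \<theta>\<^sub>2\<close>. Where \<nu> \<noteq> 0 the form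
  \<open>\<theta>\<^sub>1 \<and> \<theta>\<^sub>2\<close> does not vanish, so
  \<open>d\<lambda> = - a \<theta>\<^sub>1 - b \<theta>\<^sub>2\<close>, which is \<nu> dz because
  the normal is orthogonal to the surface. Together with the equation for d\<nu> this says that
  (\<lambda>, \<nu>) runs on the circle of radius sqrt j with polar angle z up to a constant; hence
  the arctangent. Zeros of \<nu> that are limits of nonzeros are never analysed: every nonempty open
  parameter set contains a ball on which \<nu> is identically zero or keeps one sign, and for an
  open dense set this is enough.\<close>

lemma Ck_on_cong:
  assumes "open S" "Ck_on S f n" "\<And>x. x \<in> S \<Longrightarrow> f x = g x"
  shows "Ck_on S g n"
  using assms(2,3)
proof (induction n arbitrary: f g)
  case 0
  then show ?case using continuous_on_cong[of S S f g] by simp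
next
  case (Suc n)
  have D: "(g has_derivative frechet_derivative f (at x)) (at x)" if x: "x \<in> S" for x
  proof -
    have "(f has_derivative frechet_derivative f (at x)) (at x)"
      using Suc.prems(1) x by (simp add: frechet_derivative_works[symmetric])
    then show ?thesis
      by (rule has_derivative_transform_within_open[OF _ assms(1) x Suc.prems(2)])
  qed
  have "Ck_on S (\<lambda>x. frechet_derivative g (at x) v) n" for v
  proof (rule Suc.IH)
    show "Ck_on S (\<lambda>x. frechet_derivative f (at x) v) n"
      using Suc.prems(1) by simp
    show "frechet_derivative f (at x) v = frechet_derivative g (at x) v" if "x \<in> S" for x
      using frechet_derivative_at[OF D[OF that]] by simp
  qed
  moreover have "\<forall>x\<in>S. g differentiable (at x)"
    using D unfolding differentiable_def by blast
  ultimately show ?case by simp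
qed

text \<open>\<open>frechet_derivative\<close> is defined by choice. This form accepts any witness
  \<open>f'\<close>, so each closure rule below only has to exhibit a derivative formula.\<close>

lemma Ck_on_Suc_iff:
  assumes "open S"
  shows "Ck_on S f (Suc n) \<longleftrightarrow>
    (\<exists>f'. (\<forall>x\<in>S. (f has_derivative f' x) (at x)) \<and> (\<forall>v. Ck_on S (\<lambda>x. f' x v) n))"
    (is "?l \<longleftrightarrow> ?r")
proof
  assume ?l
  then show ?r
    by (intro exI[of _ "\<lambda>x. frechet_derivative f (at x)"]) (auto simp: frechet_derivative_works[symmetric])
next
  assume ?r
  then obtain f' where "\<And>x. x \<in> S \<Longrightarrow> (f has_derivative f' x) (at x)" "\<And>v. Ck_on S (\<lambda>x. f' x v) n"
    by blast
  then have "f' x = frechet_derivative f (at x)" if "x \<in> S" for x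
    using frechet_derivative_at[of f "f' x" x] that by blast
  then have "Ck_on S (\<lambda>x. frechet_derivative f (at x) v) n" for v
    by (intro Ck_on_cong[OF assms \<open>\<And>v. Ck_on S (\<lambda>x. f' x v) n\<close>[of v]]) simp
  moreover have "\<forall>x\<in>S. f differentiable (at x)"
    using \<open>\<And>x. x \<in> S \<Longrightarrow> (f has_derivative f' x) (at x)\<close> unfolding differentiable_def by blast
  ultimately show ?l by simp
qed

lemma Ck_on_derivI:
  assumes "open S" "\<And>x. x \<in> S \<Longrightarrow> (f has_derivative f' x) (at x)" "\<And>v. Ck_on S (\<lambda>x. f' x v) n"
  shows "Ck_on S f (Suc n)"
  using assms Ck_on_Suc_iff[OF assms(1), of f n] by blast

lemma Ck_on_derivE:
  assumes "open S" "Ck_on S f (Suc n)"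
  obtains f' where "\<And>x. x \<in> S \<Longrightarrow> (f has_derivative f' x) (at x)" "\<And>v. Ck_on S (\<lambda>x. f' x v) n"
  using assms Ck_on_Suc_iff[OF assms(1), of f n] by blast

lemma Ck_on_SucD: "Ck_on S f (Suc n) \<Longrightarrow> Ck_on S f n"
proof (induction n arbitrary: f)
  case 0
  then have "continuous (at x) f" if "x \<in> S" for x
    using that differentiable_imp_continuous_within by auto
  then show ?case
    using continuous_at_imp_continuous_on by auto
next
  case (Suc n)
  have "Ck_on S (\<lambda>x. frechet_derivative f (at x) v) n" for v
    using Suc.prems by (intro Suc.IH) (simp del: Ck_on.simps(2) add: Ck_on.simps(2)[of S f])
  then show ?case using Suc.prems by simp
qed

lemma Ck_on_subset: "Ck_on S f n \<Longrightarrow> T \<subseteq> S \<Longrightarrow> Ck_on T f n"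
  by (induction n arbitrary: f) (auto intro: continuous_on_subset)

lemma Ck_on_const: "open S \<Longrightarrow> Ck_on S (\<lambda>x. c) n"
proof (induction n arbitrary: c)
  case (Suc n)
  then show ?case
    by (intro Ck_on_derivI[where f' = "\<lambda>x v. 0"]) (simp_all del: Ck_on.simps)
qed simp

lemma Ck_on_bounded_linear_comp:
  assumes "open S" "bounded_linear L" "Ck_on S f n"
  shows "Ck_on S (\<lambda>x. L (f x)) n"
  using assms(3)
proof (induction n arbitrary: f)
  case 0
  then show ?case using bounded_linear.continuous_on[OF assms(2)] by simp
next
  case (Suc n)
  obtain f' where f': "\<And>x. x \<in> S \<Longrightarrow> (f has_derivative f' x) (at x)" "\<And>v. Ck_on S (\<lambda>x. f' x v) n"
    using Ck_on_derivE[OF assms(1) Suc.prems] by blast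
  show ?case
    by (rule Ck_on_derivI[OF assms(1), where f' = "\<lambda>x v. L (f' x v)"])
      (use f' Suc.IH in \<open>auto intro!: bounded_linear.has_derivative[OF assms(2)]\<close>)
qed

lemma Ck_on_bounded_linear:
  assumes "open S" "bounded_linear L"
  shows "Ck_on S L n"
proof (cases n)
  case 0
  then show ?thesis by (simp add: linear_continuous_on assms)
next
  case (Suc m)
  show ?thesis
    unfolding Suc by (rule Ck_on_derivI[OF assms(1), where f' = "\<lambda>x v. L v"])
      (auto intro: bounded_linear_imp_has_derivative assms Ck_on_const)
qed

lemma Ck_on_add:
  assumes "open S" "Ck_on S f n" "Ck_on S g n"
  shows "Ck_on S (\<lambda>x. f x + g x) n"
  using assms(2,3)
proof (induction n arbitrary: f g)
  case 0
  then show ?case by (auto intro: continuous_intros)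
next
  case (Suc n)
  obtain f' where f': "\<And>x. x \<in> S \<Longrightarrow> (f has_derivative f' x) (at x)" "\<And>v. Ck_on S (\<lambda>x. f' x v) n"
    using Ck_on_derivE[OF assms(1) Suc.prems(1)] by blast
  obtain g' where g': "\<And>x. x \<in> S \<Longrightarrow> (g has_derivative g' x) (at x)" "\<And>v. Ck_on S (\<lambda>x. g' x v) n"
    using Ck_on_derivE[OF assms(1) Suc.prems(2)] by blast
  show ?case
    by (rule Ck_on_derivI[OF assms(1), where f' = "\<lambda>x v. f' x v + g' x v"])
      (use f' g' Suc.IH in \<open>auto intro: has_derivative_add\<close>)
qed

lemma Ck_on_sum:
  assumes "open S" "\<And>i. i \<in> I \<Longrightarrow> Ck_on S (f i) n"
  shows "Ck_on S (\<lambda>x. \<Sum>i\<in>I. f i x) n"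
  using assms(2)
  by (induction I rule: infinite_finite_induct) (auto intro: Ck_on_const Ck_on_add assms(1))

text \<open>The product rule contains \<open>f\<close> and \<open>g\<close> undifferentiated next to
  \<open>f'\<close> and \<open>g'\<close>, so the induction must run over all pairs, and
  \<open>Ck_on_SucD\<close> lowers the order of the undifferentiated factors.\<close>

lemma Ck_on_mult:
  fixes f g :: "'a::real_normed_vector \<Rightarrow> real"
  assumes "open S" "Ck_on S f n" "Ck_on S g n"
  shows "Ck_on S (\<lambda>x. f x * g x) n"
  using assms(2,3)
proof (induction n arbitrary: f g)
  case 0
  then show ?case by (auto intro: continuous_intros)
next
  case (Suc n)
  obtain f' where f': "\<And>x. x \<in> S \<Longrightarrow> (f has_derivative f' x) (at x)" "\<And>v. Ck_on S (\<lambda>x. f' x v) n"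
    using Ck_on_derivE[OF assms(1) Suc.prems(1)] by blast
  obtain g' where g': "\<And>x. x \<in> S \<Longrightarrow> (g has_derivative g' x) (at x)" "\<And>v. Ck_on S (\<lambda>x. g' x v) n"
    using Ck_on_derivE[OF assms(1) Suc.prems(2)] by blast
  show ?case
    by (rule Ck_on_derivI[OF assms(1), where f' = "\<lambda>x v. f x * g' x v + f' x v * g x"])
      (use f' g' Suc in \<open>auto intro!: has_derivative_mult Ck_on_add assms(1) Suc.IH dest: Ck_on_SucD simp del: Ck_on.simps\<close>)
qed

lemma Ck_on_scaleR_const:
  "open S \<Longrightarrow> Ck_on S f n \<Longrightarrow> Ck_on S (\<lambda>x. f x *\<^sub>R c) n"
  by (rule Ck_on_bounded_linear_comp[OF _ bounded_linear_scaleR_left])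

lemma Ck_on_minus: "open S \<Longrightarrow> Ck_on S f n \<Longrightarrow> Ck_on S (\<lambda>x. - f x) n"
  by (rule Ck_on_bounded_linear_comp[OF _ bounded_linear_minus[OF bounded_linear_ident]])

lemma Ck_on_diff:
  "open S \<Longrightarrow> Ck_on S f n \<Longrightarrow> Ck_on S g n \<Longrightarrow> Ck_on S (\<lambda>x. f x - g x) n"
  using Ck_on_add[of S f n "\<lambda>x. - g x"] Ck_on_minus[of S g n] by simp

lemma Ck_on_power:
  fixes f :: "'a::real_normed_vector \<Rightarrow> real"
  shows "open S \<Longrightarrow> Ck_on S f n \<Longrightarrow> Ck_on S (\<lambda>x. f x ^ k) n"
  by (induction k) (auto intro: Ck_on_const Ck_on_mult)

text \<open>The derivative is built from \<open>f'\<close> and the same reciprocal again, so the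
  hypothesis one order lower for the same \<open>f\<close>, together with closure under products,
  suffices. The square root follows the same pattern.\<close>

lemma Ck_on_inverse:
  fixes f :: "'a::real_normed_vector \<Rightarrow> real"
  assumes "open S" "Ck_on S f n" "\<And>x. x \<in> S \<Longrightarrow> f x \<noteq> 0"
  shows "Ck_on S (\<lambda>x. inverse (f x)) n"
  using assms(2)
proof (induction n)
  case 0
  then show ?case using assms(3) by (auto intro: continuous_intros)
next
  case (Suc n)
  obtain f' where f': "\<And>x. x \<in> S \<Longrightarrow> (f has_derivative f' x) (at x)" "\<And>v. Ck_on S (\<lambda>x. f' x v) n"
    using Ck_on_derivE[OF assms(1) Suc.prems] by blast
  show ?case
  proof (rule Ck_on_derivI[OF assms(1), where f' = "\<lambda>x v. - (inverse (f x) * f' x v * inverse (f x))"])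
    show "((\<lambda>x. inverse (f x)) has_derivative (\<lambda>v. - (inverse (f x) * f' x v * inverse (f x)))) (at x)"
      if "x \<in> S" for x
      by (rule Deriv.has_derivative_inverse[OF assms(3)[OF that] f'(1)[OF that]])
    show "Ck_on S (\<lambda>x. - (inverse (f x) * f' x v * inverse (f x))) n" for v
      using Suc.IH[OF Ck_on_SucD[OF Suc.prems]] f' assms(1)
      by (intro Ck_on_minus Ck_on_mult) auto
  qed
qed

lemma Ck_on_divide:
  fixes f g :: "'a::real_normed_vector \<Rightarrow> real"
  assumes "open S" "Ck_on S f n" "Ck_on S g n" "\<And>x. x \<in> S \<Longrightarrow> g x \<noteq> 0"
  shows "Ck_on S (\<lambda>x. f x / g x) n"
  unfolding divide_inverse by (intro Ck_on_mult Ck_on_inverse assms) (use assms(4) in blast)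

lemma Ck_on_sqrt:
  assumes "open S" "Ck_on S f n" "\<And>x. x \<in> S \<Longrightarrow> f x > 0"
  shows "Ck_on S (\<lambda>x. sqrt (f x)) n"
  using assms(2)
proof (induction n)
  case 0
  then show ?case by (auto intro: continuous_intros)
next
  case (Suc n)
  obtain f' where f': "\<And>x. x \<in> S \<Longrightarrow> (f has_derivative f' x) (at x)" "\<And>v. Ck_on S (\<lambda>x. f' x v) n"
    using Ck_on_derivE[OF assms(1) Suc.prems] by blast
  show ?case
  proof (rule Ck_on_derivI[OF assms(1), where f' = "\<lambda>x v. f' x v * inverse (2 * sqrt (f x))"])
    show "((\<lambda>x. sqrt (f x)) has_derivative (\<lambda>v. f' x v * inverse (2 * sqrt (f x)))) (at x)"
      if "x \<in> S" for x
      using f'(1)[OF that] assms(3)[OF that]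
      by (auto intro!: derivative_eq_intros simp: field_simps)
    show "Ck_on S (\<lambda>x. f' x v * inverse (2 * sqrt (f x))) n" for v
      using Suc.IH[OF Ck_on_SucD[OF Suc.prems]] f' assms(1,3)
      by (intro Ck_on_mult Ck_on_inverse Ck_on_const) (auto dest: assms(3))
  qed
qed

text \<open>No induction: the derivative is \<open>f'\<close> over \<open>1 + f^2\<close>, which the
  rules above already cover.\<close>

lemma Ck_on_arctan:
  assumes "open S" "Ck_on S f n"
  shows "Ck_on S (\<lambda>x. arctan (f x)) n"
proof (cases n)
  case 0
  then show ?thesis using assms by (auto intro: continuous_intros)
next
  case (Suc m)
  obtain f' where f': "\<And>x. x \<in> S \<Longrightarrow> (f has_derivative f' x) (at x)" "\<And>v. Ck_on S (\<lambda>x. f' x v) m"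
    using Ck_on_derivE[OF assms(1) assms(2)[unfolded Suc]] by blast
  show ?thesis unfolding Suc
  proof (rule Ck_on_derivI[OF assms(1), where f' = "\<lambda>x v. f' x v * inverse (1 + (f x)\<^sup>2)"])
    show "((\<lambda>x. arctan (f x)) has_derivative (\<lambda>v. f' x v * inverse (1 + (f x)\<^sup>2))) (at x)"
      if "x \<in> S" for x
      using f'(1)[OF that] by (auto intro!: derivative_eq_intros)
    have "1 + r\<^sup>2 \<noteq> 0" for r :: real
      by (simp add: add_pos_nonneg order_less_imp_not_eq2)
    then show "Ck_on S (\<lambda>x. f' x v * inverse (1 + (f x)\<^sup>2)) m" for v
      using f'(2) assms(1) Ck_on_SucD[OF assms(2)[unfolded Suc]]
      by (intro Ck_on_mult Ck_on_inverse Ck_on_add Ck_on_power Ck_on_const) auto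
  qed
qed

lemma Ck_on_vec_iff:
  fixes f :: "'a::real_normed_vector \<Rightarrow> real^'n"
  assumes "open S"
  shows "Ck_on S f n \<longleftrightarrow> (\<forall>i. Ck_on S (\<lambda>x. f x $ i) n)"
proof
  assume "Ck_on S f n"
  then show "\<forall>i. Ck_on S (\<lambda>x. f x $ i) n"
    using Ck_on_bounded_linear_comp[OF assms bounded_linear_vec_nth] by blast
next
  assume "\<forall>i. Ck_on S (\<lambda>x. f x $ i) n"
  then have "Ck_on S (\<lambda>x. \<Sum>i\<in>UNIV. f x $ i *\<^sub>R axis i (1::real)) n"
    by (intro Ck_on_sum Ck_on_scaleR_const assms) auto
  then show "Ck_on S f n"
    by (rule Ck_on_cong[OF assms]) (simp only: basis_expansion scalar_mult_eq_scaleR[symmetric])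
qed

lemma Ck_on_imp_continuous_on: "Ck_on S f n \<Longrightarrow> continuous_on S f"
  by (induction n) (auto simp: Ck_on_SucD simp del: Ck_on.simps(2))

lemma smooth_onD_Ck: "smooth_on S f \<Longrightarrow> Ck_on S f n"
  by (simp add: smooth_on_def)

lemma smooth_on_imp_continuous_on: "smooth_on S f \<Longrightarrow> continuous_on S f"
  using Ck_on_imp_continuous_on smooth_onD_Ck by blast

lemma smooth_on_subset: "smooth_on S f \<Longrightarrow> T \<subseteq> S \<Longrightarrow> smooth_on T f"
  by (auto simp: smooth_on_def intro: Ck_on_subset)

lemma smooth_on_has_derivative:
  assumes "smooth_on S f" "x \<in> S"
  shows "(f has_derivative frechet_derivative f (at x)) (at x)"
  using smooth_onD_Ck[OF assms(1), of 1] assms(2) by (simp add: frechet_derivative_works[symmetric])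

lemma smooth_on_deriv: "smooth_on S f \<Longrightarrow> smooth_on S (\<lambda>x. frechet_derivative f (at x) v)"
  using Ck_on.simps(2) unfolding smooth_on_def by blast

lemma smooth_on_vec_nth: "open S \<Longrightarrow> smooth_on S (\<lambda>x::real^'n. x $ i)"
  unfolding smooth_on_def using Ck_on_bounded_linear[OF _ bounded_linear_vec_nth] by blast

lemma smooth_on_vec_iff:
  fixes f :: "'a::real_normed_vector \<Rightarrow> real^'n"
  shows "open S \<Longrightarrow> smooth_on S f \<longleftrightarrow> (\<forall>i. smooth_on S (\<lambda>x. f x $ i))"
  unfolding smooth_on_def using Ck_on_vec_iff by blast

lemma smooth_on_intros:
  fixes f g :: "'a::real_normed_vector \<Rightarrow> real"
  assumes "open S"
  shows "smooth_on S (\<lambda>x. c::real)"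
    and "smooth_on S f \<Longrightarrow> smooth_on S g \<Longrightarrow> smooth_on S (\<lambda>x. f x + g x)"
    and "smooth_on S f \<Longrightarrow> smooth_on S g \<Longrightarrow> smooth_on S (\<lambda>x. f x - g x)"
    and "smooth_on S f \<Longrightarrow> smooth_on S (\<lambda>x. - f x)"
    and "smooth_on S f \<Longrightarrow> smooth_on S g \<Longrightarrow> smooth_on S (\<lambda>x. f x * g x)"
    and "smooth_on S f \<Longrightarrow> smooth_on S (\<lambda>x. f x ^ k)"
    and "smooth_on S f \<Longrightarrow> smooth_on S g \<Longrightarrow> (\<And>x. x \<in> S \<Longrightarrow> g x \<noteq> 0) \<Longrightarrow> smooth_on S (\<lambda>x. f x / g x)"
    and "smooth_on S f \<Longrightarrow> (\<And>x. x \<in> S \<Longrightarrow> f x > 0) \<Longrightarrow> smooth_on S (\<lambda>x. sqrt (f x))"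
    and "smooth_on S f \<Longrightarrow> smooth_on S (\<lambda>x. arctan (f x))"
  using assms unfolding smooth_on_def
  by (auto intro: Ck_on_const Ck_on_add Ck_on_diff Ck_on_minus Ck_on_mult
      Ck_on_power Ck_on_divide Ck_on_sqrt Ck_on_arctan)

section \<open>Symmetry of second derivatives, and the derivative of a left inverse\<close>

lemma has_real_derivative_along_line:
  assumes "(f has_derivative f') (at (a + s *\<^sub>R v))"
  shows "((\<lambda>s. f (a + s *\<^sub>R v)) has_real_derivative f' v) (at s)"
proof -
  interpret bounded_linear f' using assms by (rule has_derivative_bounded_linear)
  have "((\<lambda>s. f (a + s *\<^sub>R v)) has_derivative (\<lambda>t. f' (t *\<^sub>R v))) (at s)"
    by (rule has_derivative_compose[where f = "\<lambda>s. a + s *\<^sub>R v", OF _ assms])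
      (auto intro!: derivative_eq_intros)
  then show ?thesis
    by (simp add: has_field_derivative_def scaleR mult.commute[of _ "f' v"] o_def)
qed

text \<open>The mean value theorem is applied twice: along \<open>v\<close> to the difference of
  \<open>f\<close> on two opposite sides of the parallelogram, then along \<open>w\<close> to the
  resulting first derivative. The bound on \<open>h\<close> keeps the whole parallelogram inside the
  ball.\<close>

lemma second_difference_mean_value:
  fixes f :: "'a::real_normed_vector \<Rightarrow> real"
  assumes f: "\<And>y. y \<in> ball x r \<Longrightarrow> (f has_derivative f' y) (at y)"
    and f': "\<And>y. y \<in> ball x r \<Longrightarrow> ((\<lambda>y. f' y v) has_derivative f'' y) (at y)"
    and h: "0 < h" "h * (norm v + norm w) < r"
  obtains s t where "0 < s" "s < h" "0 < t" "t < h"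
    "f (x + h *\<^sub>R v + h *\<^sub>R w) - f (x + h *\<^sub>R v) - f (x + h *\<^sub>R w) + f x
       = h\<^sup>2 * f'' (x + s *\<^sub>R v + t *\<^sub>R w) w"
proof -
  have inball: "x + s *\<^sub>R v + t *\<^sub>R w \<in> ball x r" if "0 \<le> s" "s \<le> h" "0 \<le> t" "t \<le> h" for s t
  proof -
    have "norm (s *\<^sub>R v + t *\<^sub>R w) \<le> s * norm v + t * norm w"
      using that by (metis norm_triangle_le norm_scaleR abs_of_nonneg order_refl)
    also have "\<dots> \<le> h * norm v + h * norm w"
      using that by (intro add_mono mult_right_mono) auto
    also have "\<dots> < r" using h by (simp add: algebra_simps)
    finally show ?thesis by (simp add: dist_norm algebra_simps) (metis norm_minus_cancel minus_add_distrib add.commute uminus_add_conv_diff)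
  qed
  let ?\<phi> = "\<lambda>s. f (x + h *\<^sub>R w + s *\<^sub>R v) - f (x + s *\<^sub>R v)"
  have "\<exists>s. 0 < s \<and> s < h \<and> ?\<phi> h - ?\<phi> 0
      = (h - 0) * (f' (x + h *\<^sub>R w + s *\<^sub>R v) v - f' (x + s *\<^sub>R v) v)"
  proof (rule MVT2[OF h(1)])
    fix s assume s: "0 \<le> s" "s \<le> h"
    have "x + h *\<^sub>R w + s *\<^sub>R v \<in> ball x r" "x + s *\<^sub>R v \<in> ball x r"
      using inball[of s h] inball[of s 0] s h(1) by (auto simp: algebra_simps)
    then show "(?\<phi> has_real_derivative f' (x + h *\<^sub>R w + s *\<^sub>R v) v - f' (x + s *\<^sub>R v) v) (at s)"
      by (intro DERIV_diff has_real_derivative_along_line f)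
  qed
  then obtain s where s: "0 < s" "s < h"
    "?\<phi> h - ?\<phi> 0 = h * (f' (x + h *\<^sub>R w + s *\<^sub>R v) v - f' (x + s *\<^sub>R v) v)"
    by auto
  let ?\<psi> = "\<lambda>t. f' (x + s *\<^sub>R v + t *\<^sub>R w) v"
  have "\<exists>t. 0 < t \<and> t < h \<and> ?\<psi> h - ?\<psi> 0 = (h - 0) * f'' (x + s *\<^sub>R v + t *\<^sub>R w) w"
  proof (rule MVT2[OF h(1)])
    fix t assume t: "0 \<le> t" "t \<le> h"
    show "(?\<psi> has_real_derivative f'' (x + s *\<^sub>R v + t *\<^sub>R w) w) (at t)"
      using inball[of s t] t s by (intro has_real_derivative_along_line f') auto
  qed
  then obtain t where t: "0 < t" "t < h" "?\<psi> h - ?\<psi> 0 = h * f'' (x + s *\<^sub>R v + t *\<^sub>R w) w"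
    by auto
  have "f (x + h *\<^sub>R v + h *\<^sub>R w) - f (x + h *\<^sub>R v) - f (x + h *\<^sub>R w) + f x = h * (?\<psi> h - ?\<psi> 0)"
    using s(3) by (simp add: algebra_simps)
  also have "\<dots> = h\<^sup>2 * f'' (x + s *\<^sub>R v + t *\<^sub>R w) w"
    unfolding t(3) by (simp add: power2_eq_square)
  finally show ?thesis using that s t by blast
qed

text \<open>The second difference of \<open>f\<close> is symmetric in \<open>v\<close> and
  \<open>w\<close>, so both mixed derivatives take a common value at points arbitrarily close to
  \<open>x\<close>. By continuity each is within half of the supposed gap \<open>?e\<close> of its
  value at \<open>x\<close>, a contradiction.\<close>

lemma smooth_on_second_derivative_symmetric:
  fixes f :: "'a::real_normed_vector \<Rightarrow> real"
  assumes S: "open S" "x \<in> S" and f: "smooth_on S f"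
  shows "frechet_derivative (\<lambda>y. frechet_derivative f (at y) v) (at x) w
       = frechet_derivative (\<lambda>y. frechet_derivative f (at y) w) (at x) v"
proof (rule ccontr)
  define g where "g = (\<lambda>v w y. frechet_derivative (\<lambda>y. frechet_derivative f (at y) v) (at y) w)"
  assume "\<not> ?thesis"
  then have e: "\<bar>g v w x - g w v x\<bar> / 2 > 0" (is "?e > 0")
    unfolding g_def by simp
  obtain r where r: "r > 0" "ball x r \<subseteq> S"
    using S open_contains_ball by blast
  have cont: "continuous (at x) (g v w)" for v w
    using smooth_on_imp_continuous_on[OF smooth_on_deriv[OF smooth_on_deriv[OF f]]] S
    unfolding g_def by (simp add: continuous_on_eq_continuous_at)
  obtain d1 where d1: "d1 > 0" "\<And>y. dist y x < d1 \<Longrightarrow> dist (g v w y) (g v w x) < ?e"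
    using cont[of v w] e unfolding continuous_at_eps_delta by (metis dist_commute)
  obtain d2 where d2: "d2 > 0" "\<And>y. dist y x < d2 \<Longrightarrow> dist (g w v y) (g w v x) < ?e"
    using cont[of w v] e unfolding continuous_at_eps_delta by (metis dist_commute)
  define d where "d = min r (min d1 d2)"
  define h where "h = d / (2 * (norm v + norm w + 1))"
  have d: "d > 0" "d \<le> r" "d \<le> d1" "d \<le> d2" using r d1 d2 by (auto simp: d_def)
  have pos: "norm v + norm w + 1 > 0" by (simp add: add_nonneg_pos)
  have h: "h > 0" using d pos by (simp add: h_def)
  have hd: "h * (norm v + norm w) < d"
  proof -
    have "h * (norm v + norm w) \<le> h * (norm v + norm w + 1)" using h by simp
    also have "\<dots> = d / 2" using pos by (simp add: h_def field_simps)
    finally show ?thesis using d by simp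
  qed
  then have hd': "h * (norm w + norm v) < d" by (simp add: add.commute)
  have der: "(f has_derivative frechet_derivative f (at y)) (at y)"
    "((\<lambda>y. frechet_derivative f (at y) v) has_derivative (\<lambda>w. g v w y)) (at y)"
    if "y \<in> ball x d" for y v
  proof -
    have "y \<in> S" using that r(2) d(2) by auto
    then show "(f has_derivative frechet_derivative f (at y)) (at y)"
      "((\<lambda>y. frechet_derivative f (at y) v) has_derivative (\<lambda>w. g v w y)) (at y)"
      using smooth_on_has_derivative[OF f] smooth_on_has_derivative[OF smooth_on_deriv[OF f, of v]]
      unfolding g_def by auto
  qed
  have near: "dist (x + s *\<^sub>R v + t *\<^sub>R w) x < d" if "0 < s" "s < h" "0 < t" "t < h" for s t
  proof -
    have "norm (s *\<^sub>R v + t *\<^sub>R w) \<le> s * norm v + t * norm w"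
      using that by (metis norm_triangle_le norm_scaleR abs_of_pos order_refl)
    also have "\<dots> \<le> h * norm v + h * norm w"
      using that by (intro add_mono mult_right_mono) auto
    finally show ?thesis using hd by (simp add: dist_norm algebra_simps)
  qed
  obtain s t where st: "0 < s" "s < h" "0 < t" "t < h"
    "f (x + h *\<^sub>R v + h *\<^sub>R w) - f (x + h *\<^sub>R v) - f (x + h *\<^sub>R w) + f x
       = h\<^sup>2 * g v w (x + s *\<^sub>R v + t *\<^sub>R w)"
    by (rule second_difference_mean_value[OF der(1) der(2)[where v = v] h hd])
  obtain t' s' where st': "0 < t'" "t' < h" "0 < s'" "s' < h"
    "f (x + h *\<^sub>R w + h *\<^sub>R v) - f (x + h *\<^sub>R w) - f (x + h *\<^sub>R v) + f x
       = h\<^sup>2 * g w v (x + t' *\<^sub>R w + s' *\<^sub>R v)"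
    by (rule second_difference_mean_value[OF der(1) der(2)[where v = w] h hd'])
  have "x + t' *\<^sub>R w + s' *\<^sub>R v = x + s' *\<^sub>R v + t' *\<^sub>R w" by simp
  then have near': "dist (x + t' *\<^sub>R w + s' *\<^sub>R v) x < d" using near st' by metis
  have "x + h *\<^sub>R w + h *\<^sub>R v = x + h *\<^sub>R v + h *\<^sub>R w" by simp
  then have "f (x + h *\<^sub>R w + h *\<^sub>R v) = f (x + h *\<^sub>R v + h *\<^sub>R w)" by (rule arg_cong)
  then have "h\<^sup>2 * g v w (x + s *\<^sub>R v + t *\<^sub>R w) = h\<^sup>2 * g w v (x + t' *\<^sub>R w + s' *\<^sub>R v)"
    using st(5) st'(5) by linarith
  then have "g v w (x + s *\<^sub>R v + t *\<^sub>R w) = g w v (x + t' *\<^sub>R w + s' *\<^sub>R v)"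
    using h by simp
  moreover have "dist (g v w (x + s *\<^sub>R v + t *\<^sub>R w)) (g v w x) < ?e"
    using near[OF st(1-4)] d by (intro d1(2)) auto
  moreover have "dist (g w v (x + t' *\<^sub>R w + s' *\<^sub>R v)) (g w v x) < ?e"
    using near' d by (intro d2(2)) auto
  ultimately show False
    unfolding dist_real_def by argo
qed

lemma zero_derivative_imp_const_on_ball:
  fixes f :: "'a::real_normed_vector \<Rightarrow> real"
  assumes "\<And>x. x \<in> ball a r \<Longrightarrow> (f has_derivative (\<lambda>v. 0)) (at x)" "x \<in> ball a r"
  shows "f x = f a"
proof -
  have "0 < r" using assms(2) by (auto dest: le_less_trans[OF zero_le_dist])
  then show ?thesis
    using has_derivative_zero_unique[of "ball a r" f a x] assms has_derivative_at_withinI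
    by (metis centre_in_ball convex_ball)
qed

text \<open>Intended for inverses of charts, defined only on a surface: \<open>f'\<close> is merely
  injective and \<open>g'\<close> is any left inverse of it. Applying \<open>g'\<close> to the
  remainder of \<open>f\<close> at \<open>g z\<close> bounds the remainder of \<open>g\<close> by a
  small multiple of \<open>norm (g z - g y)\<close>; continuity of \<open>g\<close> makes this
  usable.\<close>

lemma has_derivative_left_inverse_within:
  fixes f :: "'a::real_normed_vector \<Rightarrow> 'b::real_normed_vector"
  assumes f: "(f has_derivative f') (at (g y))"
    and g': "bounded_linear g'" "\<And>h. g' (f' h) = h"
    and g: "continuous (at y within T) g"
    and y: "y \<in> T" and fg: "\<And>z. z \<in> T \<Longrightarrow> f (g z) = z"
  shows "(g has_derivative g') (at y within T)"
proof -
  interpret f': bounded_linear f' using f by (rule has_derivative_bounded_linear)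
  interpret g': bounded_linear g' by fact
  obtain C where C: "0 < C" "\<And>x. norm (g' x) \<le> norm x * C"
    using g'.pos_bounded by blast
  have step: "\<exists>d>0. \<forall>z\<in>T. norm (z - y) < d \<longrightarrow>
      norm (g z - g y - g' (z - y)) \<le> e * norm (g z - g y)" if e: "e > 0" for e
  proof -
    obtain d0 where d0: "0 < d0"
      "\<And>u. norm (u - g y) < d0 \<Longrightarrow> norm (f u - f (g y) - f' (u - g y)) \<le> e / C * norm (u - g y)"
      using f e C(1) unfolding has_derivative_at_alt by (meson divide_pos_pos)
    obtain d where d: "0 < d" "\<And>z. z \<in> T \<Longrightarrow> norm (z - y) < d \<Longrightarrow> norm (g z - g y) < d0"
      using g d0(1) unfolding continuous_within_eps_delta by (metis dist_norm)
    have "norm (g z - g y - g' (z - y)) \<le> e * norm (g z - g y)" if z: "z \<in> T" "norm (z - y) < d" for z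
    proof -
      have "g z - g y - g' (z - y) = - g' (f (g z) - f (g y) - f' (g z - g y))"
        by (simp add: fg z y g'.diff g'(2))
      also have "norm \<dots> \<le> norm (f (g z) - f (g y) - f' (g z - g y)) * C"
        using C(2) by simp
      also have "\<dots> \<le> (e / C * norm (g z - g y)) * C"
        using C(1) by (intro mult_right_mono d0(2) d(2) z) auto
      finally show ?thesis using C(1) by simp
    qed
    with d(1) show ?thesis by blast
  qed
  obtain d1 where d1: "d1 > 0" "\<And>z. z \<in> T \<Longrightarrow> norm (z - y) < d1 \<Longrightarrow>
      norm (g z - g y - g' (z - y)) \<le> 1/2 * norm (g z - g y)"
    using step[of "1/2"] by auto
  \<comment> \<open>With the factor 1/2 the remainder is absorbed on the left, which makes
    \<open>g\<close> Lipschitz at \<open>y\<close> and turns bounds in \<open>g z - g y\<close> into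
    bounds in \<open>z - y\<close>.\<close>
  have lip: "norm (g z - g y) \<le> 2 * C * norm (z - y)" if z: "z \<in> T" "norm (z - y) < d1" for z
  proof -
    have "norm (g z - g y) \<le> norm (g z - g y - g' (z - y)) + norm (g' (z - y))"
      using norm_triangle_ineq[of "g z - g y - g' (z - y)" "g' (z - y)"] by simp
    also have "\<dots> \<le> 1/2 * norm (g z - g y) + norm (z - y) * C"
      using d1(2)[OF z] C(2) by (intro add_mono) auto
    finally show ?thesis by (simp add: algebra_simps)
  qed
  show ?thesis
    unfolding has_derivative_within_alt
  proof (intro conjI allI impI)
    fix e :: real assume e: "e > 0"
    \<comment> \<open>The divisor \<open>2 * C\<close> compensates the Lipschitz constant in
      \<open>lip\<close>.\<close>
    obtain d where d: "d > 0" "\<And>z. z \<in> T \<Longrightarrow> norm (z - y) < d \<Longrightarrow>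
        norm (g z - g y - g' (z - y)) \<le> e / (2 * C) * norm (g z - g y)"
      using step[of "e / (2 * C)"] e C(1) by auto
    show "\<exists>d>0. \<forall>z\<in>T. norm (z - y) < d \<longrightarrow> norm (g z - g y - g' (z - y)) \<le> e * norm (z - y)"
    proof (intro exI[of _ "min d d1"] conjI ballI impI)
      fix z assume z: "z \<in> T" "norm (z - y) < min d d1"
      have "norm (g z - g y - g' (z - y)) \<le> e / (2 * C) * norm (g z - g y)"
        using d(2) z by simp
      also have "\<dots> \<le> e / (2 * C) * (2 * C * norm (z - y))"
        using lip z e C(1) by (intro mult_left_mono) auto
      finally show "norm (g z - g y - g' (z - y)) \<le> e * norm (z - y)"
        using C(1) by simp
    qed (use d d1 in auto)
  qed (rule g'(1))
qed

section \<open>The geometry of the ambient space in coordinates\<close>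

lemma metric_inner_H2R:
  "metric_inner H2R_metric p v w = v $ 1 * w $ 1 / (p $ 2)\<^sup>2 + v $ 2 * w $ 2 / (p $ 2)\<^sup>2 + v $ 3 * w $ 3"
  by (simp add: metric_inner_def H2R_metric_def sum_3)

lemma matrix_inv_eqI:
  fixes A :: "real^'n^'n"
  assumes "A ** B = mat 1" "B ** A = mat 1"
  shows "matrix_inv A = B"
proof -
  have "A ** matrix_inv A = mat 1 \<and> matrix_inv A ** A = mat 1"
    unfolding matrix_inv_def by (rule someI[of _ B]) (simp add: assms)
  then have "B ** (A ** matrix_inv A) = B" by simp
  then show ?thesis by (simp add: matrix_mul_assoc assms)
qed

lemma has_derivative_inverse_square_coord:
  fixes p :: "real^'n"
  assumes "p $ k \<noteq> 0"
  shows "((\<lambda>q. 1 / (q $ k)\<^sup>2) has_derivative (\<lambda>v. - 2 * v $ k / (p $ k) ^ 3)) (at p)"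
proof -
  have "((\<lambda>q::real^'n. q $ k) has_derivative (\<lambda>v. v $ k)) (at p)"
    by (intro bounded_linear_imp_has_derivative bounded_linear_vec_nth)
  then show ?thesis
    using assms by (auto intro!: derivative_eq_intros simp: field_simps power2_eq_square power3_eq_cube)
qed

lemma coord_deriv_eqI: "(h has_derivative h') (at p) \<Longrightarrow> coord_deriv i h p = h' (axis i 1)"
  unfolding coord_deriv_def by (simp add: frechet_derivative_at[symmetric])

lemma coord_deriv_const: "coord_deriv i (\<lambda>q. c) p = 0"
  by (simp add: coord_deriv_def)

lemma coord_deriv_inverse_square:
  fixes p :: "real^'n"
  assumes "p $ k \<noteq> 0"
  shows "coord_deriv i (\<lambda>q. 1 / (q $ k)\<^sup>2) p = (if i = k then - 2 / (p $ k) ^ 3 else 0)"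
  using coord_deriv_eqI[OF has_derivative_inverse_square_coord[OF assms], of i] by (simp add: axis_def)

lemma H2R_metric_nth:
  "H2R_metric p $ i $ j = (if i \<noteq> j then 0 else if i = 3 then 1 else 1 / (p $ 2)\<^sup>2)"
  by (simp add: H2R_metric_def)

lemma H2_metric_nth: "H2_metric p $ i $ j = (if i = j then 1 / (p $ 2)\<^sup>2 else 0)"
  by (simp add: H2_metric_def)

lemma matrix_inv_H2R:
  assumes "p $ 2 > 0"
  shows "matrix_inv (H2R_metric p) = (\<chi> i j. if i \<noteq> j then 0 else if i = 3 then 1 else (p $ 2)\<^sup>2)"
  using assms
  by (intro matrix_inv_eqI)
    (auto simp: vec_eq_iff matrix_matrix_mult_def H2R_metric_nth sum_3 mat_def forall_3)

lemma matrix_inv_H2: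
  assumes "p $ 2 > 0"
  shows "matrix_inv (H2_metric p) = (\<chi> i j. if i = j then (p $ 2)\<^sup>2 else 0)"
  using assms
  by (intro matrix_inv_eqI)
    (auto simp: vec_eq_iff matrix_matrix_mult_def H2_metric_nth sum_2 mat_def forall_2)

lemma christoffel_form_H2R:
  assumes "p $ 2 > 0"
  shows "christoffel_form H2R_metric p v w =
    vector [- (v $ 1 * w $ 2 + v $ 2 * w $ 1) / p $ 2, (v $ 1 * w $ 1 - v $ 2 * w $ 2) / p $ 2, 0]"
proof -
  have ne: "p $ 2 \<noteq> 0" using assms by simp
  have d: "coord_deriv i (\<lambda>q. H2R_metric q $ j $ l) p
      = (if i = 2 \<and> j = l \<and> j \<noteq> 3 then - 2 / (p $ 2) ^ 3 else 0)" for i j l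
    by (cases "j = l"; cases "j = 3")
      (auto simp: H2R_metric_nth coord_deriv_const coord_deriv_inverse_square[OF ne])
  show ?thesis
    using assms
    by (simp add: vec_eq_iff forall_3 christoffel_form_def christoffel_def d matrix_inv_H2R sum_3
        vector_3 field_simps power2_eq_square power3_eq_cube)
qed

lemma christoffel_form_H2:
  assumes "p $ 2 > 0"
  shows "christoffel_form H2_metric p v w =
    vector [- (v $ 1 * w $ 2 + v $ 2 * w $ 1) / p $ 2, (v $ 1 * w $ 1 - v $ 2 * w $ 2) / p $ 2]"
proof -
  have ne: "p $ 2 \<noteq> 0" using assms by simp
  have d: "coord_deriv i (\<lambda>q. H2_metric q $ j $ l) p
      = (if i = 2 \<and> j = l then - 2 / (p $ 2) ^ 3 else 0)" for i j l
    by (cases "j = l") (auto simp: H2_metric_nth coord_deriv_const coord_deriv_inverse_square[OF ne])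
  show ?thesis
    using assms
    by (simp add: vec_eq_iff forall_2 christoffel_form_def christoffel_def d matrix_inv_H2 sum_2
        vector_2 field_simps power2_eq_square power3_eq_cube)
qed

text \<open>Components of a vector in the orthonormal frame \<open>y \<partial>\<^sub>x, y \<partial>\<^sub>y, \<partial>\<^sub>z\<close>.\<close>

definition frame :: "real^3 \<Rightarrow> real^3 \<Rightarrow> real^3" where
  "frame p v = vector [v $ 1 / p $ 2, v $ 2 / p $ 2, v $ 3]"

lemma frame_nth [simp]:
  "frame p v $ 1 = v $ 1 / p $ 2" "frame p v $ 2 = v $ 2 / p $ 2" "frame p v $ 3 = v $ 3"
  by (simp_all add: frame_def vector_3)

lemma inner_frame: "frame p v \<bullet> frame p w = metric_inner H2R_metric p v w"
  by (simp add: metric_inner_H2R inner_vec_def sum_3 power2_eq_square)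

lemma frame_vector [simp]:
  "p $ 2 \<noteq> 0 \<Longrightarrow> frame p (vector [p $ 2 * a, p $ 2 * b, c]) = vector [a, b, c]"
  by (simp add: frame_def vector_3)

lemma linear_frame: "linear (frame p)"
  by (rule linearI) (simp_all add: vec_eq_iff forall_3 add_divide_distrib)

lemma frame_eq_iff: "p $ 2 \<noteq> 0 \<Longrightarrow> frame p v = frame p w \<longleftrightarrow> v = w"
  by (auto simp: vec_eq_iff forall_3)

text \<open>The first vector is the product-rule derivative of the coordinate components
  \<open>(y a, y b, \<nu>)\<close>. The Christoffel terms cancel \<open>v $ 2 * a\<close> and
  \<open>v $ 2 * b\<close>, leaving only the rotation of \<open>(a, b)\<close> by the connection
  form \<open>frame p v $ 1\<close>.\<close>

lemma shape_equation_frame_iff: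
  assumes "p $ 2 > 0"
  shows "- (vector [v $ 2 * a + p $ 2 * a', v $ 2 * b + p $ 2 * b', \<nu>']
        + christoffel_form H2R_metric p v (vector [p $ 2 * a, p $ 2 * b, \<nu>])) = l *\<^sub>R v
    \<longleftrightarrow> a' = (b - l) * frame p v $ 1 \<and> b' = - a * frame p v $ 1 - l * frame p v $ 2
        \<and> \<nu>' = - l * frame p v $ 3"
proof -
  have "christoffel_form H2R_metric p v (vector [p $ 2 * a, p $ 2 * b, \<nu>])
      = vector [- (v $ 1 * b + v $ 2 * a), v $ 1 * a - v $ 2 * b, 0]"
    using assms by (simp add: christoffel_form_H2R vec_eq_iff forall_3 vector_3 field_simps)
  then show ?thesis
    using assms by (auto simp: vec_eq_iff forall_3 vector_3 field_simps)
qed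

text \<open>By Lagrange's formula the product of \<open>n\<close> with \<open>cross3 a b\<close> is
  a combination of \<open>a\<close> and \<open>b\<close> with coefficients
  \<open>n \<bullet> b\<close> and \<open>n \<bullet> a\<close> up to sign, hence zero.\<close>

lemma orthogonal_pair_imp_parallel_cross:
  assumes "n \<bullet> a = 0" "n \<bullet> b = 0" "cross3 a b \<noteq> 0"
  obtains c where "n = c *\<^sub>R cross3 a b"
proof -
  have "cross3 n (cross3 a b) = 0"
    using assms(1,2) by (simp add: Lagrange)
  then have "collinear {0, cross3 a b, n}"
    unfolding cross_eq_0 by (simp only: insert_commute)
  then show ?thesis
    using that[of 0] that assms(3) unfolding collinear_lemma by (elim disjE exE) simp_all
qed

lemma unit_normals_eq_up_to_sign:
  fixes n m :: "real^3"
  assumes "n \<bullet> a = 0" "n \<bullet> b = 0" "m \<bullet> a = 0" "m \<bullet> b = 0" "cross3 a b \<noteq> 0"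
    and "n \<bullet> n = 1" "m \<bullet> m = 1"
  shows "n = m \<or> n = - m"
proof -
  obtain c d where n: "n = c *\<^sub>R cross3 a b" and m: "m = d *\<^sub>R cross3 a b"
    using orthogonal_pair_imp_parallel_cross assms by metis
  have "c\<^sup>2 * (cross3 a b \<bullet> cross3 a b) = d\<^sup>2 * (cross3 a b \<bullet> cross3 a b)"
    using assms(6,7) unfolding n m power2_eq_square
    by (metis inner_scaleR_left inner_scaleR_right mult.assoc)
  then have "c\<^sup>2 = d\<^sup>2" using assms(5) by simp
  then show ?thesis using n m by (auto simp: power2_eq_iff)
qed

lemma cross_frame_nonzero:
  fixes A :: "real^2 \<Rightarrow> real^3"
  assumes "linear A" "inj A" "p $ 2 \<noteq> 0"
  shows "cross3 (frame p (A (axis 1 1))) (frame p (A (axis 2 1))) \<noteq> 0"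
proof
  interpret FA: linear "frame p \<circ> A"
    by (rule linear_compose[OF assms(1) linear_frame])
  have inj: "w = 0" if "(frame p \<circ> A) w = 0" for w
  proof -
    have "frame p (A w) = frame p (A 0)" using that FA.zero by simp
    then show ?thesis using assms by (simp add: frame_eq_iff inj_eq)
  qed
  assume "cross3 (frame p (A (axis 1 1))) (frame p (A (axis 2 1))) = 0"
  then consider "(frame p \<circ> A) (axis 1 1) = 0" | "(frame p \<circ> A) (axis 2 1) = 0"
    | c where "(frame p \<circ> A) (axis 2 1) = c *\<^sub>R (frame p \<circ> A) (axis 1 1)"
    unfolding cross_eq_0 collinear_lemma by auto
  then show False
  proof cases
    case 3
    then have "(frame p \<circ> A) (axis 2 1 - c *\<^sub>R axis 1 1) = 0"
      by (simp add: FA.diff FA.scaleR del: o_apply)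
    from inj[OF this] have "(axis 2 1 - c *\<^sub>R axis 1 1 :: real^2) $ 2 = 0" by simp
    then show False by (simp add: axis_def)
  qed (use inj axis_eq_0_iff in force)+
qed

section \<open>Local parametrizations\<close>

lemma openin_Int_relative:
  "openin (top_of_set M) B \<Longrightarrow> A \<subseteq> M \<Longrightarrow> openin (top_of_set A) (A \<inter> B)"
  by (auto simp: openin_open)

lemma local_paramD:
  assumes "local_param M V X"
  shows "open V" "smooth_on V X" "openin (top_of_set M) (X ` V)"
    "u \<in> V \<Longrightarrow> (X has_derivative frechet_derivative X (at u)) (at u)"
    "u \<in> V \<Longrightarrow> inj (frechet_derivative X (at u))"
  using assms smooth_on_has_derivative unfolding local_param_def by auto

lemma local_param_openin_trans:
  assumes "local_param U V X" "openin (top_of_set M) U"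
  shows "local_param M V X"
  using assms openin_trans unfolding local_param_def by blast

lemma local_param_restrict:
  assumes X: "local_param M V X" and W: "open W" "W \<subseteq> V"
  shows "local_param M W X" "local_param (X ` W) W X"
proof -
  obtain Y where Y: "homeomorphism V (X ` V) X Y"
    using X unfolding local_param_def by blast
  have YW: "homeomorphism W (X ` W) X Y"
    using homeomorphism_of_subsets[OF Y W(2)] by auto
  have "openin (top_of_set (X ` V)) (X ` W)"
    using homeomorphism_imp_open_map[OF Y, of W] W by (simp add: open_subset openin_open_eq local_paramD(1)[OF X])
  then have "openin (top_of_set M) (X ` W)"
    using local_paramD(3)[OF X] openin_trans by blast
  then show "local_param M W X" "local_param (X ` W) W X"
    using X W YW unfolding local_param_def by (auto intro: smooth_on_subset)
qed

text \<open>The definition of \<open>local_param\<close> provides only a continuous inverse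
  \<open>Y\<close>. Its differentiability relative to the image comes from the injective derivative
  of \<open>X\<close>, with any linear left inverse as \<open>L\<close>.\<close>

lemma local_param_left_inverse:
  assumes "local_param M V X"
  obtains Y where "homeomorphism V (X ` V) X Y"
    "\<And>u. u \<in> V \<Longrightarrow> \<exists>L. (Y has_derivative L) (at (X u) within X ` V) \<and>
        (\<forall>h. L (frechet_derivative X (at u) h) = h)"
proof -
  obtain Y where Y: "homeomorphism V (X ` V) X Y"
    using assms unfolding local_param_def by blast
  have "\<exists>L. (Y has_derivative L) (at (X u) within X ` V) \<and> (\<forall>h. L (frechet_derivative X (at u) h) = h)"
    if u: "u \<in> V" for u
  proof -
    have YX: "Y (X u) = u" using Y u by (simp add: homeomorphism_apply1)
    have "linear (frechet_derivative X (at u))"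
      using local_paramD(4)[OF assms u] has_derivative_linear by blast
    then obtain L where L: "linear L" "L \<circ> frechet_derivative X (at u) = id"
      using linear_injective_left_inverse local_paramD(5)[OF assms u] by blast
    have "(Y has_derivative L) (at (X u) within X ` V)"
    proof (rule has_derivative_left_inverse_within[where f = X and f' = "frechet_derivative X (at u)"])
      show "continuous (at (X u) within X ` V) Y"
        using homeomorphism_cont2[OF Y] u by (simp add: continuous_on_eq_continuous_within)
    qed (use YX u L local_paramD(4)[OF assms u] Y in
        \<open>auto simp: fun_eq_iff homeomorphism_apply1 homeomorphism_apply2 linear_conv_bounded_linear\<close>)
    then show ?thesis using L by (auto simp: fun_eq_iff)
  qed
  with Y that show ?thesis by blast
qed

text \<open>\<open>tangent_plane\<close> collects vectors from all charts through the point. Another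
  chart factors locally as \<open>X' = X \<circ> (Y \<circ> X')\<close>, and the chain rule puts its
  velocities into the range of the derivative of \<open>X\<close>.\<close>

lemma tangent_plane_eq:
  assumes X: "local_param M V X" "u \<in> V"
  shows "tangent_plane M (X u) = range (frechet_derivative X (at u))"
proof
  show "range (frechet_derivative X (at u)) \<subseteq> tangent_plane M (X u)"
    using X unfolding tangent_plane_def by blast
  show "tangent_plane M (X u) \<subseteq> range (frechet_derivative X (at u))"
  proof
    fix v assume "v \<in> tangent_plane M (X u)"
    then obtain V' X' u' w where X': "local_param M V' X'" "u' \<in> V'" "X' u' = X u"
      and v: "v = frechet_derivative X' (at u') w"
      unfolding tangent_plane_def by blast
    obtain Y L where Y: "homeomorphism V (X ` V) X Y"
      and L: "(Y has_derivative L) (at (X u) within X ` V)"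
      using local_param_left_inverse[OF X(1)] X(2) by metis
    \<comment> \<open>The part of \<open>V'\<close> mapped into the patch of \<open>X\<close>; its
      openness turns derivatives within \<open>A\<close> into ordinary ones.\<close>
    define A where "A = V' \<inter> X' -` (X ` V)"
    have "openin (top_of_set (X' ` V')) (X' ` V' \<inter> X ` V)"
      by (rule openin_Int_relative[OF local_paramD(3)[OF X(1)] openin_imp_subset[OF local_paramD(3)[OF X'(1)]]])
    then have "openin (top_of_set V') (V' \<inter> X' -` (X' ` V' \<inter> X ` V))"
      using continuous_on_open[of V' X'] smooth_on_imp_continuous_on[OF local_paramD(2)[OF X'(1)]] by blast
    moreover have "V' \<inter> X' -` (X' ` V' \<inter> X ` V) = A" by (auto simp: A_def)
    ultimately have A: "open A"
      using local_paramD(1)[OF X'(1)] openin_open_trans by metis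
    have uA: "u' \<in> A" using X' X(2) by (auto simp: A_def)
    have "(X' has_derivative frechet_derivative X' (at u')) (at u' within A)"
      using local_paramD(4)[OF X'(1,2)] by (rule has_derivative_at_withinI)
    moreover have "(Y has_derivative L) (at (X' u') within X' ` A)"
      unfolding X'(3) by (rule has_derivative_subset[OF L]) (auto simp: A_def)
    ultimately have YX': "((Y \<circ> X') has_derivative L \<circ> frechet_derivative X' (at u')) (at u' within A)"
      by (rule diff_chain_within)
    have "Y (X' u') = u" using X'(3) Y X(2) by (simp add: homeomorphism_apply1)
    then have "(X has_derivative frechet_derivative X (at u)) (at ((Y \<circ> X') u') within (Y \<circ> X') ` A)"
      using local_paramD(4)[OF X] by (simp add: has_derivative_at_withinI)
    from diff_chain_within[OF YX' this]
    have "((X \<circ> (Y \<circ> X')) has_derivative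
        frechet_derivative X (at u) \<circ> (L \<circ> frechet_derivative X' (at u'))) (at u')"
      unfolding at_within_open[OF uA A] .
    then have "(X' has_derivative frechet_derivative X (at u) \<circ> (L \<circ> frechet_derivative X' (at u'))) (at u')"
      by (rule has_derivative_transform_within_open[OF _ A uA])
        (use Y in \<open>auto simp: A_def homeomorphism_apply1\<close>)
    then have "frechet_derivative X' (at u')
        = frechet_derivative X (at u) \<circ> (L \<circ> frechet_derivative X' (at u'))"
      using frechet_derivative_at by metis
    then show "v \<in> range (frechet_derivative X (at u))"
      unfolding v by (metis comp_apply rangeI)
  qed
qed

text \<open>By invariance of domain, without an implicit function theorem.\<close>

lemma local_param_image_openin:
  assumes S: "regular_surface S" and X: "local_param M V X" and sub: "X ` V \<subseteq> S"
  shows "openin (top_of_set S) (X ` V)"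
proof (subst openin_subopen, intro ballI)
  fix p assume p: "p \<in> X ` V"
  then obtain V' X' where X': "local_param S V' X'" "p \<in> X' ` V'"
    using S sub unfolding regular_surface_def by blast
  obtain Y' where Y': "homeomorphism V' (X' ` V') X' Y'"
    using X'(1) unfolding local_param_def by blast
  obtain Y where Y: "homeomorphism V (X ` V) X Y"
    using X unfolding local_param_def by blast
  define A where "A = V \<inter> X -` (X' ` V')"
  have contX: "continuous_on V X" using Y by (simp add: homeomorphism_def)
  have "openin (top_of_set (X ` V)) (X ` V \<inter> X' ` V')"
    by (rule openin_Int_relative[OF local_paramD(3)[OF X'(1)] sub])
  then have "openin (top_of_set V) (V \<inter> X -` (X ` V \<inter> X' ` V'))"
    using continuous_on_open[of V X] contX by blast
  moreover have "V \<inter> X -` (X ` V \<inter> X' ` V') = A" by (auto simp: A_def)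
  ultimately have A: "open A"
    using local_paramD(1)[OF X] openin_open_trans by metis
  have "X ` A \<subseteq> X' ` V'" by (auto simp: A_def)
  \<comment> \<open>\<open>Y' \<circ> X\<close> is a continuous injection between subsets of the
    plane; equality of the two dimensions is what makes the piece open in \<open>S\<close>.\<close>
  have "open ((Y' \<circ> X) ` A)"
  proof (rule invariance_of_domain[OF _ A])
    show "continuous_on A (Y' \<circ> X)"
      using Y' \<open>X ` A \<subseteq> X' ` V'\<close> contX
      by (intro continuous_on_compose)
        (auto simp: A_def homeomorphism_def intro: continuous_on_subset)
    show "inj_on (Y' \<circ> X) A"
    proof (rule inj_onI)
      fix s t assume st: "s \<in> A" "t \<in> A" "(Y' \<circ> X) s = (Y' \<circ> X) t"
      then have "X s = X t"
        using Y' \<open>X ` A \<subseteq> X' ` V'\<close> by (metis comp_apply homeomorphism_apply2 image_subset_iff)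
      then show "s = t" using st Y by (metis A_def IntD1 homeomorphism_apply1)
    qed
  qed
  then have "openin (top_of_set V') ((Y' \<circ> X) ` A)"
    using Y' \<open>X ` A \<subseteq> X' ` V'\<close> local_paramD(1)[OF X'(1)]
    by (intro open_subset) (auto simp: homeomorphism_def)
  then have "openin (top_of_set (X' ` V')) (X' ` (Y' \<circ> X) ` A)"
    using homeomorphism_imp_open_map[OF Y'] by blast
  moreover have "X' ` (Y' \<circ> X) ` A = X ` A"
    unfolding image_image using Y' \<open>X ` A \<subseteq> X' ` V'\<close>
    by (intro image_cong) (auto simp: homeomorphism_def)
  ultimately have "openin (top_of_set S) (X ` A)"
    using local_paramD(3)[OF X'(1)] openin_trans by metis
  then show "\<exists>T. openin (top_of_set S) T \<and> p \<in> T \<and> T \<subseteq> X ` V"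
    using p X'(2) by (intro exI[of _ "X ` A"]) (auto simp: A_def)
qed

text \<open>A derivative relative to a surface is not unique. Composed with \<open>X\<close> it
  becomes a derivative at an interior point of the plane, which is unique, so the chosen one agrees
  with every \<open>D\<close> on tangent vectors.\<close>

lemma frechet_derivative_within_tangent:
  assumes X: "local_param M V X" "u \<in> V" and D: "(\<xi> has_derivative D) (at (X u) within M)"
  shows "frechet_derivative \<xi> (at (X u) within M) (frechet_derivative X (at u) w)
    = D (frechet_derivative X (at u) w)"
    and "(\<xi> \<circ> X has_derivative D \<circ> frechet_derivative X (at u)) (at u)"
proof -
  have chain: "(\<xi> \<circ> X has_derivative E \<circ> frechet_derivative X (at u)) (at u)"
    if E: "(\<xi> has_derivative E) (at (X u) within M)" for E
  proof -
    have "(X has_derivative frechet_derivative X (at u)) (at u within V)"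
      using local_paramD(4)[OF X] by (rule has_derivative_at_withinI)
    moreover have "(\<xi> has_derivative E) (at (X u) within X ` V)"
      by (rule has_derivative_subset[OF E openin_imp_subset[OF local_paramD(3)[OF X(1)]]])
    ultimately show ?thesis
      using diff_chain_within at_within_open[OF X(2) local_paramD(1)[OF X(1)]] by metis
  qed
  have "(\<xi> has_derivative frechet_derivative \<xi> (at (X u) within M)) (at (X u) within M)"
    using D frechet_derivative_works differentiableI by blast
  then show "frechet_derivative \<xi> (at (X u) within M) (frechet_derivative X (at u) w)
    = D (frechet_derivative X (at u) w)"
    using has_derivative_unique[OF chain chain[OF D]] by (metis comp_apply)
  show "(\<xi> \<circ> X has_derivative D \<circ> frechet_derivative X (at u)) (at u)"
    using chain[OF D] .
qed

text \<open>\<open>\<Phi> \<circ> X\<close> vanishes on the parameter domain. This yields the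
  orthogonality of the candidate normals of the model surfaces.\<close>

lemma tangent_plane_level_set:
  assumes "\<And>q. q \<in> S \<Longrightarrow> \<Phi> q = 0" "(\<Phi> has_derivative \<Phi>') (at p)" "v \<in> tangent_plane S p"
  shows "\<Phi>' v = (0::real)"
proof -
  obtain V X u w where X: "local_param S V X" "u \<in> V" "X u = p" "v = frechet_derivative X (at u) w"
    using assms(3) unfolding tangent_plane_def by blast
  have "(\<Phi> has_derivative \<Phi>') (at (X u) within S)"
    unfolding X(3) by (rule has_derivative_at_withinI[OF assms(2)])
  then have "(\<Phi> \<circ> X has_derivative \<Phi>' \<circ> frechet_derivative X (at u)) (at u)"
    by (rule frechet_derivative_within_tangent(2)[OF X(1,2)])
  moreover have "0 = (\<Phi> \<circ> X) u'" if "u' \<in> V" for u'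
    using assms(1)[of "X u'"] openin_imp_subset[OF local_paramD(3)[OF X(1)]] that by auto
  then have "(\<Phi> \<circ> X has_derivative (\<lambda>h. 0)) (at u)"
    by (rule has_derivative_transform_within_open[OF has_derivative_const local_paramD(1)[OF X(1)] X(2)])
  ultimately have "\<Phi>' \<circ> frechet_derivative X (at u) = (\<lambda>h. 0)"
    by (rule has_derivative_unique)
  then show ?thesis
    unfolding X(4) by (metis comp_apply)
qed

text \<open>Each model surface is covered by one graph-like chart whose inverse is an affine
  projection; differentiating the inversion identity shows that the derivative of \<open>X\<close>
  is injective.\<close>

lemma regular_surface_chartI:
  fixes X :: "real^2 \<Rightarrow> real^3"
  assumes "open V" "smooth_on V X" "X ` V = S" "S \<subseteq> H2R"
    and L: "bounded_linear L" and inv: "\<And>u. u \<in> V \<Longrightarrow> L (X u) + c = u"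
  shows "regular_surface S"
proof -
  have hom: "homeomorphism V (X ` V) X (\<lambda>p. L p + c)"
    unfolding homeomorphism_def
    using inv smooth_on_imp_continuous_on[OF assms(2)]
    by (auto simp: image_image intro!: continuous_intros linear_continuous_on[OF L])
  have "inj (frechet_derivative X (at u))" if u: "u \<in> V" for u
  proof -
    have "((\<lambda>u. L (X u) + c) has_derivative (\<lambda>h. L (frechet_derivative X (at u) h) + 0)) (at u)"
      by (intro has_derivative_add has_derivative_const bounded_linear.has_derivative[OF L]
          smooth_on_has_derivative[OF assms(2) u])
    moreover have "((\<lambda>u. L (X u) + c) has_derivative (\<lambda>h. h)) (at u)"
      by (rule has_derivative_transform_within_open[OF has_derivative_ident assms(1) u]) (simp add: inv)
    ultimately have "(\<lambda>h. L (frechet_derivative X (at u) h) + 0) = (\<lambda>h. h)"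
      by (rule has_derivative_unique)
    then have "L (frechet_derivative X (at u) h) = h" for h
      using fun_cong[of _ _ h] by fastforce
    then show ?thesis by (rule inj_on_inverseI)
  qed
  then have "local_param S V X"
    using assms hom unfolding local_param_def by auto
  then show ?thesis
    using assms(3,4) unfolding regular_surface_def by blast
qed

section \<open>Surfaces with a prescribed unit normal\<close>

lemma tangent_plane_openin_subset:
  "openin (top_of_set S) U \<Longrightarrow> tangent_plane U q \<subseteq> tangent_plane S q"
  unfolding tangent_plane_def using local_param_openin_trans by blast

lemma unit_normal_field_frame:
  assumes "unit_normal_field U \<xi>" "q \<in> U"
  shows "frame q (\<xi> q) \<bullet> frame q (\<xi> q) = 1" "v \<in> tangent_plane U q \<Longrightarrow> frame q (\<xi> q) \<bullet> frame q v = 0"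
  using assms by (simp_all add: unit_normal_field_def inner_frame)

text \<open>Smoothness of \<open>\<xi>\<close> is known only through some chart; continuity in space
  follows by writing \<open>\<xi>\<close> as \<open>(\<xi> \<circ> X) \<circ> Y\<close>.\<close>

lemma unit_normal_field_local_param:
  assumes "unit_normal_field U \<xi>" "q \<in> U"
  obtains V X u where "local_param U V X" "u \<in> V" "X u = q" "continuous_on (X ` V) \<xi>"
proof -
  obtain V X where X: "local_param U V X" "q \<in> X ` V" "smooth_on V (\<xi> \<circ> X)"
    using assms unfolding unit_normal_field_def smooth_along_def by blast
  obtain Y where Y: "homeomorphism V (X ` V) X Y"
    using X(1) unfolding local_param_def by blast
  have "continuous_on (Y ` X ` V) (\<xi> \<circ> X)"
    using smooth_on_imp_continuous_on[OF X(3)] Y by (simp add: homeomorphism_def)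
  then have "continuous_on (X ` V) ((\<xi> \<circ> X) \<circ> Y)"
    using Y by (intro continuous_on_compose[of _ Y]) (auto simp: homeomorphism_def)
  then have "continuous_on (X ` V) \<xi>"
    by (rule continuous_on_eq) (use Y in \<open>auto simp: homeomorphism_def\<close>)
  with X that show ?thesis by blast
qed

text \<open>A unit normal field is locally \<open>\<plusminus>N\<close> with a constant sign, so its shape operator is
  that of \<open>N\<close> up to this sign.\<close>

lemma shape_operator_of_normal:
  assumes U: "openin (top_of_set S) U" and SH: "S \<subseteq> H2R"
    and \<xi>: "unit_normal_field U \<xi>" and q: "q \<in> U"
    and contN: "continuous_on S N" and N': "(N has_derivative N') (at q)"
    and unit: "\<And>p. p \<in> S \<Longrightarrow> metric_inner H2R_metric p (N p) (N p) = 1"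
    and orth: "\<And>p v. p \<in> S \<Longrightarrow> v \<in> tangent_plane S p \<Longrightarrow> metric_inner H2R_metric p (N p) v = 0"
    and shape: "\<And>v. v \<in> tangent_plane S q \<Longrightarrow> - (N' v + christoffel_form H2R_metric q v (N q)) = l *\<^sub>R v"
  obtains s where "\<And>v. v \<in> tangent_plane U q \<Longrightarrow> shape_operator U \<xi> q v = (s * l) *\<^sub>R v"
proof -
  have US: "U \<subseteq> S" using U by (rule openin_imp_subset)
  define \<sigma> where "\<sigma> p = frame p (\<xi> p) \<bullet> frame p (N p)" for p
  have sign: "\<xi> p = \<sigma> p *\<^sub>R N p \<and> (\<sigma> p = 1 \<or> \<sigma> p = -1)" if p: "p \<in> U" for p
  proof -
    obtain V X u where X: "local_param U V X" "u \<in> V" "X u = p"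
      by (rule unit_normal_field_local_param[OF \<xi> p])
    have p2: "p $ 2 \<noteq> 0" using p US SH by (auto simp: H2R_def)
    let ?A = "frechet_derivative X (at u)"
    have tp: "?A w \<in> tangent_plane U p" for w
      using X unfolding tangent_plane_def by blast
    have tp': "?A w \<in> tangent_plane S p" for w
      using tp tangent_plane_openin_subset[OF U] by blast
    have NN: "frame p (N p) \<bullet> frame p (N p) = 1"
      using unit p US by (auto simp: inner_frame)
    have "frame p (\<xi> p) = frame p (N p) \<or> frame p (\<xi> p) = - frame p (N p)"
    proof (rule unit_normals_eq_up_to_sign)
      show "cross3 (frame p (?A (axis 1 1))) (frame p (?A (axis 2 1))) \<noteq> 0"
        using has_derivative_linear[OF local_paramD(4)[OF X(1,2)]] local_paramD(5)[OF X(1,2)] p2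
        by (rule cross_frame_nonzero)
      show "frame p (N p) \<bullet> frame p (?A (axis 1 1)) = 0" "frame p (N p) \<bullet> frame p (?A (axis 2 1)) = 0"
        unfolding inner_frame using orth[OF _ tp'] p US by auto
    qed (use unit_normal_field_frame[OF \<xi> p] tp NN in auto)
    then have "\<xi> p = N p \<and> \<sigma> p = 1 \<or> \<xi> p = - N p \<and> \<sigma> p = -1"
      using NN p2 linear_neg[OF linear_frame, of p "N p"] unfolding \<sigma>_def
      by (metis frame_eq_iff inner_minus_left)
    then show ?thesis by auto
  qed
  obtain V X u where X: "local_param U V X" "u \<in> V" "X u = q" and cont: "continuous_on (X ` V) \<xi>"
    by (rule unit_normal_field_local_param[OF \<xi> q])
  have XU: "X ` V \<subseteq> U" using openin_imp_subset[OF local_paramD(3)[OF X(1)]] .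
  have "p $ 2 \<noteq> 0" if "p \<in> X ` V" for p
  proof -
    have "p \<in> H2R" using that XU US SH by blast
    then show ?thesis by (simp add: H2R_def)
  qed
  then have "continuous_on (X ` V) \<sigma>"
    unfolding \<sigma>_def inner_frame metric_inner_H2R
    using cont continuous_on_subset[OF contN, of "X ` V"] XU US
    by (intro continuous_intros) auto
  \<comment> \<open>\<open>\<sigma>\<close> is continuous and takes only the values 1 and -1, so a
    variation below 1 makes it constant near \<open>q\<close>.\<close>
  then obtain d where d: "d > 0" "\<And>p. p \<in> X ` V \<Longrightarrow> dist p q < d \<Longrightarrow> dist (\<sigma> p) (\<sigma> q) < 1"
    using X(2,3) unfolding continuous_on_iff by (metis imageI zero_less_one)
  obtain T where T: "open T" "X ` V = U \<inter> T"
    using local_paramD(3)[OF X(1)] by (auto simp: openin_open)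
  obtain e where e: "e > 0" "ball q e \<subseteq> T"
    using T X open_contains_ball by (metis Int_iff imageI)
  have const: "\<sigma> p = \<sigma> q" if "p \<in> U" "dist p q < min d e" for p
  proof -
    have "p \<in> X ` V" using that e T by (auto simp: dist_commute)
    then have "dist (\<sigma> p) (\<sigma> q) < 1" using d that by simp
    then show ?thesis using sign[OF that(1)] sign[OF q] by (auto simp: dist_real_def)
  qed
  have D: "(\<xi> has_derivative (\<lambda>v. \<sigma> q *\<^sub>R N' v)) (at q within U)"
  proof (rule has_derivative_transform_within)
    show "((\<lambda>p. \<sigma> q *\<^sub>R N p) has_derivative (\<lambda>v. \<sigma> q *\<^sub>R N' v)) (at q within U)"
      by (rule has_derivative_scaleR_right[OF has_derivative_at_withinI[OF N']])
    show "\<sigma> q *\<^sub>R N p = \<xi> p" if "p \<in> U" "dist p q < min d e" for p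
      using sign[OF that(1)] const[OF that] by simp
  qed (use d e q in auto)
  have "shape_operator U \<xi> q v = (\<sigma> q * l) *\<^sub>R v" if v: "v \<in> tangent_plane U q" for v
  proof -
    obtain w where w: "v = frechet_derivative X (at u) w"
      using v tangent_plane_eq[OF X(1,2)] X(3) by auto
    have vS: "v \<in> tangent_plane S q" using v tangent_plane_openin_subset[OF U] by blast
    have "frechet_derivative \<xi> (at q within U) v = \<sigma> q *\<^sub>R N' v"
      using frechet_derivative_within_tangent(1)[OF X(1,2)] D X(3) w by metis
    moreover have "\<xi> q = \<sigma> q *\<^sub>R N q" using sign[OF q] by simp
    moreover have "christoffel_form H2R_metric q v (\<sigma> q *\<^sub>R N q)
        = \<sigma> q *\<^sub>R christoffel_form H2R_metric q v (N q)"
      by (simp add: christoffel_form_def vec_eq_iff sum_distrib_left mult.left_commute)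
    ultimately have "shape_operator U \<xi> q v = \<sigma> q *\<^sub>R - (N' v + christoffel_form H2R_metric q v (N q))"
      unfolding shape_operator_def cov_deriv_along_def by (simp add: scaleR_add_right scaleR_diff_right)
    then show ?thesis unfolding shape[OF vS] by simp
  qed
  with that show ?thesis by blast
qed

text \<open>The candidate normal is differentiable in the ambient space (\<open>at p\<close>, not
  within \<open>S\<close>), so its derivative is computed by the usual rules; the three equations
  are required on tangent vectors only.\<close>

lemma umbilical_of_frame_equations:
  assumes S: "regular_surface S"
    and der: "\<And>p. p \<in> S \<Longrightarrow> (a has_derivative a' p) (at p)"
      "\<And>p. p \<in> S \<Longrightarrow> (b has_derivative b' p) (at p)"
      "\<And>p. p \<in> S \<Longrightarrow> (\<nu> has_derivative \<nu>' p) (at p)"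
    and unit: "\<And>p. p \<in> S \<Longrightarrow> (a p)\<^sup>2 + (b p)\<^sup>2 + (\<nu> p)\<^sup>2 = 1"
    and orth: "\<And>p v. p \<in> S \<Longrightarrow> v \<in> tangent_plane S p \<Longrightarrow>
        a p * frame p v $ 1 + b p * frame p v $ 2 + \<nu> p * frame p v $ 3 = 0"
    and eqs: "\<And>p v. p \<in> S \<Longrightarrow> v \<in> tangent_plane S p \<Longrightarrow>
        a' p v = (b p - l p) * frame p v $ 1 \<and> b' p v = - a p * frame p v $ 1 - l p * frame p v $ 2
        \<and> \<nu>' p v = - l p * frame p v $ 3"
  shows "umbilical S" "(\<And>p. p \<in> S \<Longrightarrow> l p = 0) \<Longrightarrow> totally_geodesic S"
proof -
  define N :: "real^3 \<Rightarrow> real^3" where "N p = vector [p $ 2 * a p, p $ 2 * b p, \<nu> p]" for p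
  define N' :: "real^3 \<Rightarrow> real^3 \<Rightarrow> real^3" where
    "N' p v = vector [v $ 2 * a p + p $ 2 * a' p v, v $ 2 * b p + p $ 2 * b' p v, \<nu>' p v]" for p v
  have SH: "S \<subseteq> H2R" using S by (simp add: regular_surface_def)
  have pos: "p $ 2 > 0" if "p \<in> S" for p using SH that by (auto simp: H2R_def)
  have N': "(N has_derivative N' p) (at p)" if p: "p \<in> S" for p
  proof (subst has_derivative_componentwise_within, intro ballI)
    fix i :: "real^3" assume "i \<in> Basis"
    then obtain k where i: "i = axis k 1" by (auto simp: Basis_vec_def)
    have p2: "((\<lambda>q::real^3. q $ 2) has_derivative (\<lambda>v. v $ 2)) (at p)"
      by (intro bounded_linear_imp_has_derivative bounded_linear_vec_nth)
    show "((\<lambda>x. N x \<bullet> i) has_derivative (\<lambda>x. N' p x \<bullet> i)) (at p)"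
      using exhaust_3[of k]
      by (elim disjE) (auto simp: i inner_axis N_def N'_def vector_3 add.commute mult.commute
          intro!: derivative_eq_intros p2 der[OF p])
  qed
  have contN: "continuous_on S N"
    using N' by (meson continuous_at_imp_continuous_on has_derivative_continuous)
  have fN: "frame p (N p) = vector [a p, b p, \<nu> p]" if "p \<in> S" for p
    unfolding N_def using pos[OF that] by simp
  have sh: "\<exists>s. \<forall>v\<in>tangent_plane U q. shape_operator U \<xi> q v = (s * l q) *\<^sub>R v"
    if U: "openin (top_of_set S) U" "unit_normal_field U \<xi>" "q \<in> U" for U \<xi> q
  proof -
    have q: "q \<in> S" using U openin_imp_subset by blast
    show ?thesis
    proof (rule shape_operator_of_normal[OF U(1) SH U(2,3) contN N'[OF q]])
      show "metric_inner H2R_metric p (N p) (N p) = 1" if "p \<in> S" for p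
        using unit[OF that] unfolding inner_frame[symmetric] fN[OF that]
        by (simp add: inner_vec_def sum_3 vector_3 power2_eq_square)
      show "metric_inner H2R_metric p (N p) v = 0" if "p \<in> S" "v \<in> tangent_plane S p" for p v
        using orth[OF that] unfolding inner_frame[symmetric] fN[OF that(1)]
        by (simp add: inner_vec_def sum_3 vector_3)
      show "- (N' q v + christoffel_form H2R_metric q v (N q)) = l q *\<^sub>R v"
        if "v \<in> tangent_plane S q" for v
        unfolding N_def N'_def shape_equation_frame_iff[OF pos[OF q]] using eqs[OF q that] .
    qed blast
  qed
  show "umbilical S"
    unfolding umbilical_def
  proof (intro conjI S ballI allI impI)
    fix p U \<xi>
    assume "openin (top_of_set S) U \<and> p \<in> U \<and> unit_normal_field U \<xi>"
    then have "\<forall>q\<in>U. \<exists>s. \<forall>v\<in>tangent_plane U q. shape_operator U \<xi> q v = (s * l q) *\<^sub>R v"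
      using sh by blast
    \<comment> \<open>The sign may vary from point to point; the definition of
      \<open>umbilical\<close> asks for no continuity of the factor.\<close>
    then obtain s where "\<forall>q\<in>U. \<forall>v\<in>tangent_plane U q. shape_operator U \<xi> q v = (s q * l q) *\<^sub>R v"
      by metis
    then show "\<exists>lam. \<forall>q\<in>U. \<forall>v\<in>tangent_plane U q. shape_operator U \<xi> q v = lam q *\<^sub>R v"
      by (intro exI[of _ "\<lambda>q. s q * l q"]) blast
  qed
  show "totally_geodesic S" if l0: "\<And>p. p \<in> S \<Longrightarrow> l p = 0"
    unfolding totally_geodesic_def
  proof (intro conjI S ballI allI impI)
    fix U \<xi> q v w
    assume U: "openin (top_of_set S) U \<and> unit_normal_field U \<xi>" and q: "q \<in> U"
      and v: "v \<in> tangent_plane U q"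
    have "l q = 0" using l0 U q openin_imp_subset by blast
    then have "shape_operator U \<xi> q v = 0" using sh[of U \<xi> q] U q v by auto
    then show "second_fundamental_form U \<xi> q v w = 0"
      by (simp add: second_fundamental_form_def metric_inner_def)
  qed
qed

section \<open>The model surfaces\<close>

lemma bounded_linear_vector_2:
  assumes "bounded_linear f" "bounded_linear g"
  shows "bounded_linear (\<lambda>p. vector [f p, g p] :: real^2)"
proof -
  interpret f: bounded_linear f by fact
  interpret g: bounded_linear g by fact
  have "bounded_linear (\<lambda>p. f p *\<^sub>R axis 1 1 + g p *\<^sub>R axis 2 1 :: real^2)"
    by (intro bounded_linear_add bounded_linear_scaleR_left[THEN bounded_linear_compose] assms)
  moreover have "(\<lambda>p. f p *\<^sub>R axis 1 1 + g p *\<^sub>R axis 2 1) = (\<lambda>p. vector [f p, g p] :: real^2)"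
    by (simp add: fun_eq_iff vec_eq_iff forall_2 axis_def)
  ultimately show ?thesis by simp
qed

lemma smooth_on_vector_3:
  assumes "open V" "smooth_on V f" "smooth_on V g" "smooth_on V h"
  shows "smooth_on V (\<lambda>u. vector [f u, g u, h u] :: real^3)"
  using assms by (simp add: smooth_on_vec_iff forall_3)

section \<open>The graphs of family (ii), with the horizontal planes as a special case\<close>

lemma umb_lambda_mult:
  "y \<noteq> 0 \<Longrightarrow> umb_lambda c1 c2 c3 x y * y = c1 / 2 * (x\<^sup>2 + y\<^sup>2) + c2 * x - c3"
  by (simp add: umb_lambda_def)

text \<open>Origin of \<open>umb_j\<close>: the left side is \<open>a^2 + b^2\<close> for the
  horizontal normal components, so it is the value that \<open>\<lambda>^2 + \<nu>^2\<close> must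
  have for the normal to be a unit vector.\<close>

lemma umb_unit_identity:
  assumes "y \<noteq> 0"
  shows "(c1 * x + c2)\<^sup>2 + (umb_lambda c1 c2 c3 x y - c1 * y)\<^sup>2
    = 1 + (umb_lambda c1 c2 c3 x y)\<^sup>2 - umb_j c1 c2 c3"
  using umb_lambda_mult[OF assms, of c1 c2 c3 x] unfolding umb_j_def by algebra

text \<open>In terms of the normal components \<open>a = - (c1 x + c2)\<close> and
  \<open>b = \<lambda> - c1 y\<close> this is
  \<open>d\<lambda> = - a \<theta>\<^sub>1 - b \<theta>\<^sub>2\<close>.\<close>

lemma umb_lambda_has_derivative:
  fixes p :: "real^'n"
  assumes "p $ j \<noteq> 0"
  shows "((\<lambda>p. umb_lambda c1 c2 c3 (p $ i) (p $ j)) has_derivative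
    (\<lambda>v. (c1 * p $ i + c2) * (v $ i / p $ j)
        - (umb_lambda c1 c2 c3 (p $ i) (p $ j) - c1 * p $ j) * (v $ j / p $ j))) (at p)"
proof -
  have nth: "((\<lambda>q::real^'n. q $ k) has_derivative (\<lambda>v. v $ k)) (at p)" for k
    by (intro bounded_linear_imp_has_derivative bounded_linear_vec_nth)
  show ?thesis
    unfolding umb_lambda_def using assms
    by (auto intro!: derivative_eq_intros nth simp: field_simps power2_eq_square)
qed

lemma smooth_on_umb_lambda:
  assumes "open V" "\<And>u::real^'n. u \<in> V \<Longrightarrow> u $ j \<noteq> 0"
  shows "smooth_on V (\<lambda>u. umb_lambda c1 c2 c3 (u $ i) (u $ j))"
  unfolding umb_lambda_def using assms
  by (intro smooth_on_intros smooth_on_vec_nth) auto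

text \<open>The function is \<open>arcsin (t / sqrt j)\<close> in another form. In both directions
  of the classification this is the integration of \<open>dz = d\<lambda> / \<nu>\<close> with
  \<open>\<nu> = sqrt (j - \<lambda>^2)\<close>.\<close>

lemma DERIV_arctan_div_sqrt:
  fixes t j :: real
  assumes "t\<^sup>2 < j"
  shows "((\<lambda>t. arctan (t / sqrt (j - t\<^sup>2))) has_real_derivative 1 / sqrt (j - t\<^sup>2)) (at t)"
proof -
  define r where "r = sqrt (j - t\<^sup>2)"
  have r: "r > 0" "r\<^sup>2 = j - t\<^sup>2" using assms by (auto simp: r_def)
  have "((\<lambda>t. t / sqrt (j - t\<^sup>2)) has_real_derivative (r + t\<^sup>2 / r) / r\<^sup>2) (at t)"
    using assms r unfolding r_def
    by (auto intro!: derivative_eq_intros simp: field_simps power2_eq_square)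
  from DERIV_chain2[OF DERIV_arctan this]
  have "((\<lambda>t. arctan (t / sqrt (j - t\<^sup>2))) has_real_derivative
      inverse (1 + (t / r)\<^sup>2) * ((r + t\<^sup>2 / r) / r\<^sup>2)) (at t)"
    unfolding r_def .
  moreover have "inverse (1 + (t / r)\<^sup>2) * ((r + t\<^sup>2 / r) / r\<^sup>2) = 1 / r"
  proof -
    have "1 + (t / r)\<^sup>2 = (r\<^sup>2 + t\<^sup>2) / r\<^sup>2" "(r + t\<^sup>2 / r) / r\<^sup>2 = (r\<^sup>2 + t\<^sup>2) / r ^ 3"
      using r(1) by (simp_all add: field_simps power2_eq_square power3_eq_cube)
    moreover have "r\<^sup>2 + t\<^sup>2 \<noteq> 0" using r(1) by (simp add: add_pos_nonneg order_less_imp_not_eq2)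
    ultimately show ?thesis using r(1) by (simp add: power2_eq_square power3_eq_cube)
  qed
  ultimately show ?thesis by (simp add: r_def)
qed

lemma umb_graph_regular: "regular_surface (umb_graph c c1 c2 c3)"
proof -
  let ?j = "umb_j c1 c2 c3"
  let ?lam = "\<lambda>u::real^2. umb_lambda c1 c2 c3 (u $ 1) (u $ 2)"
  define W where "W = {u::real^2. u $ 2 > 0}"
  define V where "V = W \<inter> {u. (?lam u)\<^sup>2 < ?j}"
  define X :: "real^2 \<Rightarrow> real^3" where
    "X u = vector [u $ 1, u $ 2, umb_fun c c1 c2 c3 (u $ 1) (u $ 2)]" for u
  have W: "open W" unfolding W_def by (intro open_Collect_less continuous_intros)
  have lamW: "smooth_on W ?lam" by (rule smooth_on_umb_lambda[OF W]) (simp add: W_def)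
  \<comment> \<open>\<open>umb_lambda\<close> divides by \<open>y\<close>, so its continuity is
    known only on \<open>W\<close>; openness of \<open>V\<close> is a preimage argument inside
    \<open>W\<close>.\<close>
  have "open (W \<inter> (\<lambda>u. (?lam u)\<^sup>2) -` {..<?j})"
    by (intro continuous_open_preimage continuous_intros smooth_on_imp_continuous_on[OF lamW] W open_lessThan)
  moreover have "W \<inter> (\<lambda>u. (?lam u)\<^sup>2) -` {..<?j} = V" by (auto simp: V_def)
  ultimately have V: "open V" by simp
  have lamV: "smooth_on V ?lam" by (rule smooth_on_subset[OF lamW]) (simp add: V_def)
  show ?thesis
  proof (rule regular_surface_chartI[where X = X and V = V and L = "\<lambda>p. vector [p $ 1, p $ 2]" and c = 0])
    show "smooth_on V X"
      unfolding X_def umb_fun_def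
      by (intro smooth_on_vector_3 smooth_on_intros[OF V] V smooth_on_vec_nth lamV)
        (auto simp: V_def)
    show "X ` V = umb_graph c c1 c2 c3"
    proof
      show "X ` V \<subseteq> umb_graph c c1 c2 c3"
        by (auto simp: X_def V_def W_def umb_graph_def H2R_def vector_3)
      show "umb_graph c c1 c2 c3 \<subseteq> X ` V"
      proof
        fix p assume "p \<in> umb_graph c c1 c2 c3"
        then show "p \<in> X ` V"
          by (intro image_eqI[of _ _ "vector [p $ 1, p $ 2]"])
            (auto simp: X_def V_def W_def umb_graph_def H2R_def vec_eq_iff forall_3 vector_3)
      qed
    qed
  qed (auto simp: V X_def vec_eq_iff forall_2 vector_3 umb_graph_def
      intro!: bounded_linear_vector_2 bounded_linear_vec_nth)
qed

text \<open>The normal is \<open>(- (c1 x + c2), \<lambda> - c1 y, sqrt (j - \<lambda>^2))\<close>.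
  On the graph \<open>dz = d\<lambda> / \<nu>\<close>, which is orthogonality, and then the equation
  for \<open>d\<nu>\<close> is the derivative of \<open>\<nu>^2 = j - \<lambda>^2\<close>. The
  second claim serves the horizontal planes, where \<open>\<lambda>\<close> vanishes.\<close>

lemma umb_graph_umbilical:
  fixes c c1 c2 c3 :: real
  shows "umbilical (umb_graph c c1 c2 c3)"
    "c1 = 0 \<Longrightarrow> c2 = 0 \<Longrightarrow> c3 = 0 \<Longrightarrow> totally_geodesic (umb_graph c c1 c2 c3)"
proof -
  let ?S = "umb_graph c c1 c2 c3" and ?j = "umb_j c1 c2 c3"
  let ?lam = "\<lambda>p::real^3. umb_lambda c1 c2 c3 (p $ 1) (p $ 2)"
  define a where "a p = - (c1 * p $ 1 + c2)" for p :: "real^3"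
  define b where "b p = ?lam p - c1 * p $ 2" for p
  define \<nu> where "\<nu> p = sqrt (?j - (?lam p)\<^sup>2)" for p
  define lam' where "lam' p v = - a p * frame p v $ 1 - b p * frame p v $ 2" for p v
  have S: "p $ 2 > 0" "(?lam p)\<^sup>2 < ?j" if "p \<in> ?S" for p
    using that by (auto simp: umb_graph_def H2R_def)
  have nth: "((\<lambda>q::real^3. q $ k) has_derivative (\<lambda>v. v $ k)) (at p)" for k p
    by (intro bounded_linear_imp_has_derivative bounded_linear_vec_nth)
  have lam': "(?lam has_derivative lam' p) (at p)" if "p \<in> ?S" for p
    using umb_lambda_has_derivative[of p 2 c1 c2 c3 1] S(1)[OF that]
    by (simp add: lam'_def[abs_def] a_def b_def algebra_simps)
  have \<nu>0: "\<nu> p > 0" if "p \<in> ?S" for p using S(2)[OF that] by (simp add: \<nu>_def)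
  have der: "(a has_derivative (\<lambda>v. - c1 * v $ 1)) (at p)"
    "(b has_derivative (\<lambda>v. lam' p v - c1 * v $ 2)) (at p)"
    "(\<nu> has_derivative (\<lambda>v. - ?lam p * lam' p v / \<nu> p)) (at p)" if p: "p \<in> ?S" for p
    unfolding a_def[abs_def] b_def[abs_def] \<nu>_def[abs_def] using S[OF p]
    by (auto intro!: derivative_eq_intros nth lam'[OF p] simp: field_simps)
  have unit: "(a p)\<^sup>2 + (b p)\<^sup>2 + (\<nu> p)\<^sup>2 = 1" if "p \<in> ?S" for p
    using umb_unit_identity[of "p $ 2" c1 "p $ 1" c2 c3] S[OF that]
    by (simp add: a_def b_def \<nu>_def power2_eq_square algebra_simps)
  have orth: "a p * frame p v $ 1 + b p * frame p v $ 2 + \<nu> p * frame p v $ 3 = 0"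
    if p: "p \<in> ?S" and v: "v \<in> tangent_plane ?S p" for p v
  proof -
    have "((\<lambda>q. arctan (?lam q / sqrt (?j - (?lam q)\<^sup>2))) has_derivative (\<lambda>v. 1 / \<nu> p * lam' p v)) (at p)"
      using has_derivative_compose[OF lam'[OF p]
          DERIV_arctan_div_sqrt[OF S(2)[OF p], unfolded has_field_derivative_def]]
      by (simp add: \<nu>_def)
    then have "((\<lambda>q. q $ 3 - umb_fun c c1 c2 c3 (q $ 1) (q $ 2)) has_derivative
        (\<lambda>v. v $ 3 - (1 / \<nu> p * lam' p v + 0))) (at p)"
      unfolding umb_fun_def by (intro has_derivative_diff has_derivative_add has_derivative_const nth)
    from tangent_plane_level_set[OF _ this v] have "v $ 3 = 1 / \<nu> p * lam' p v"
      by (simp add: umb_graph_def)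
    then show ?thesis using \<nu>0[OF p] by (simp add: lam'_def field_simps)
  qed
  have eqs: "- c1 * v $ 1 = (b p - ?lam p) * frame p v $ 1
      \<and> lam' p v - c1 * v $ 2 = - a p * frame p v $ 1 - ?lam p * frame p v $ 2
      \<and> - ?lam p * lam' p v / \<nu> p = - ?lam p * frame p v $ 3"
    if p: "p \<in> ?S" and v: "v \<in> tangent_plane ?S p" for p v
  proof (intro conjI)
    show "- c1 * v $ 1 = (b p - ?lam p) * frame p v $ 1"
      "lam' p v - c1 * v $ 2 = - a p * frame p v $ 1 - ?lam p * frame p v $ 2"
      using S(1)[OF p] by (simp_all add: b_def lam'_def field_simps)
    have "lam' p v = \<nu> p * frame p v $ 3" using orth[OF p v] unfolding lam'_def by linarith
    then show "- ?lam p * lam' p v / \<nu> p = - ?lam p * frame p v $ 3" using \<nu>0[OF p] by simp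
  qed
  note main = umbilical_of_frame_equations[OF umb_graph_regular der unit orth eqs]
  show "umbilical ?S" by (rule main(1))
  show "totally_geodesic ?S" if "c1 = 0" "c2 = 0" "c3 = 0"
    using that by (intro main(2)) (simp_all add: umb_lambda_def)
qed

lemma horizontal_plane_eq_umb_graph: "horizontal_plane c = umb_graph c 0 0 0"
  by (auto simp: horizontal_plane_def umb_graph_def umb_lambda_def umb_j_def umb_fun_def)

text \<open>The level \<open>\<lambda> = 0\<close>: a vertical line (\<open>c1 = 0\<close>) or a
  half circle centred on the boundary \<open>y = 0\<close>, times the line. The normalization
  \<open>c2^2 + 2 * c1 * c3 = 1\<close>, that is \<open>umb_j = 0\<close>, stays outside the
  definition.\<close>

definition geodesic_cylinder :: "real \<Rightarrow> real \<Rightarrow> real \<Rightarrow> (real^3) set" where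
  "geodesic_cylinder c1 c2 c3 = {p \<in> H2R. c1 / 2 * ((p $ 1)\<^sup>2 + (p $ 2)\<^sup>2) + c2 * p $ 1 - c3 = 0}"

text \<open>The left side is the squared Euclidean gradient of the defining function. On its zero
  set it is \<open>c2^2 + 2 * c1 * c3\<close>, so the normalization makes the gradient a unit
  vector.\<close>

lemma geodesic_unit_identity:
  fixes x y :: real
  shows "(c1 * x + c2)\<^sup>2 + (c1 * y)\<^sup>2
    = 2 * c1 * (c1 / 2 * (x\<^sup>2 + y\<^sup>2) + c2 * x - c3) + (c2\<^sup>2 + 2 * c1 * c3)"
  by (simp add: algebra_simps power2_eq_square)

lemma geodesic_circle_iff:
  fixes x y :: real
  assumes "c1 \<noteq> 0" "c2\<^sup>2 + 2 * c1 * c3 = 1"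
  shows "c1 / 2 * (x\<^sup>2 + y\<^sup>2) + c2 * x - c3 = 0 \<longleftrightarrow> (x + c2 / c1)\<^sup>2 + y\<^sup>2 = (1 / c1)\<^sup>2"
proof -
  have "(x + c2 / c1)\<^sup>2 + y\<^sup>2 = (1 / c1)\<^sup>2 \<longleftrightarrow> (c1 * x + c2)\<^sup>2 + (c1 * y)\<^sup>2 = 1"
    using assms(1) by (simp add: field_simps power2_eq_square)
  then show ?thesis
    unfolding geodesic_unit_identity[of c1 x c2 y c3] using assms by simp
qed

text \<open>For \<open>c1 = 0\<close> the surface is the half plane \<open>x = c3 / c2\<close>;
  otherwise it is a graph over \<open>x\<close> and \<open>z\<close> of the half circle with centre
  \<open>- c2 / c1\<close> and radius \<open>1 / \<bar>c1\<bar>\<close>.\<close>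

lemma geodesic_cylinder_regular:
  assumes c: "c2\<^sup>2 + 2 * c1 * c3 = 1"
  shows "regular_surface (geodesic_cylinder c1 c2 c3)"
proof (cases "c1 = 0")
  case True
  then have c2: "c2 \<noteq> 0" using c by auto
  define V where "V = {u::real^2. u $ 1 > 0}"
  define X :: "real^2 \<Rightarrow> real^3" where "X u = vector [c3 / c2, u $ 1, u $ 2]" for u
  have V: "open V" unfolding V_def by (intro open_Collect_less continuous_intros)
  show ?thesis
  proof (rule regular_surface_chartI[where X = X and V = V and L = "\<lambda>p. vector [p $ 2, p $ 3]" and c = 0])
    show "smooth_on V X"
      unfolding X_def by (intro smooth_on_vector_3 smooth_on_intros[OF V] V smooth_on_vec_nth)
    show "X ` V = geodesic_cylinder c1 c2 c3"
    proof
      show "X ` V \<subseteq> geodesic_cylinder c1 c2 c3"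
        using True c2 by (auto simp: X_def V_def geodesic_cylinder_def H2R_def vector_3)
      show "geodesic_cylinder c1 c2 c3 \<subseteq> X ` V"
      proof
        fix p assume "p \<in> geodesic_cylinder c1 c2 c3"
        then show "p \<in> X ` V" using True c2
          by (intro image_eqI[of _ _ "vector [p $ 2, p $ 3]"])
            (auto simp: X_def V_def geodesic_cylinder_def H2R_def vec_eq_iff forall_3 vector_3 field_simps)
      qed
    qed
  qed (auto simp: V X_def vec_eq_iff forall_2 vector_3 geodesic_cylinder_def
      intro!: bounded_linear_vector_2 bounded_linear_vec_nth)
next
  case False
  define V where "V = {u::real^2. (u $ 1)\<^sup>2 < (1 / c1)\<^sup>2}"
  define X :: "real^2 \<Rightarrow> real^3" where
    "X u = vector [u $ 1 - c2 / c1, sqrt ((1 / c1)\<^sup>2 - (u $ 1)\<^sup>2), u $ 2]" for u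
  have V: "open V" unfolding V_def by (intro open_Collect_less continuous_intros)
  have iff: "p \<in> geodesic_cylinder c1 c2 c3 \<longleftrightarrow>
      p $ 2 > 0 \<and> (p $ 1 + c2 / c1)\<^sup>2 + (p $ 2)\<^sup>2 = (1 / c1)\<^sup>2" for p
    using geodesic_circle_iff[OF False c] by (auto simp: geodesic_cylinder_def H2R_def)
  show ?thesis
  proof (rule regular_surface_chartI[where X = X and V = V
        and L = "\<lambda>p. vector [p $ 1, p $ 3]" and c = "vector [c2 / c1, 0]"])
    show "smooth_on V X"
      unfolding X_def by (intro smooth_on_vector_3 smooth_on_intros[OF V] V smooth_on_vec_nth)
        (simp add: V_def)
    show "X ` V = geodesic_cylinder c1 c2 c3"
    proof
      show "X ` V \<subseteq> geodesic_cylinder c1 c2 c3"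
        by (auto simp: X_def V_def iff vector_3)
      show "geodesic_cylinder c1 c2 c3 \<subseteq> X ` V"
      proof
        fix p assume "p \<in> geodesic_cylinder c1 c2 c3"
        then have p: "p $ 2 > 0" "(p $ 1 + c2 / c1)\<^sup>2 + (p $ 2)\<^sup>2 = (1 / c1)\<^sup>2" using iff by auto
        then have "(1 / c1)\<^sup>2 - (p $ 1 + c2 / c1)\<^sup>2 = (p $ 2)\<^sup>2" by simp
        then have "sqrt ((1 / c1)\<^sup>2 - (p $ 1 + c2 / c1)\<^sup>2) = p $ 2" using p(1) by simp
        moreover have "(p $ 1 + c2 / c1)\<^sup>2 < (1 / c1)\<^sup>2"
          using p(2) zero_less_power[OF p(1), of 2] by linarith
        ultimately show "p \<in> X ` V"
          by (intro image_eqI[of _ _ "vector [p $ 1 + c2 / c1, p $ 3]"])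
            (auto simp: X_def V_def vec_eq_iff forall_3 vector_3)
      qed
    qed
  qed (auto simp: V X_def vec_eq_iff forall_2 vector_3 geodesic_cylinder_def
      intro!: bounded_linear_vector_2 bounded_linear_vec_nth)
qed

text \<open>The negative gradient of the defining function, read in the orthonormal frame, is the
  unit normal; its third component is zero and the factor is \<open>l = 0\<close>.\<close>

lemma geodesic_cylinder_umbilical:
  assumes c: "c2\<^sup>2 + 2 * c1 * c3 = 1"
  shows "umbilical (geodesic_cylinder c1 c2 c3)" "totally_geodesic (geodesic_cylinder c1 c2 c3)"
proof -
  let ?S = "geodesic_cylinder c1 c2 c3"
  define a where "a p = - (c1 * p $ 1 + c2)" for p :: "real^3"
  define b where "b p = - c1 * p $ 2" for p :: "real^3"
  have S: "p $ 2 > 0" "c1 / 2 * ((p $ 1)\<^sup>2 + (p $ 2)\<^sup>2) + c2 * p $ 1 - c3 = 0" if "p \<in> ?S" for p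
    using that by (auto simp: geodesic_cylinder_def H2R_def)
  have nth: "((\<lambda>q::real^3. q $ k) has_derivative (\<lambda>v. v $ k)) (at p)" for k p
    by (intro bounded_linear_imp_has_derivative bounded_linear_vec_nth)
  have der: "(a has_derivative (\<lambda>v. - c1 * v $ 1)) (at p)"
    "(b has_derivative (\<lambda>v. - c1 * v $ 2)) (at p)" "((\<lambda>p. 0) has_derivative (\<lambda>v. 0)) (at p)" for p
    unfolding a_def[abs_def] b_def[abs_def] by (auto intro!: derivative_eq_intros nth)
  have unit: "(a p)\<^sup>2 + (b p)\<^sup>2 + 0\<^sup>2 = 1" if "p \<in> ?S" for p
  proof -
    have "(c1 * p $ 1 + c2)\<^sup>2 + (c1 * p $ 2)\<^sup>2 = 1"
      unfolding geodesic_unit_identity[of c1 _ c2 _ c3] S(2)[OF that] c by simp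
    then show ?thesis unfolding a_def b_def power2_minus mult_minus_left by simp
  qed
  have orth: "a p * frame p v $ 1 + b p * frame p v $ 2 + 0 * frame p v $ 3 = 0"
    if p: "p \<in> ?S" and v: "v \<in> tangent_plane ?S p" for p v
  proof -
    have "((\<lambda>p. c1 / 2 * ((p $ 1)\<^sup>2 + (p $ 2)\<^sup>2) + c2 * p $ 1 - c3) has_derivative
        (\<lambda>v. - (a p * v $ 1 + b p * v $ 2))) (at p)"
      unfolding a_def b_def
      by (auto intro!: derivative_eq_intros nth simp: field_simps power2_eq_square)
    from tangent_plane_level_set[OF _ this v] S(2) have "a p * v $ 1 + b p * v $ 2 = 0" by simp
    then show ?thesis
      by (simp add: add_divide_distrib[symmetric])
  qed
  \<comment> \<open>The middle equation holds only for tangent \<open>v\<close>: orthogonality turns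
    \<open>- a * frame p v $ 1\<close> into \<open>b * frame p v $ 2\<close>, which is
    \<open>- c1 * v $ 2\<close>.\<close>
  have eqs: "- c1 * v $ 1 = (b p - 0) * frame p v $ 1
      \<and> - c1 * v $ 2 = - a p * frame p v $ 1 - 0 * frame p v $ 2 \<and> 0 = - 0 * frame p v $ 3"
    if p: "p \<in> ?S" and v: "v \<in> tangent_plane ?S p" for p v
    using orth[OF that] S(1)[OF p] by (auto simp: b_def field_simps)
  note main = umbilical_of_frame_equations[where \<nu> = "\<lambda>p. 0" and l = "\<lambda>p. 0",
      OF geodesic_cylinder_regular[OF c] der unit orth eqs]
  show "umbilical ?S" by (rule main(1))
  show "totally_geodesic ?S" by (rule main(2)) simp_all
qed

section \<open>Geodesics of the hyperbolic plane\<close>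

definition H2_circle :: "real \<Rightarrow> real \<Rightarrow> real \<Rightarrow> (real^2) set" where
  "H2_circle c1 c2 c3 = {p \<in> H2. c1 / 2 * ((p $ 1)\<^sup>2 + (p $ 2)\<^sup>2) + c2 * p $ 1 - c3 = 0}"

lemma vertical_cylinder_H2_circle: "vertical_cylinder (H2_circle c1 c2 c3) = geodesic_cylinder c1 c2 c3"
  by (auto simp: vertical_cylinder_def H2_circle_def geodesic_cylinder_def H2_def H2R_def vector_2)

lemma tanh_artanh_real:
  assumes "\<bar>m :: real\<bar> < 1"
  shows "tanh (artanh m) = m"
proof -
  have "exp (- 2 * artanh m) = (1 - m) / (1 + m)"
    using assms by (simp add: artanh_def exp_minus)
  then have "tanh (artanh m) = (1 - (1 - m) / (1 + m)) / (1 + (1 - m) / (1 + m))"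
    by (simp only: tanh_real_altdef)
  moreover have "1 + m \<noteq> 0" using assms by auto
  then have "1 - (1 - m) / (1 + m) = 2 * m / (1 + m)" "1 + (1 - m) / (1 + m) = 2 / (1 + m)"
    by (simp_all add: field_simps)
  ultimately show ?thesis
    using \<open>1 + m \<noteq> 0\<close> by simp
qed

lemma affine_of_constant_derivative:
  assumes "\<And>t. (f has_real_derivative k) (at t)"
  shows "f t = f 0 + k * t"
proof -
  have "((\<lambda>t. f t - k * t) has_real_derivative 0) (at t)" for t
    using assms by (auto intro!: derivative_eq_intros)
  then show ?thesis using DERIV_isconst_all[of "\<lambda>t. f t - k * t" t 0] by simp
qed

lemma has_real_derivative_component:
  "(c has_vector_derivative c') (at t) \<Longrightarrow> ((\<lambda>t. c t $ i) has_real_derivative c' $ i) (at t)"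
  using bounded_linear.has_vector_derivative[OF bounded_linear_vec_nth]
  by (simp add: has_real_derivative_iff_has_vector_derivative)

lemma has_vector_derivative_vector_2:
  assumes "(f has_real_derivative f') (at t)" "(g has_real_derivative g') (at t)"
  shows "((\<lambda>t. vector [f t, g t] :: real^2) has_vector_derivative vector [f', g']) (at t)"
proof -
  have eq: "vector [r, s] = r *\<^sub>R axis 1 1 + s *\<^sub>R (axis 2 1 :: real^2)" for r s :: real
    by (simp add: vec_eq_iff forall_2 axis_def)
  show ?thesis
    unfolding eq using assms
    by (auto intro!: derivative_eq_intros simp: has_real_derivative_iff_has_vector_derivative)
qed

lemma complete_geodesic_H2E:
  assumes "complete_geodesic H2_metric H2 c"
  obtains x y x' y' :: "real \<Rightarrow> real" where
    "\<And>t. c t = vector [x t, y t]" "\<And>t. y t > 0" "\<And>t. x' t \<noteq> 0 \<or> y' t \<noteq> 0"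
    "\<And>t. (x has_real_derivative x' t) (at t)" "\<And>t. (y has_real_derivative y' t) (at t)"
    "\<And>t. (x' has_real_derivative 2 * x' t * y' t / y t) (at t)"
    "\<And>t. (y' has_real_derivative ((y' t)\<^sup>2 - (x' t)\<^sup>2) / y t) (at t)"
proof -
  obtain c' c'' where g: "\<And>t. c t \<in> H2" "\<And>t. c' t \<noteq> 0"
    "\<And>t. (c has_vector_derivative c' t) (at t)" "\<And>t. (c' has_vector_derivative c'' t) (at t)"
    "\<And>t. c'' t + christoffel_form H2_metric (c t) (c' t) (c' t) = 0"
    using assms unfolding complete_geodesic_def by blast
  have pos: "c t $ 2 > 0" for t using g(1) by (simp add: H2_def)
  have eqs: "c'' t $ 1 = 2 * c' t $ 1 * c' t $ 2 / c t $ 2"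
    "c'' t $ 2 = ((c' t $ 2)\<^sup>2 - (c' t $ 1)\<^sup>2) / c t $ 2" for t
  proof -
    have "(c'' t + christoffel_form H2_metric (c t) (c' t) (c' t)) $ i = 0" for i
      using g(5) by simp
    from this[of 1] this[of 2] show "c'' t $ 1 = 2 * c' t $ 1 * c' t $ 2 / c t $ 2"
      "c'' t $ 2 = ((c' t $ 2)\<^sup>2 - (c' t $ 1)\<^sup>2) / c t $ 2"
      using pos[of t] by (simp_all add: christoffel_form_H2 vector_2 field_simps power2_eq_square)
  qed
  show ?thesis
  proof (rule that[of "\<lambda>t. c t $ 1" "\<lambda>t. c t $ 2" "\<lambda>t. c' t $ 1" "\<lambda>t. c' t $ 2"])
    show "c' t $ 1 \<noteq> 0 \<or> c' t $ 2 \<noteq> 0" for t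
      using g(2)[of t] by (auto simp: vec_eq_iff forall_2)
    show "((\<lambda>t. c' t $ 1) has_real_derivative 2 * c' t $ 1 * c' t $ 2 / c t $ 2) (at t)"
      "((\<lambda>t. c' t $ 2) has_real_derivative ((c' t $ 2)\<^sup>2 - (c' t $ 1)\<^sup>2) / c t $ 2) (at t)" for t
      unfolding eqs[symmetric] by (rule has_real_derivative_component[OF g(4)])+
  qed (use pos has_real_derivative_component[OF g(3)] in \<open>auto simp: vec_eq_iff forall_2\<close>)
qed

text \<open>With \<open>(a, b)\<close> the unit normal of the geodesic in the orthonormal frame, the numbers
  \<open>c1 = - b / y\<close>, \<open>c2 = - a - c1 x\<close> and hence \<open>c3\<close> are conserved along it.\<close>

lemma complete_geodesic_H2_range:
  assumes "complete_geodesic H2_metric H2 c"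
  obtains c1 c2 c3 where "c2\<^sup>2 + 2 * c1 * c3 = 1" "range c = H2_circle c1 c2 c3"
proof -
  obtain x y x' y' where c: "\<And>t. c t = vector [x t, y t]"
    and y: "\<And>t. y t > 0" and ne: "\<And>t. x' t \<noteq> 0 \<or> y' t \<noteq> 0"
    and x': "\<And>t. (x has_real_derivative x' t) (at t)" and y': "\<And>t. (y has_real_derivative y' t) (at t)"
    and x'': "\<And>t. (x' has_real_derivative 2 * x' t * y' t / y t) (at t)"
    and y'': "\<And>t. (y' has_real_derivative ((y' t)\<^sup>2 - (x' t)\<^sup>2) / y t) (at t)"
    by (rule complete_geodesic_H2E[OF assms]) blast
  have y0: "y t \<noteq> 0" for t using y[of t] by simp
  \<comment> \<open>\<open>E\<close> is the squared hyperbolic speed and \<open>e\<close> below the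
    constant speed; the parameter need not be arc length.\<close>
  define E where "E t = ((x' t)\<^sup>2 + (y' t)\<^sup>2) / (y t)\<^sup>2" for t
  have "(E has_real_derivative 0) (at t)" for t
    unfolding E_def[abs_def] using y0[of t]
    by (auto intro!: derivative_eq_intros x' y' x'' y'' simp: field_simps power2_eq_square)
  then have Econst: "E t = E 0" for t using DERIV_isconst_all by blast
  define e where "e = sqrt (E 0)"
  have "E 0 > 0" unfolding E_def using ne[of 0] y[of 0] by (simp add: sum_power2_gt_zero_iff)
  then have e: "e > 0" "e\<^sup>2 = E 0" by (auto simp: e_def)
  have speed: "(x' t)\<^sup>2 + (y' t)\<^sup>2 = (e * y t)\<^sup>2" for t
    using Econst[of t] y0[of t] e(2) by (simp add: E_def field_simps power_mult_distrib)
  \<comment> \<open>The unit normal is the unit tangent \<open>(x', y') / (e y)\<close> turned by a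
    right angle, so \<open>k\<close> is \<open>- b / y\<close> and \<open>m\<close> below is
    \<open>- a\<close>.\<close>
  define k where "k t = - x' t / (e * (y t)\<^sup>2)" for t
  have "(k has_real_derivative 0) (at t)" for t
    unfolding k_def[abs_def] using y0[of t] e
    by (auto intro!: derivative_eq_intros x' y' x'' y'' simp: field_simps power2_eq_square)
  then have kconst: "k t = k 0" for t using DERIV_isconst_all by blast
  define c1 where "c1 = k 0"
  have x'c: "x' t = - c1 * e * (y t)\<^sup>2" for t
    using kconst[of t] y0[of t] e by (simp add: c1_def k_def field_simps)
  define m where "m t = y' t / (e * y t)" for t
  have m': "(m has_real_derivative c1 * x' t) (at t)" for t
  proof -
    have "(m has_real_derivative - (x' t)\<^sup>2 / (e * (y t)\<^sup>2)) (at t)"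
      unfolding m_def[abs_def] using y0[of t] e
      by (auto intro!: derivative_eq_intros x' y' x'' y'' simp: field_simps power2_eq_square)
    moreover have "- (x' t)\<^sup>2 / (e * (y t)\<^sup>2) = c1 * x' t"
      unfolding x'c using y0[of t] e by (simp add: field_simps power2_eq_square)
    ultimately show ?thesis by simp
  qed
  define c2 where "c2 = m 0 - c1 * x 0"
  have "((\<lambda>t. m t - c1 * x t) has_real_derivative 0) (at t)" for t
    by (auto intro!: derivative_eq_intros m' x')
  then have mc: "m t = c1 * x t + c2" for t
    using DERIV_isconst_all[of "\<lambda>t. m t - c1 * x t" t 0] by (simp add: c2_def)
  have unit: "(m t)\<^sup>2 + (c1 * y t)\<^sup>2 = 1" for t
  proof -
    have "(m t)\<^sup>2 + (c1 * y t)\<^sup>2 = ((x' t)\<^sup>2 + (y' t)\<^sup>2) / (e * y t)\<^sup>2"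
      unfolding m_def x'c using y0[of t] e by (simp add: field_simps power2_eq_square)
    then show ?thesis unfolding speed using y0[of t] e by simp
  qed
  have y'm: "y' t = e * y t * m t" for t using y0[of t] e by (simp add: m_def)
  define F where "F t = c1 / 2 * ((x t)\<^sup>2 + (y t)\<^sup>2) + c2 * x t" for t
  have "(F has_real_derivative (c1 * x t + c2) * x' t + c1 * y t * y' t) (at t)" for t
    unfolding F_def[abs_def]
    by (auto intro!: derivative_eq_intros x' y' simp: field_simps power2_eq_square)
  moreover have "(c1 * x t + c2) * x' t + c1 * y t * y' t = 0" for t
    unfolding mc[symmetric] y'm x'c by (simp add: power2_eq_square)
  ultimately have "(F has_real_derivative 0) (at t)" for t by metis
  then have Fconst: "F t = F 0" for t using DERIV_isconst_all by blast
  define c3 where "c3 = F 0"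
  have on: "c1 / 2 * ((x t)\<^sup>2 + (y t)\<^sup>2) + c2 * x t - c3 = 0" for t
    using Fconst[of t] by (simp add: F_def c3_def)
  have norm: "c2\<^sup>2 + 2 * c1 * c3 = 1"
    using geodesic_unit_identity[of c1 "x 0" c2 "y 0" c3] unit[of 0] on[of 0] by (simp add: mc)
  \<comment> \<open>Completeness enters here: \<open>ln y\<close> or \<open>artanh m\<close> is an
    affine function of \<open>t\<close> with nonzero slope, so the geodesic reaches every point of
    the line or half circle.\<close>
  have onto: "\<exists>t. x t = X \<and> y t = Y"
    if Y: "Y > 0" and XY: "c1 / 2 * (X\<^sup>2 + Y\<^sup>2) + c2 * X - c3 = 0" for X Y
  proof (cases "c1 = 0")
    case True
    have c2: "c2\<^sup>2 = 1" "c2 \<noteq> 0" using norm True by auto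
    have "((\<lambda>t. ln (y t)) has_real_derivative e * c2) (at t)" for t
      using y[of t] True by (auto intro!: derivative_eq_intros y' simp: y'm mc)
    then have "ln (y t) = ln (y 0) + e * c2 * t" for t
      by (rule affine_of_constant_derivative)
    from this[of "(ln Y - ln (y 0)) / (e * c2)"]
    have "ln (y ((ln Y - ln (y 0)) / (e * c2))) = ln Y" using e c2 by simp
    then have "y ((ln Y - ln (y 0)) / (e * c2)) = Y" using y Y by simp
    moreover have "c2 * x t = c2 * X" for t using on[of t] XY True by simp
    then have "x t = X" for t using c2(2) by simp
    ultimately show ?thesis by blast
  next
    case False
    define M where "M = c1 * X + c2"
    have MY: "M\<^sup>2 + (c1 * Y)\<^sup>2 = 1"
      unfolding M_def geodesic_unit_identity[of c1 X c2 Y c3] XY norm by simp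
    have bound: "\<bar>r\<bar> < 1" if "r\<^sup>2 + (c1 * s)\<^sup>2 = 1" "s > 0" for r s
    proof -
      have "(c1 * s)\<^sup>2 > 0" using False that(2) by simp
      then have "r\<^sup>2 < 1" using that(1) by linarith
      then show ?thesis by (simp add: abs_square_less_1)
    qed
    have m1: "\<bar>m t\<bar> < 1" for t using bound[OF unit y] .
    have "((\<lambda>t. artanh (m t)) has_real_derivative - e) (at t)" for t
    proof -
      \<comment> \<open>Hence \<open>m\<close> solves the logistic-type equation
        \<open>m' = - e * (1 - m^2)\<close>, which \<open>artanh\<close> linearizes.\<close>
      have "c1 * x' t = - e * (1 - (m t)\<^sup>2)"
        unfolding x'c using unit[of t] by (simp add: power_mult_distrib power2_eq_square) algebra
      moreover have "1 - (m t)\<^sup>2 \<noteq> 0" using m1[of t] abs_square_less_1[of "m t"] by simp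
      ultimately have "1 / (1 - (m t)\<^sup>2) * (c1 * x' t) = - e" by simp
      then show ?thesis
        using DERIV_chain2[OF artanh_real_has_field_derivative[OF m1] m', of t] by simp
    qed
    then have "artanh (m t) = artanh (m 0) + - e * t" for t
      by (rule affine_of_constant_derivative)
    from this[of "(artanh (m 0) - artanh M) / e"]
    obtain t where "artanh (m t) = artanh M" using e by auto
    then have mt: "m t = M" using tanh_artanh_real[OF m1] tanh_artanh_real[OF bound[OF MY Y]] by metis
    then have "x t = X" using mc[of t] False by (simp add: M_def)
    moreover have "(c1 * y t)\<^sup>2 = (c1 * Y)\<^sup>2" using unit[of t] MY unfolding mt by linarith
    then have "(y t)\<^sup>2 = Y\<^sup>2" using False by (simp add: power_mult_distrib)
    then have "y t = Y" using y[of t] Y by (simp add: power2_eq_iff_nonneg)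
    ultimately show ?thesis by blast
  qed
  have "p \<in> range c" if p: "p \<in> H2_circle c1 c2 c3" for p
  proof -
    obtain t where "x t = p $ 1" "y t = p $ 2"
      using p onto[of "p $ 2" "p $ 1"] unfolding H2_circle_def H2_def by blast
    then have "p = c t" by (simp add: c vec_eq_iff forall_2)
    then show ?thesis by blast
  qed
  moreover have "c t \<in> H2_circle c1 c2 c3" for t
    using on[of t] y[of t] by (simp add: c H2_circle_def H2_def)
  ultimately have "range c = H2_circle c1 c2 c3" by blast
  with norm that show ?thesis by blast
qed

section \<open>Vertical lines and half circles as complete geodesics\<close>

lemma complete_geodesic_H2I:
  assumes "\<And>t. y t > 0" "\<And>t. x' t \<noteq> 0 \<or> y' t \<noteq> 0"
    and "\<And>t. (x has_real_derivative x' t) (at t)" "\<And>t. (y has_real_derivative y' t) (at t)"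
    and "\<And>t. (x' has_real_derivative 2 * x' t * y' t / y t) (at t)"
    and "\<And>t. (y' has_real_derivative ((y' t)\<^sup>2 - (x' t)\<^sup>2) / y t) (at t)"
  shows "complete_geodesic H2_metric H2 (\<lambda>t. vector [x t, y t])"
  unfolding complete_geodesic_def
proof (intro exI allI conjI)
  fix t
  show "vector [x t, y t] \<in> H2" using assms(1) by (simp add: H2_def)
  show "vector [x' t, y' t] \<noteq> (0 :: real^2)" using assms(2)[of t] by (auto simp: vec_eq_iff forall_2)
  show "((\<lambda>t. vector [x t, y t] :: real^2) has_vector_derivative vector [x' t, y' t]) (at t)"
    by (intro has_vector_derivative_vector_2 assms)
  show "((\<lambda>t. vector [x' t, y' t] :: real^2) has_vector_derivative
      vector [2 * x' t * y' t / y t, ((y' t)\<^sup>2 - (x' t)\<^sup>2) / y t]) (at t)"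
    by (intro has_vector_derivative_vector_2 assms)
  show "vector [2 * x' t * y' t / y t, ((y' t)\<^sup>2 - (x' t)\<^sup>2) / y t]
      + christoffel_form H2_metric (vector [x t, y t]) (vector [x' t, y' t]) (vector [x' t, y' t]) = 0"
    using assms(1)[of t]
    by (simp add: christoffel_form_H2 vec_eq_iff forall_2 vector_2 field_simps power2_eq_square)
qed

text \<open>Unit-speed parametrizations are given explicitly: \<open>exp\<close> along the vertical
  line, and \<open>tanh\<close> and \<open>1 / cosh\<close>, scaled by the radius \<open>R\<close>,
  on the half circle.\<close>

lemma H2_circle_geodesic:
  assumes c: "c2\<^sup>2 + 2 * c1 * c3 = 1"
  shows "H2_circle c1 c2 c3 \<in> H2_geodesics"
proof (cases "c1 = 0")
  case True
  then have c2: "c2 \<noteq> 0" using c by auto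
  have "complete_geodesic H2_metric H2 (\<lambda>t. vector [c3 / c2, exp t])"
    by (rule complete_geodesic_H2I[where x' = "\<lambda>t. 0" and y' = exp])
      (auto intro!: derivative_eq_intros simp: power2_eq_square)
  moreover have "range (\<lambda>t. vector [c3 / c2, exp t]) = H2_circle c1 c2 c3"
  proof
    show "range (\<lambda>t. vector [c3 / c2, exp t]) \<subseteq> H2_circle c1 c2 c3"
      using True c2 by (auto simp: H2_circle_def H2_def)
    show "H2_circle c1 c2 c3 \<subseteq> range (\<lambda>t. vector [c3 / c2, exp t])"
    proof
      fix p assume "p \<in> H2_circle c1 c2 c3"
      then have "p = vector [c3 / c2, exp (ln (p $ 2))]"
        using True c2 by (auto simp: H2_circle_def H2_def vec_eq_iff forall_2 field_simps)
      then show "p \<in> range (\<lambda>t. vector [c3 / c2, exp t])" by blast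
    qed
  qed
  ultimately show ?thesis unfolding H2_geodesics_def by blast
next
  case False
  define R where "R = \<bar>1 / c1\<bar>"
  have R: "R > 0" "R\<^sup>2 = (1 / c1)\<^sup>2" using False by (auto simp: R_def power_divide)
  define g :: "real \<Rightarrow> real^2" where "g t = vector [R * tanh t - c2 / c1, R / cosh t]" for t
  have ch: "cosh t > 0" "(cosh t)\<^sup>2 = (sinh t)\<^sup>2 + 1" for t :: real by (auto simp: cosh_square_eq)
  have tanh2: "(tanh t)\<^sup>2 = 1 - 1 / (cosh t)\<^sup>2" for t :: real
  proof -
    have "(tanh t)\<^sup>2 = ((cosh t)\<^sup>2 - 1) / (cosh t)\<^sup>2" using ch(2)[of t] by (simp add: tanh_def power_divide)
    then show ?thesis using ch(1)[of t] by (simp add: diff_divide_distrib)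
  qed
  have "complete_geodesic H2_metric H2 g"
    unfolding g_def
  proof (rule complete_geodesic_H2I[where x' = "\<lambda>t. R / (cosh t)\<^sup>2" and y' = "\<lambda>t. - R * sinh t / (cosh t)\<^sup>2"])
    fix t :: real
    have tanh: "1 - (tanh t)\<^sup>2 = 1 / (cosh t)\<^sup>2" by (simp add: tanh2)
    show "((\<lambda>t. R * tanh t - c2 / c1) has_real_derivative R / (cosh t)\<^sup>2) (at t)"
      using ch(1)[of t] by (auto intro!: derivative_eq_intros simp: tanh)
    show "((\<lambda>t. R / cosh t) has_real_derivative - R * sinh t / (cosh t)\<^sup>2) (at t)"
      using ch(1)[of t] by (auto intro!: derivative_eq_intros simp: power2_eq_square)
    show "((\<lambda>t. R / (cosh t)\<^sup>2) has_real_derivative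
        2 * (R / (cosh t)\<^sup>2) * (- R * sinh t / (cosh t)\<^sup>2) / (R / cosh t)) (at t)"
      using ch(1)[of t] R(1) by (auto intro!: derivative_eq_intros simp: field_simps power2_eq_square)
    have "((\<lambda>t. - R * sinh t / (cosh t)\<^sup>2) has_real_derivative
        R * (2 * (sinh t)\<^sup>2 - (cosh t)\<^sup>2) / (cosh t) ^ 3) (at t)"
      using ch(1)[of t]
      by (auto intro!: derivative_eq_intros simp: field_simps power2_eq_square power3_eq_cube)
    moreover have "((- R * sinh t / (cosh t)\<^sup>2)\<^sup>2 - (R / (cosh t)\<^sup>2)\<^sup>2) / (R / cosh t)
        = R * ((sinh t)\<^sup>2 - 1) / (cosh t) ^ 3"
      using ch(1)[of t] R(1) by (simp add: field_simps power2_eq_square power3_eq_cube)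
    moreover have "2 * (sinh t)\<^sup>2 - (cosh t)\<^sup>2 = (sinh t)\<^sup>2 - 1" using ch(2)[of t] by simp
    ultimately show "((\<lambda>t. - R * sinh t / (cosh t)\<^sup>2) has_real_derivative
        ((- R * sinh t / (cosh t)\<^sup>2)\<^sup>2 - (R / (cosh t)\<^sup>2)\<^sup>2) / (R / cosh t)) (at t)"
      by simp
  qed (use R(1) in auto)
  moreover have "range g = H2_circle c1 c2 c3"
  proof
    have iff: "p \<in> H2_circle c1 c2 c3 \<longleftrightarrow> p $ 2 > 0 \<and> (p $ 1 + c2 / c1)\<^sup>2 + (p $ 2)\<^sup>2 = R\<^sup>2" for p
      using geodesic_circle_iff[OF False c] R(2) by (auto simp: H2_circle_def H2_def)
    have unit: "(tanh t)\<^sup>2 + (1 / cosh t)\<^sup>2 = 1" for t :: real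
      by (simp add: tanh2 power_divide)
    show "range g \<subseteq> H2_circle c1 c2 c3"
    proof clarify
      fix t
      have "(R * tanh t)\<^sup>2 + (R / cosh t)\<^sup>2 = R\<^sup>2 * ((tanh t)\<^sup>2 + (1 / cosh t)\<^sup>2)"
        by (simp add: algebra_simps power_mult_distrib power_divide)
      then show "g t \<in> H2_circle c1 c2 c3" using R(1) unit[of t] by (simp add: iff g_def)
    qed
    show "H2_circle c1 c2 c3 \<subseteq> range g"
    proof
      fix p assume "p \<in> H2_circle c1 c2 c3"
      then have p: "p $ 2 > 0" "(p $ 1 + c2 / c1)\<^sup>2 + (p $ 2)\<^sup>2 = R\<^sup>2" using iff by auto
      \<comment> \<open>\<open>m\<close> is the normalized horizontal position, which the
        parametrization makes equal to \<open>tanh t\<close>; the height then agrees because both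
        heights are positive.\<close>
      define m where "m = (p $ 1 + c2 / c1) / R"
      define t where "t = artanh m"
      have m: "m\<^sup>2 + (p $ 2 / R)\<^sup>2 = 1"
        using p(2) R(1) by (simp add: m_def power_divide add_divide_distrib[symmetric])
      moreover have "(p $ 2 / R)\<^sup>2 > 0" using p(1) R(1) by simp
      ultimately have "m\<^sup>2 < 1" by linarith
      then have "\<bar>m\<bar> < 1" by (simp add: abs_square_less_1)
      then have t: "tanh t = m" unfolding t_def by (rule tanh_artanh_real)
      then have "(1 / cosh t)\<^sup>2 = (p $ 2 / R)\<^sup>2" using unit[of t] m by simp
      then have "1 / cosh t = p $ 2 / R"
        using p(1) R(1) ch(1)[of t] by (subst (asm) power2_eq_iff_nonneg) auto
      then have "R / cosh t = p $ 2"
        using R(1) by (simp add: field_simps)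
      moreover have "R * tanh t = p $ 1 + c2 / c1" using R(1) t by (simp add: m_def)
      ultimately have "p = g t" by (simp add: g_def vec_eq_iff forall_2)
      then show "p \<in> range g" by blast
    qed
  qed
  ultimately show ?thesis unfolding H2_geodesics_def by blast
qed

text \<open>From here on cylinders enter only through their equations, so a piece of a surface is
  recognized by checking constants.\<close>

lemma planes_and_cylinders_eq:
  "planes_and_cylinders = range horizontal_plane
    \<union> {geodesic_cylinder c1 c2 c3 | c1 c2 c3. c2\<^sup>2 + 2 * c1 * c3 = 1}"
proof -
  have eq: "H2_geodesics = {H2_circle c1 c2 c3 | c1 c2 c3. c2\<^sup>2 + 2 * c1 * c3 = 1}"
  proof
    show "H2_geodesics \<subseteq> {H2_circle c1 c2 c3 | c1 c2 c3. c2\<^sup>2 + 2 * c1 * c3 = 1}"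
    proof
      fix \<gamma> assume "\<gamma> \<in> H2_geodesics"
      then obtain c where c: "complete_geodesic H2_metric H2 c" "\<gamma> = range c"
        unfolding H2_geodesics_def by blast
      show "\<gamma> \<in> {H2_circle c1 c2 c3 | c1 c2 c3. c2\<^sup>2 + 2 * c1 * c3 = 1}"
        by (rule complete_geodesic_H2_range[OF c(1)]) (use c(2) in blast)
    qed
  qed (use H2_circle_geodesic in blast)
  have "vertical_cylinder ` H2_geodesics = {geodesic_cylinder c1 c2 c3 | c1 c2 c3. c2\<^sup>2 + 2 * c1 * c3 = 1}"
    unfolding eq vertical_cylinder_H2_circle[symmetric] by blast
  then show ?thesis unfolding planes_and_cylinders_def by simp
qed

lemma model_surfaces:
  assumes "S \<in> planes_and_cylinders"
  shows "umbilical S" "totally_geodesic S"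
  using assms geodesic_cylinder_umbilical umb_graph_umbilical(1)[of _ 0 0 0]
    umb_graph_umbilical(2)[of 0 0 0]
  unfolding planes_and_cylinders_eq horizontal_plane_eq_umb_graph by auto

lemma umb_graphs_umbilical: "S \<in> umb_graphs \<Longrightarrow> umbilical S"
  unfolding umb_graphs_def using umb_graph_umbilical(1) by auto

section \<open>Integration of the umbilicity equations\<close>

abbreviation dd :: "(real^2 \<Rightarrow> 'b::real_normed_vector) \<Rightarrow> real^2 \<Rightarrow> real^2 \<Rightarrow> 'b" where
  "dd f u w \<equiv> frechet_derivative f (at u) w"

lemma linear_eq_on_axes:
  fixes f g :: "real^2 \<Rightarrow> 'b::real_vector"
  assumes "linear f" "linear g" "f (axis 1 1) = g (axis 1 1)" "f (axis 2 1) = g (axis 2 1)"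
  shows "f w = g w"
proof -
  interpret f: linear f by fact
  interpret g: linear g by fact
  have "w = w $ 1 *\<^sub>R axis 1 1 + w $ 2 *\<^sub>R axis 2 1"
    by (simp add: vec_eq_iff forall_2 axis_def)
  then show ?thesis using assms(3,4) by (metis f.add f.scaleR g.add g.scaleR)
qed

text \<open>This replaces exterior differentiation: if two directional derivatives of
  \<open>f\<close> are given by formulas on \<open>V\<close>, differentiating the formulas crosswise
  gives equal values.\<close>

lemma mixed_derivatives_eq:
  fixes f :: "'a::real_normed_vector \<Rightarrow> real"
  assumes V: "open V" "u \<in> V" and f: "smooth_on V f"
    and v: "\<And>u. u \<in> V \<Longrightarrow> frechet_derivative f (at u) v = g u" "(g has_derivative g') (at u)"
    and w: "\<And>u. u \<in> V \<Longrightarrow> frechet_derivative f (at u) w = h u" "(h has_derivative h') (at u)"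
  shows "g' w = h' v"
proof -
  have "((\<lambda>u. frechet_derivative f (at u) v) has_derivative g') (at u)"
    by (rule has_derivative_transform_within_open[OF v(2) V]) (simp add: v(1))
  moreover have "((\<lambda>u. frechet_derivative f (at u) w) has_derivative h') (at u)"
    by (rule has_derivative_transform_within_open[OF w(2) V]) (simp add: w(1))
  ultimately show ?thesis
    using smooth_on_second_derivative_symmetric[OF V f, of v w] frechet_derivative_at by metis
qed

text \<open>A parametrized surface patch \<open>(x, y, z)\<close> with unit normal \<open>(a, b, \<nu>)\<close> in the orthonormal
  frame, whose shape operator is multiplication by \<open>l\<close>.\<close>

locale umbilical_patch =
  fixes u0 :: "real^2" and r :: real and x y z a b \<nu> l :: "real^2 \<Rightarrow> real"
  assumes r: "r > 0"
    and smooth: "smooth_on (ball u0 r) x" "smooth_on (ball u0 r) y" "smooth_on (ball u0 r) z"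
      "smooth_on (ball u0 r) a" "smooth_on (ball u0 r) b" "smooth_on (ball u0 r) \<nu>"
      "smooth_on (ball u0 r) l"
    and y_pos: "u \<in> ball u0 r \<Longrightarrow> y u > 0"
    and unit: "u \<in> ball u0 r \<Longrightarrow> (a u)\<^sup>2 + (b u)\<^sup>2 + (\<nu> u)\<^sup>2 = 1"
    and orth: "u \<in> ball u0 r \<Longrightarrow> a u * (dd x u w / y u) + b u * (dd y u w / y u) + \<nu> u * dd z u w = 0"
    and da: "u \<in> ball u0 r \<Longrightarrow> dd a u w = (b u - l u) * (dd x u w / y u)"
    and db: "u \<in> ball u0 r \<Longrightarrow> dd b u w = - a u * (dd x u w / y u) - l u * (dd y u w / y u)"
    and d\<nu>: "u \<in> ball u0 r \<Longrightarrow> dd \<nu> u w = - l u * dd z u w"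
    and immersed: "u \<in> ball u0 r \<Longrightarrow>
      cross3 (vector [dd x u (axis 1 1), dd y u (axis 1 1), dd z u (axis 1 1)])
        (vector [dd x u (axis 2 1), dd y u (axis 2 1), dd z u (axis 2 1)]) \<noteq> 0"
begin

abbreviation "e1 \<equiv> axis 1 (1::real) :: real^2"
abbreviation "e2 \<equiv> axis 2 (1::real) :: real^2"

lemma has_derivs:
  assumes "u \<in> ball u0 r"
  shows "(x has_derivative dd x u) (at u)" "(y has_derivative dd y u) (at u)"
    "(z has_derivative dd z u) (at u)" "(a has_derivative dd a u) (at u)"
    "(b has_derivative dd b u) (at u)" "(\<nu> has_derivative dd \<nu> u) (at u)"
    "(l has_derivative dd l u) (at u)"
  using smooth_on_has_derivative[OF _ assms] smooth by auto

text \<open>For \<open>\<nu> u \<noteq> 0\<close> orthogonality expresses \<open>dz\<close> through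
  \<open>dx\<close> and \<open>dy\<close>, so all three minors of the immersion are multiples of
  this one and would vanish with it.\<close>

lemma jacobian_nonzero:
  assumes u: "u \<in> ball u0 r" and \<nu>: "\<nu> u \<noteq> 0"
  shows "dd x u e1 * dd y u e2 - dd x u e2 * dd y u e1 \<noteq> 0"
proof
  assume J: "dd x u e1 * dd y u e2 - dd x u e2 * dd y u e1 = 0"
  have z: "y u * \<nu> u * dd z u w = - (a u * dd x u w + b u * dd y u w)" for w
    using orth[OF u, of w] y_pos[OF u] by (simp add: field_simps)
  have "y u * \<nu> u * (dd y u e1 * dd z u e2 - dd z u e1 * dd y u e2)
      = a u * (dd x u e1 * dd y u e2 - dd x u e2 * dd y u e1)"
    "y u * \<nu> u * (dd z u e1 * dd x u e2 - dd x u e1 * dd z u e2)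
      = b u * (dd x u e1 * dd y u e2 - dd x u e2 * dd y u e1)"
    using z[of e1] z[of e2] by algebra+
  then have "dd y u e1 * dd z u e2 - dd z u e1 * dd y u e2 = 0"
    "dd z u e1 * dd x u e2 - dd x u e1 * dd z u e2 = 0"
    using J \<nu> y_pos[OF u] by auto
  then show False
    using immersed[OF u] J by (simp add: cross3_def vec_eq_iff forall_3 vector_3 mult.commute)
qed

text \<open>The integrability conditions of \<open>a\<close> and \<open>b\<close> are two linear equations for the differential
  of \<open>l\<close>; the Jacobian of \<open>(x, y)\<close> is their determinant.\<close>

lemma dl_eq:
  assumes u: "u \<in> ball u0 r" and \<nu>: "\<nu> u \<noteq> 0"
  shows "dd l u w = \<nu> u * dd z u w"
proof -
  have y0: "y u \<noteq> 0" using y_pos[OF u] by simp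
  note d = has_derivs[OF u]
  have x2: "((\<lambda>u. dd x u w) has_derivative dd (\<lambda>u. dd x u w) u) (at u)" for w
    using smooth_on_has_derivative[OF smooth_on_deriv[OF smooth(1)] u] .
  have y2: "((\<lambda>u. dd y u w) has_derivative dd (\<lambda>u. dd y u w) u) (at u)" for w
    using smooth_on_has_derivative[OF smooth_on_deriv[OF smooth(2)] u] .
  have sx: "dd (\<lambda>u. dd x u e1) u e2 = dd (\<lambda>u. dd x u e2) u e1"
    and sy: "dd (\<lambda>u. dd y u e1) u e2 = dd (\<lambda>u. dd y u e2) u e1"
    using smooth_on_second_derivative_symmetric[OF open_ball u] smooth by auto
  define P Q R S J where "P = dd x u e1" and "Q = dd x u e2" and "R = dd y u e1" and "S = dd y u e2"
    and "J = P * S - Q * R"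
  \<comment> \<open>Naming the reciprocal makes the integrability identities polynomial, with
    \<open>y u * i = 1\<close> as the only side relation.\<close>
  define i where "i = inverse (y u)"
  have i: "y u * i = 1" using y0 by (simp add: i_def)
  have div_y: "t / y u = t * i" "t / (y u)\<^sup>2 = t * (i * i)" for t
    by (simp_all add: i_def divide_inverse power2_eq_square)
  note PQ = P_def[symmetric] Q_def[symmetric] R_def[symmetric] S_def[symmetric]
  have J: "J \<noteq> 0" using jacobian_nonzero[OF u \<nu>] by (simp add: J_def P_def Q_def R_def S_def)
  have "((\<lambda>u. (b u - l u) * (dd x u w / y u)) has_derivative
      (\<lambda>v. (dd b u v - dd l u v) * (dd x u w / y u)
        + (b u - l u) * (dd (\<lambda>u. dd x u w) u v / y u - dd x u w * dd y u v / (y u)\<^sup>2))) (at u)" for w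
    using y0 by (auto intro!: derivative_eq_intros d x2 simp: field_simps power2_eq_square)
  from mixed_derivatives_eq[OF open_ball u smooth(4) da this da this, of e1 e2]
  have "(dd b u e2 - dd l u e2) * (P / y u) + (b u - l u) * (dd (\<lambda>u. dd x u e1) u e2 / y u - P * S / (y u)\<^sup>2)
    = (dd b u e1 - dd l u e1) * (Q / y u) + (b u - l u) * (dd (\<lambda>u. dd x u e2) u e1 / y u - Q * R / (y u)\<^sup>2)"
    unfolding PQ by simp
  then have "(dd b u e2 - dd l u e2) * (P * i) + (b u - l u) * (dd (\<lambda>u. dd x u e2) u e1 * i - P * S * (i * i))
    = (dd b u e1 - dd l u e1) * (Q * i) + (b u - l u) * (dd (\<lambda>u. dd x u e2) u e1 * i - Q * R * (i * i))"
    unfolding sx div_y .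
  then have "(dd b u e2 - dd l u e2) * P * y u - (b u - l u) * (P * S)
      = (dd b u e1 - dd l u e1) * Q * y u - (b u - l u) * (Q * R)"
    using i by algebra
  moreover have dbu: "dd b u e1 * y u = - a u * P - l u * R" "dd b u e2 * y u = - a u * Q - l u * S"
    unfolding db[OF u] PQ using y0 by (simp_all add: field_simps)
  \<comment> \<open>In forms this is \<open>d\<lambda> \<and> \<theta>\<^sub>1 = b \<theta>\<^sub>1
    \<and> \<theta>\<^sub>2\<close>; the second derivatives of \<open>x\<close> have cancelled by
    \<open>sx\<close>. \<open>E2\<close> is the analogous identity from \<open>b\<close>.\<close>
  ultimately have E1: "y u * (dd l u e1 * Q - dd l u e2 * P) = b u * J"
    unfolding J_def by algebra
  have "((\<lambda>u. - a u * (dd x u w / y u) - l u * (dd y u w / y u)) has_derivative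
      (\<lambda>v. - dd a u v * (dd x u w / y u)
        - a u * (dd (\<lambda>u. dd x u w) u v / y u - dd x u w * dd y u v / (y u)\<^sup>2)
        - dd l u v * (dd y u w / y u)
        - l u * (dd (\<lambda>u. dd y u w) u v / y u - dd y u w * dd y u v / (y u)\<^sup>2))) (at u)" for w
    using y0 by (auto intro!: derivative_eq_intros d x2 y2 simp: field_simps power2_eq_square)
  from mixed_derivatives_eq[OF open_ball u smooth(5) db this db this, of e1 e2]
  have "- dd a u e2 * (P / y u) - a u * (dd (\<lambda>u. dd x u e1) u e2 / y u - P * S / (y u)\<^sup>2)
        - dd l u e2 * (R / y u) - l u * (dd (\<lambda>u. dd y u e1) u e2 / y u - R * S / (y u)\<^sup>2)
    = - dd a u e1 * (Q / y u) - a u * (dd (\<lambda>u. dd x u e2) u e1 / y u - Q * R / (y u)\<^sup>2)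
        - dd l u e1 * (S / y u) - l u * (dd (\<lambda>u. dd y u e2) u e1 / y u - S * R / (y u)\<^sup>2)"
    unfolding PQ by simp
  then have "- dd a u e2 * (P * i) - a u * (dd (\<lambda>u. dd x u e2) u e1 * i - P * S * (i * i))
        - dd l u e2 * (R * i) - l u * (dd (\<lambda>u. dd y u e2) u e1 * i - R * S * (i * i))
    = - dd a u e1 * (Q * i) - a u * (dd (\<lambda>u. dd x u e2) u e1 * i - Q * R * (i * i))
        - dd l u e1 * (S * i) - l u * (dd (\<lambda>u. dd y u e2) u e1 * i - S * R * (i * i))"
    unfolding sx sy div_y .
  then have "- dd a u e2 * P * y u + a u * (P * S) - dd l u e2 * R * y u
      = - dd a u e1 * Q * y u + a u * (Q * R) - dd l u e1 * S * y u"
    using i by algebra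
  moreover have "dd a u e1 * y u = (b u - l u) * P" "dd a u e2 * y u = (b u - l u) * Q"
    unfolding da[OF u] PQ using y0 by simp_all
  ultimately have E2: "y u * (dd l u e1 * S - dd l u e2 * R) = - a u * J"
    unfolding J_def by algebra
  \<comment> \<open>Cramer's rule for \<open>E1\<close> and \<open>E2\<close>, with determinant
    \<open>J\<close>.\<close>
  have "y u * dd l u e1 * J = - (a u * P + b u * R) * J" "y u * dd l u e2 * J = - (a u * Q + b u * S) * J"
    using E1 E2 unfolding J_def by algebra+
  then have l12: "y u * dd l u e1 = - (a u * P + b u * R)" "y u * dd l u e2 = - (a u * Q + b u * S)"
    using J by (metis mult_right_cancel)+
  have z: "y u * (\<nu> u * dd z u w) = - (a u * dd x u w + b u * dd y u w)" for w
    using orth[OF u, of w] y0 by (simp add: field_simps)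
  have on_axes: "dd l u e1 = \<nu> u * dd z u e1" "dd l u e2 = \<nu> u * dd z u e2"
    using l12 z[of e1] z[of e2] y0 unfolding PQ by (metis mult_left_cancel)+
  show ?thesis
  proof (rule linear_eq_on_axes[OF _ _ on_axes])
    show "linear (dd l u)" using d(7) by (rule has_derivative_linear)
    interpret z: linear "dd z u" using d(3) by (rule has_derivative_linear)
    show "linear (\<lambda>w. \<nu> u * dd z u w)"
      by (rule linearI) (simp_all add: z.add z.scaleR algebra_simps)
  qed
qed

lemma const_on_ball:
  assumes "\<And>u. u \<in> ball u0 r \<Longrightarrow> (f has_derivative f' u) (at u)"
    "\<And>u w. u \<in> ball u0 r \<Longrightarrow> f' u w = 0" "u \<in> ball u0 r"
  shows "f u = (f u0 :: real)"
proof (rule zero_derivative_imp_const_on_ball[OF _ assms(3)])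
  show "(f has_derivative (\<lambda>v. 0)) (at u)" if "u \<in> ball u0 r" for u
    using assms(1)[OF that] assms(2)[OF that] by (metis ext)
qed

text \<open>Taking the relation for \<open>dl\<close> as hypothesis covers both cases: it holds
  where \<open>\<nu>\<close> has no zero, and trivially where \<open>\<nu>\<close> and
  \<open>l\<close> vanish. The constants are read off at the centre \<open>u0\<close>, and their
  derivatives vanish by the equations for \<open>a\<close>, \<open>b\<close> and
  \<open>l\<close>.\<close>

lemma normal_constants:
  assumes dl: "\<And>u w. u \<in> ball u0 r \<Longrightarrow> dd l u w = \<nu> u * dd z u w"
  obtains c1 c2 c3 where "\<forall>u\<in>ball u0 r. a u = - (c1 * x u + c2)
    \<and> b u = umb_lambda c1 c2 c3 (x u) (y u) - c1 * y u \<and> l u = umb_lambda c1 c2 c3 (x u) (y u)"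
proof -
  have y0: "y u \<noteq> 0" if "u \<in> ball u0 r" for u using y_pos[OF that] by simp
  have dl': "dd l u w = - (a u * (dd x u w / y u) + b u * (dd y u w / y u))" if "u \<in> ball u0 r" for u w
    using dl[OF that, of w] orth[OF that, of w] by linarith
  define c1 where "c1 = (l u0 - b u0) / y u0"
  have k1: "(l u - b u) / y u = c1" if u: "u \<in> ball u0 r" for u
    unfolding c1_def
  proof (rule const_on_ball[OF _ _ u, of "\<lambda>u. (l u - b u) / y u"])
    show "((\<lambda>u. (l u - b u) / y u) has_derivative
        (\<lambda>w. (dd l u w - dd b u w) / y u - (l u - b u) * dd y u w / (y u)\<^sup>2)) (at u)"
      if "u \<in> ball u0 r" for u
      using y0[OF that] by (auto intro!: derivative_eq_intros has_derivs[OF that]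
          simp: field_simps power2_eq_square)
    show "(dd l u w - dd b u w) / y u - (l u - b u) * dd y u w / (y u)\<^sup>2 = 0"
      if "u \<in> ball u0 r" for u w
      unfolding dl'[OF that] db[OF that] using y0[OF that] by (simp add: field_simps power2_eq_square)
  qed
  have c1: "l u - b u = c1 * y u" if "u \<in> ball u0 r" for u
    using k1[OF that] y0[OF that] by (simp add: field_simps)
  define c2 where "c2 = - a u0 - c1 * x u0"
  have k2: "- a u - c1 * x u = c2" if u: "u \<in> ball u0 r" for u
    unfolding c2_def
  proof (rule const_on_ball[OF _ _ u, of "\<lambda>u. - a u - c1 * x u"])
    show "((\<lambda>u. - a u - c1 * x u) has_derivative (\<lambda>w. - dd a u w - c1 * dd x u w)) (at u)"
      if "u \<in> ball u0 r" for u
      by (auto intro!: derivative_eq_intros has_derivs[OF that])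
    show "- dd a u w - c1 * dd x u w = 0" if "u \<in> ball u0 r" for u w
    proof -
      have "(b u - l u) * (dd x u w / y u) = - c1 * y u * (dd x u w / y u)"
        using c1[OF that] by (simp add: algebra_simps)
      then show ?thesis unfolding da[OF that] using y0[OF that] by simp
    qed
  qed
  have c2: "a u = - (c1 * x u + c2)" if "u \<in> ball u0 r" for u
    using k2[OF that] by (simp add: algebra_simps)
  define c3 where "c3 = c1 / 2 * ((x u0)\<^sup>2 + (y u0)\<^sup>2) + c2 * x u0 - l u0 * y u0"
  have k3: "c1 / 2 * ((x u)\<^sup>2 + (y u)\<^sup>2) + c2 * x u - l u * y u = c3" if u: "u \<in> ball u0 r" for u
    unfolding c3_def
  proof (rule const_on_ball[OF _ _ u, of "\<lambda>u. c1 / 2 * ((x u)\<^sup>2 + (y u)\<^sup>2) + c2 * x u - l u * y u"])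
    show "((\<lambda>u. c1 / 2 * ((x u)\<^sup>2 + (y u)\<^sup>2) + c2 * x u - l u * y u) has_derivative
       (\<lambda>w. (c1 * x u + c2) * dd x u w + c1 * y u * dd y u w - (dd l u w * y u + l u * dd y u w))) (at u)"
      if "u \<in> ball u0 r" for u
      by (auto intro!: derivative_eq_intros has_derivs[OF that] simp: field_simps power2_eq_square)
    show "(c1 * x u + c2) * dd x u w + c1 * y u * dd y u w - (dd l u w * y u + l u * dd y u w) = 0"
      if "u \<in> ball u0 r" for u w
    proof -
      have "dd l u w * y u = - (a u * dd x u w + b u * dd y u w)"
        unfolding dl'[OF that] using y0[OF that] by (simp add: field_simps)
      then show ?thesis using c1[OF that] c2[OF that] by algebra
    qed
  qed
  have l: "l u = umb_lambda c1 c2 c3 (x u) (y u)" if "u \<in> ball u0 r" for u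
    using k3[OF that] y0[OF that] by (simp add: umb_lambda_def field_simps)
  have "b u = umb_lambda c1 c2 c3 (x u) (y u) - c1 * y u" if "u \<in> ball u0 r" for u
    using c1[OF that] l[OF that] by simp
  with c2 l that[of c1 c2 c3] show ?thesis by blast
qed

text \<open>The unit length of the normal, inserted into \<open>umb_unit_identity\<close>.\<close>

lemma umb_j_eq:
  assumes "u \<in> ball u0 r" "a u = - (c1 * x u + c2)"
    "b u = umb_lambda c1 c2 c3 (x u) (y u) - c1 * y u" "l u = umb_lambda c1 c2 c3 (x u) (y u)"
  shows "umb_j c1 c2 c3 = (l u)\<^sup>2 + (\<nu> u)\<^sup>2"
proof -
  have "(c1 * x u + c2)\<^sup>2 = (a u)\<^sup>2" unfolding assms(2) by (rule power2_minus[symmetric])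
  then have "(a u)\<^sup>2 + (b u)\<^sup>2 = 1 + (l u)\<^sup>2 - umb_j c1 c2 c3"
    using umb_unit_identity[of "y u" c1 "x u" c2 c3] y_pos[OF assms(1)] assms(3,4) by simp
  then show ?thesis using unit[OF assms(1)] by linarith
qed

text \<open>Since \<open>j = l^2 + \<nu>^2\<close> and \<open>\<nu> > 0\<close>,
  \<open>\<nu>\<close> is the positive root of \<open>j - l^2\<close>, and
  \<open>dl = \<nu> dz\<close> integrates to the arctangent; the constant \<open>c\<close> is the
  value of the difference at \<open>u0\<close>.\<close>

lemma graph_piece:
  assumes \<nu>: "\<And>u. u \<in> ball u0 r \<Longrightarrow> \<nu> u > 0"
  obtains S where "S \<in> umb_graphs" "\<forall>u\<in>ball u0 r. vector [x u, y u, z u] \<in> S"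
proof -
  have dl: "dd l u w = \<nu> u * dd z u w" if "u \<in> ball u0 r" for u w
    using dl_eq[OF that] \<nu>[OF that] by simp
  obtain c1 c2 c3 where const: "\<forall>u\<in>ball u0 r. a u = - (c1 * x u + c2)
    \<and> b u = umb_lambda c1 c2 c3 (x u) (y u) - c1 * y u \<and> l u = umb_lambda c1 c2 c3 (x u) (y u)"
    by (rule normal_constants[OF dl])
  have c: "a u = - (c1 * x u + c2)" "b u = umb_lambda c1 c2 c3 (x u) (y u) - c1 * y u"
    and lam: "l u = umb_lambda c1 c2 c3 (x u) (y u)" if "u \<in> ball u0 r" for u
    using const that by auto
  let ?j = "umb_j c1 c2 c3"
  have j: "?j = (l u)\<^sup>2 + (\<nu> u)\<^sup>2" if "u \<in> ball u0 r" for u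
    using umb_j_eq[OF that c(1)[OF that] c(2)[OF that] lam[OF that]] .
  have lj: "(l u)\<^sup>2 < ?j" if "u \<in> ball u0 r" for u using j[OF that] \<nu>[OF that] by simp
  have sq: "sqrt (?j - (l u)\<^sup>2) = \<nu> u" if "u \<in> ball u0 r" for u
    using j[OF that] \<nu>[OF that] by simp
  let ?f = "\<lambda>u. z u - arctan (l u / sqrt (?j - (l u)\<^sup>2))"
  have fconst: "?f u = ?f u0" if u: "u \<in> ball u0 r" for u
  proof (rule const_on_ball[OF _ _ u, of ?f])
    show "(?f has_derivative (\<lambda>w. dd z u w - 1 / \<nu> u * dd l u w)) (at u)" if u: "u \<in> ball u0 r" for u
      using has_derivative_diff[OF has_derivs(3)[OF u] has_derivative_compose[OF has_derivs(7)[OF u]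
          DERIV_arctan_div_sqrt[OF lj[OF u], unfolded has_field_derivative_def sq[OF u]]]] by simp
    show "dd z u w - 1 / \<nu> u * dd l u w = 0" if "u \<in> ball u0 r" for u w
      unfolding dl[OF that] using \<nu>[OF that] by simp
  qed
  have "u0 \<in> ball u0 r" using r by simp
  from lj[OF this] have "?j > 0" using zero_le_power2[of "l u0"] by linarith
  then have "umb_graph (?f u0) c1 c2 c3 \<in> umb_graphs" unfolding umb_graphs_def by blast
  moreover have "vector [x u, y u, z u] \<in> umb_graph (?f u0) c1 c2 c3" if "u \<in> ball u0 r" for u
    using lj[OF that] y_pos[OF that] fconst[OF that]
    by (simp add: umb_graph_def H2R_def umb_fun_def lam[OF that, symmetric])
  ultimately show ?thesis using that by blast
qed

text \<open>If \<open>l\<close> vanishes, \<open>0 = dl = \<nu> dz\<close> forces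
  \<open>dz = 0\<close>. This separate case places totally geodesic pieces in planes instead of in
  members of the graph family.\<close>

lemma plane_piece:
  assumes "\<And>u. u \<in> ball u0 r \<Longrightarrow> \<nu> u \<noteq> 0" and l0: "\<And>u. u \<in> ball u0 r \<Longrightarrow> l u = 0"
  obtains c where "\<forall>u\<in>ball u0 r. vector [x u, y u, z u] \<in> horizontal_plane c"
proof -
  have "dd l u w = 0" if u: "u \<in> ball u0 r" for u w
  proof -
    have "(l has_derivative (\<lambda>w. 0)) (at u)"
      by (rule has_derivative_transform_within_open[OF has_derivative_const open_ball u]) (simp add: l0)
    then show ?thesis using frechet_derivative_at by metis
  qed
  then have "dd z u w = 0" if "u \<in> ball u0 r" for u w
    using dl_eq[OF that] assms(1)[OF that] that by (metis mult_eq_0_iff)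
  then have "z u = z u0" if "u \<in> ball u0 r" for u
    using const_on_ball[OF has_derivs(3)] that by blast
  then show ?thesis
    using that[of "z u0"] y_pos by (simp add: horizontal_plane_def H2R_def)
qed

text \<open>From \<open>\<nu> = 0\<close> follows \<open>l dz = 0\<close>. If \<open>l\<close> were
  nonzero at a point, the tangent plane there would be horizontal and yet orthogonal to the nonzero
  horizontal vector \<open>(a, b)\<close>, contrary to immersion. So \<open>l = 0\<close> throughout
  and \<open>umb_j\<close> vanishes, which is the normalization.\<close>

lemma cylinder_piece:
  assumes \<nu>0: "\<And>u. u \<in> ball u0 r \<Longrightarrow> \<nu> u = 0"
  obtains c1 c2 c3 where "c2\<^sup>2 + 2 * c1 * c3 = 1"
    "\<forall>u\<in>ball u0 r. vector [x u, y u, z u] \<in> geodesic_cylinder c1 c2 c3"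
proof -
  have zero: "dd f u w = 0" if f: "\<And>u. u \<in> ball u0 r \<Longrightarrow> f u = 0" and u: "u \<in> ball u0 r"
    for f :: "real^2 \<Rightarrow> real" and u w
  proof -
    have "(f has_derivative (\<lambda>w. 0)) (at u)"
      by (rule has_derivative_transform_within_open[OF has_derivative_const open_ball u]) (simp add: f)
    then show ?thesis using frechet_derivative_at by metis
  qed
  have l0: "l u = 0" if u: "u \<in> ball u0 r" for u
  proof (rule ccontr)
    assume "l u \<noteq> 0"
    then have dz: "dd z u w = 0" for w
      using d\<nu>[OF u, of w] zero[OF \<nu>0 u] by simp
    have o: "a u * dd x u w + b u * dd y u w = 0" for w
      using orth[OF u, of w] y_pos[OF u] dz by (simp add: field_simps)
    have "a u * (dd x u e1 * dd y u e2 - dd x u e2 * dd y u e1) = 0"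
      "b u * (dd x u e1 * dd y u e2 - dd x u e2 * dd y u e1) = 0"
      using o[of e1] o[of e2] by algebra+
    moreover have "a u \<noteq> 0 \<or> b u \<noteq> 0" using unit[OF u] \<nu>0[OF u] by auto
    ultimately have "dd x u e1 * dd y u e2 - dd x u e2 * dd y u e1 = 0" by auto
    then show False
      using immersed[OF u] dz by (simp add: cross3_def vec_eq_iff forall_3 vector_3 mult.commute)
  qed
  have dl: "dd l u w = \<nu> u * dd z u w" if "u \<in> ball u0 r" for u w
    using zero[OF l0 that] \<nu>0[OF that] by simp
  obtain c1 c2 c3 where const: "\<forall>u\<in>ball u0 r. a u = - (c1 * x u + c2)
    \<and> b u = umb_lambda c1 c2 c3 (x u) (y u) - c1 * y u \<and> l u = umb_lambda c1 c2 c3 (x u) (y u)"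
    by (rule normal_constants[OF dl])
  have c: "a u = - (c1 * x u + c2)" "b u = umb_lambda c1 c2 c3 (x u) (y u) - c1 * y u"
    and lam: "l u = umb_lambda c1 c2 c3 (x u) (y u)" if "u \<in> ball u0 r" for u
    using const that by auto
  have u0: "u0 \<in> ball u0 r" using r by simp
  show ?thesis
  proof (rule that[of c2 c1 c3])
    have "umb_j c1 c2 c3 = 0"
      using umb_j_eq[OF u0 c(1)[OF u0] c(2)[OF u0] lam[OF u0]] l0[OF u0] \<nu>0[OF u0] by simp
    then show "c2\<^sup>2 + 2 * c1 * c3 = 1" by (simp add: umb_j_def)
    show "\<forall>u\<in>ball u0 r. vector [x u, y u, z u] \<in> geodesic_cylinder c1 c2 c3"
    proof
      fix u assume "u \<in> ball u0 r"
      then show "vector [x u, y u, z u] \<in> geodesic_cylinder c1 c2 c3"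
        using lam[of u] l0[of u] y_pos[of u]
        by (simp add: geodesic_cylinder_def H2R_def umb_lambda_def)
    qed
  qed
qed

end

text \<open>Reversing the normal changes the sign of the factor as well but not the surface; it
  reduces \<open>\<nu> < 0\<close> to the positive case of \<open>graph_piece\<close>.\<close>

lemma umbilical_patch_uminus:
  assumes "umbilical_patch u0 r x y z a b \<nu> l"
  shows "umbilical_patch u0 r x y z (\<lambda>u. - a u) (\<lambda>u. - b u) (\<lambda>u. - \<nu> u) (\<lambda>u. - l u)"
proof -
  interpret umbilical_patch u0 r x y z a b \<nu> l by fact
  have neg: "dd (\<lambda>u. - f u) u w = - dd f u w"
    if "(f has_derivative dd f u) (at u)" for f :: "real^2 \<Rightarrow> real" and u w
    using frechet_derivative_at[OF has_derivative_minus[OF that]] by metis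
  show ?thesis
  proof
    fix u w assume u: "u \<in> ball u0 r"
    note d = neg[OF has_derivs(4)[OF u]] neg[OF has_derivs(5)[OF u]] neg[OF has_derivs(6)[OF u]]
    show "- a u * (dd x u w / y u) + - b u * (dd y u w / y u) + - \<nu> u * dd z u w = 0"
      using orth[OF u, of w] by linarith
    show "dd (\<lambda>u. - a u) u w = (- b u - - l u) * (dd x u w / y u)"
    proof -
      have "- b u - - l u = - (b u - l u)" by simp
      then show ?thesis unfolding d da[OF u] by (simp only: mult_minus_left)
    qed
    show "dd (\<lambda>u. - b u) u w = - (- a u) * (dd x u w / y u) - - l u * (dd y u w / y u)"
      unfolding d db[OF u] by simp
    show "dd (\<lambda>u. - \<nu> u) u w = - (- l u) * dd z u w"
      unfolding d d\<nu>[OF u] by simp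
  qed (use r smooth y_pos unit immersed in \<open>auto intro: smooth_on_intros\<close>)
qed

section \<open>The unit normal of a parametrized surface\<close>

lemma frame_shape:
  assumes "p $ 2 > 0"
  shows "frame p (- (vector [v $ 2 * a + p $ 2 * a', v $ 2 * b + p $ 2 * b', \<nu>']
        + christoffel_form H2R_metric p v (vector [p $ 2 * a, p $ 2 * b, \<nu>])))
    = vector [- (a' - b * frame p v $ 1), - (b' + a * frame p v $ 1), - \<nu>']"
  using assms
  by (simp add: christoffel_form_H2R vec_eq_iff forall_3 vector_3 field_simps power2_eq_square)

lemma frechet_derivative_vec_nth:
  assumes "(X has_derivative frechet_derivative X (at u)) (at u)"
  shows "frechet_derivative (\<lambda>u. X u $ i) (at u) w = frechet_derivative X (at u) w $ i"
  using frechet_derivative_at[OF bounded_linear.has_derivative[OF bounded_linear_vec_nth assms]] by metis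

text \<open>The normal is the normalized cross product of the two chart velocities taken in the
  orthonormal frame. Transported by the inverse chart it becomes a field \<open>\<xi>\<close> on the
  patch, and its shape operator is expressed through parameter derivatives.\<close>

lemma local_param_unit_normal:
  assumes X: "local_param M V X" and M: "M \<subseteq> H2R"
  obtains a b \<nu> \<xi> where "smooth_on V a" "smooth_on V b" "smooth_on V \<nu>"
    "\<And>u. u \<in> V \<Longrightarrow> (a u)\<^sup>2 + (b u)\<^sup>2 + (\<nu> u)\<^sup>2 = 1"
    "\<And>u w. u \<in> V \<Longrightarrow> vector [a u, b u, \<nu> u] \<bullet> frame (X u) (dd X u w) = 0"
    "unit_normal_field (X ` V) \<xi>"
    "\<And>u w. u \<in> V \<Longrightarrow> frame (X u) (shape_operator (X ` V) \<xi> (X u) (dd X u w))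
      = vector [- (dd a u w - b u * frame (X u) (dd X u w) $ 1),
          - (dd b u w + a u * frame (X u) (dd X u w) $ 1), - dd \<nu> u w]"
proof -
  have V: "open V" and sX: "smooth_on V X" using local_paramD[OF X] by auto
  have XV: "X ` V \<subseteq> H2R" using openin_imp_subset[OF local_paramD(3)[OF X]] M by blast
  have y: "X u $ 2 > 0" if "u \<in> V" for u using XV that by (auto simp: H2R_def)
  have X': "local_param (X ` V) V X" using local_param_restrict(2)[OF X V] by simp
  define A where "A u = frame (X u) (dd X u (axis 1 1))" for u
  define B where "B u = frame (X u) (dd X u (axis 2 1))" for u
  define k where "k u = cross3 (A u) (B u)" for u
  have k0: "k u \<noteq> 0" if u: "u \<in> V" for u
    unfolding k_def A_def B_def
    using has_derivative_linear[OF local_paramD(4)[OF X u]] local_paramD(5)[OF X u] y[OF u]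
    by (intro cross_frame_nonzero) auto
  have sm: "smooth_on V (\<lambda>u. X u $ i)" "smooth_on V (\<lambda>u. dd X u w $ i)" for i w
    using smooth_on_vec_iff[OF V, THEN iffD1, OF sX]
      smooth_on_vec_iff[OF V, THEN iffD1, OF smooth_on_deriv[OF sX, of w]] by blast+
  have sAB: "smooth_on V (\<lambda>u. A u $ i)" "smooth_on V (\<lambda>u. B u $ i)" for i
    using exhaust_3[of i] y unfolding A_def B_def
    by (auto intro!: smooth_on_intros[OF V] sm simp: less_imp_neq[symmetric])
  have sk: "smooth_on V (\<lambda>u. k u $ i)" for i
    using exhaust_3[of i] unfolding k_def cross3_def
    by (auto intro!: smooth_on_intros[OF V] sAB simp: vector_3)
  define q where "q u = (k u $ 1)\<^sup>2 + (k u $ 2)\<^sup>2 + (k u $ 3)\<^sup>2" for u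
  have qk: "q u = k u \<bullet> k u" for u by (simp add: q_def inner_vec_def sum_3 power2_eq_square)
  have q0: "q u > 0" if "u \<in> V" for u using k0[OF that] by (simp add: qk)
  have sq: "smooth_on V (\<lambda>u. sqrt (q u))"
    unfolding q_def using q0 by (intro smooth_on_intros[OF V] sk) (simp add: q_def)
  define a b \<nu> where "a u = k u $ 1 / sqrt (q u)" and "b u = k u $ 2 / sqrt (q u)"
    and "\<nu> u = k u $ 3 / sqrt (q u)" for u
  have sm3: "smooth_on V a" "smooth_on V b" "smooth_on V \<nu>"
    unfolding a_def[abs_def] b_def[abs_def] \<nu>_def[abs_def] using q0
    by (auto intro!: smooth_on_intros[OF V] sk sq simp: less_imp_neq[symmetric])
  have n: "vector [a u, b u, \<nu> u] = (1 / sqrt (q u)) *\<^sub>R k u" for u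
    by (simp add: vec_eq_iff forall_3 vector_3 a_def b_def \<nu>_def)
  have unit: "vector [a u, b u, \<nu> u] \<bullet> (vector [a u, b u, \<nu> u] :: real^3) = 1" if "u \<in> V" for u
    using q0[OF that] by (simp add: n qk[symmetric])
  then have unit': "(a u)\<^sup>2 + (b u)\<^sup>2 + (\<nu> u)\<^sup>2 = 1" if "u \<in> V" for u
    using that by (simp add: inner_vec_def sum_3 vector_3 power2_eq_square)
  have orth: "vector [a u, b u, \<nu> u] \<bullet> frame (X u) (dd X u w) = 0" if u: "u \<in> V" for u w
  proof -
    have lin: "linear (frame (X u) \<circ> dd X u)"
      using has_derivative_linear[OF local_paramD(4)[OF X u]] linear_frame by (rule linear_compose)
    have "linear (\<lambda>w. vector [a u, b u, \<nu> u] \<bullet> frame (X u) (dd X u w))"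
      using linear_compose[OF lin bounded_linear.linear[OF bounded_linear_inner_right]]
      by (simp add: o_def)
    moreover have "k u \<bullet> A u = 0" "k u \<bullet> B u = 0"
      unfolding k_def by (simp_all add: dot_cross_self)
    then have "vector [a u, b u, \<nu> u] \<bullet> frame (X u) (dd X u (axis i 1)) = 0" for i :: 2
      using exhaust_2[of i] by (auto simp: n A_def B_def)
    ultimately show ?thesis
      using linear_eq_on_axes[of _ "\<lambda>w. 0" w] linear_zero by metis
  qed
  obtain Y where Y: "homeomorphism V (X ` V) X Y" and YL: "\<And>u. u \<in> V \<Longrightarrow>
      \<exists>L. (Y has_derivative L) (at (X u) within X ` V) \<and> (\<forall>h. L (dd X u h) = h)"
    using local_param_left_inverse[OF X] by metis
  have YX: "Y (X u) = u" if "u \<in> V" for u using Y that by (simp add: homeomorphism_def)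
  define \<eta> :: "real^2 \<Rightarrow> real^3" where
    "\<eta> u = vector [X u $ 2 * a u, X u $ 2 * b u, \<nu> u]" for u
  have s\<eta>: "smooth_on V \<eta>"
    unfolding \<eta>_def by (intro smooth_on_vector_3 smooth_on_intros[OF V] sm sm3 V)
  define \<xi> where "\<xi> = \<eta> \<circ> Y"
  have \<xi>X: "\<xi> (X u) = \<eta> u" if "u \<in> V" for u using YX[OF that] by (simp add: \<xi>_def)
  have f\<eta>: "frame (X u) (\<eta> u) = vector [a u, b u, \<nu> u]" if "u \<in> V" for u
    unfolding \<eta>_def using y[OF that] by simp
  have normal: "unit_normal_field (X ` V) \<xi>"
    unfolding unit_normal_field_def
  proof (intro conjI ballI)
    have "smooth_on V (\<xi> \<circ> X)"
      unfolding smooth_on_def using Ck_on_cong[OF V smooth_onD_Ck[OF s\<eta>]] \<xi>X by (metis comp_apply)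
    then show "smooth_along (X ` V) \<xi>"
      unfolding smooth_along_def using X' by blast
    fix p assume "p \<in> X ` V"
    then obtain u where u: "u \<in> V" "p = X u" by blast
    show "metric_inner H2R_metric p (\<xi> p) (\<xi> p) = 1"
      unfolding inner_frame[symmetric] u(2) \<xi>X[OF u(1)] f\<eta>[OF u(1)] by (rule unit[OF u(1)])
    fix v assume "v \<in> tangent_plane (X ` V) p"
    then obtain w where w: "v = dd X u w"
      unfolding u(2) tangent_plane_eq[OF X' u(1)] by blast
    show "metric_inner H2R_metric p (\<xi> p) v = 0"
      unfolding inner_frame[symmetric] u(2) \<xi>X[OF u(1)] f\<eta>[OF u(1)] w by (rule orth[OF u(1)])
  qed
  have shape: "frame (X u) (shape_operator (X ` V) \<xi> (X u) (dd X u w))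
      = vector [- (dd a u w - b u * frame (X u) (dd X u w) $ 1),
          - (dd b u w + a u * frame (X u) (dd X u w) $ 1), - dd \<nu> u w]" if u: "u \<in> V" for u w
  proof -
    obtain L where L: "(Y has_derivative L) (at (X u) within X ` V)" "\<And>h. L (dd X u h) = h"
      using YL[OF u] by blast
    have "(\<eta> has_derivative dd \<eta> u) (at (Y (X u)) within Y ` X ` V)"
      unfolding YX[OF u] by (rule has_derivative_at_withinI[OF smooth_on_has_derivative[OF s\<eta> u]])
    from diff_chain_within[OF L(1) this]
    \<comment> \<open>\<open>L\<close> inverts the derivative of \<open>X\<close>, so on
      \<open>dd X u w\<close> this derivative of \<open>\<xi>\<close> is simply
      \<open>dd \<eta> u w\<close>.\<close>
    have D: "(\<xi> has_derivative dd \<eta> u \<circ> L) (at (X u) within X ` V)" unfolding \<xi>_def .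
    have "frechet_derivative \<xi> (at (X u) within X ` V) (dd X u w) = dd \<eta> u w"
      using frechet_derivative_within_tangent(1)[OF X' u D, of w] L(2) by simp
    also have "\<dots> = vector [dd X u w $ 2 * a u + X u $ 2 * dd a u w,
        dd X u w $ 2 * b u + X u $ 2 * dd b u w, dd \<nu> u w]"
    proof -
      have prod: "dd (\<lambda>u. X u $ 2 * f u) u w = dd X u w $ 2 * f u + X u $ 2 * dd f u w"
        if "smooth_on V f" for f
      proof -
        have "((\<lambda>u. X u $ 2 * f u) has_derivative (\<lambda>w. X u $ 2 * dd f u w + dd X u w $ 2 * f u)) (at u)"
          by (intro has_derivative_mult smooth_on_has_derivative[OF that u]
              bounded_linear.has_derivative[OF bounded_linear_vec_nth local_paramD(4)[OF X u]])
        from frechet_derivative_at[OF this, symmetric] show ?thesis by simp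
      qed
      have "dd \<eta> u w $ i = dd (\<lambda>u. \<eta> u $ i) u w" for i
        using frechet_derivative_vec_nth[OF smooth_on_has_derivative[OF s\<eta> u]] by metis
      moreover have "(\<lambda>u. \<eta> u $ 1) = (\<lambda>u. X u $ 2 * a u)" "(\<lambda>u. \<eta> u $ 2) = (\<lambda>u. X u $ 2 * b u)"
        "(\<lambda>u. \<eta> u $ 3) = \<nu>"
        by (simp_all add: \<eta>_def fun_eq_iff vector_3)
      ultimately show ?thesis
        using prod[OF sm3(1)] prod[OF sm3(2)] by (simp add: vec_eq_iff forall_3 vector_3)
    qed
    finally have "shape_operator (X ` V) \<xi> (X u) (dd X u w) = - (vector [dd X u w $ 2 * a u + X u $ 2 * dd a u w,
        dd X u w $ 2 * b u + X u $ 2 * dd b u w, dd \<nu> u w]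
        + christoffel_form H2R_metric (X u) (dd X u w) (vector [X u $ 2 * a u, X u $ 2 * b u, \<nu> u]))"
      unfolding shape_operator_def cov_deriv_along_def \<xi>X[OF u] by (simp add: \<eta>_def)
    then show ?thesis using frame_shape[OF y[OF u]] by metis
  qed
  show ?thesis by (rule that[OF sm3 unit' orth normal shape])
qed

section \<open>Pieces of umbilical surfaces\<close>

lemma cross_derivatives_nonzero:
  assumes X: "local_param M V X" and u: "u \<in> V"
  shows "cross3 (dd X u (axis 1 1)) (dd X u (axis 2 1)) \<noteq> 0"
proof -
  \<comment> \<open>At height 1 the orthonormal frame is the coordinate frame, so the frame version
    specializes to plain derivatives.\<close>
  have "frame (vector [0, 1, 0]) v = v" for v by (simp add: vec_eq_iff forall_3 vector_3)
  then show ?thesis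
    using cross_frame_nonzero[OF has_derivative_linear[OF local_paramD(4)[OF X u]] local_paramD(5)[OF X u],
        of "vector [0, 1, 0]"] by (simp add: vector_3)
qed

text \<open>The factor \<open>l\<close> is smooth because the equations can be solved for it.\<close>

lemma umbilical_factor_smooth:
  assumes X: "local_param M V X" and M: "M \<subseteq> H2R"
    and sm: "smooth_on V a" "smooth_on V b" "smooth_on V \<nu>"
    and eqs: "\<And>u w. u \<in> V \<Longrightarrow> dd a u w = (b u - l u) * frame (X u) (dd X u w) $ 1
        \<and> dd b u w = - a u * frame (X u) (dd X u w) $ 1 - l u * frame (X u) (dd X u w) $ 2
        \<and> dd \<nu> u w = - l u * frame (X u) (dd X u w) $ 3"
  obtains l' where "smooth_on V l'" "\<forall>u\<in>V. l' u = l u"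
proof -
  have V: "open V" and sX: "smooth_on V X" using local_paramD[OF X] by auto
  have XV: "X ` V \<subseteq> H2R" using openin_imp_subset[OF local_paramD(3)[OF X]] M by blast
  have y: "X u $ 2 > 0" if "u \<in> V" for u using XV that by (auto simp: H2R_def)
  define A where "A u = frame (X u) (dd X u (axis 1 1))" for u
  have smX: "smooth_on V (\<lambda>u. X u $ i)" "smooth_on V (\<lambda>u. dd X u w $ i)" for i w
    using smooth_on_vec_iff[OF V, THEN iffD1, OF sX]
      smooth_on_vec_iff[OF V, THEN iffD1, OF smooth_on_deriv[OF sX, of w]] by blast+
  have sA: "smooth_on V (\<lambda>u. A u $ i)" for i
    using exhaust_3[of i] y unfolding A_def
    by (auto intro!: smooth_on_intros[OF V] smX simp: less_imp_neq[symmetric])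
  define q where "q u = (A u $ 1)\<^sup>2 + (A u $ 2)\<^sup>2 + (A u $ 3)\<^sup>2" for u
  have q0: "q u \<noteq> 0" if u: "u \<in> V" for u
  proof -
    have "cross3 (A u) (frame (X u) (dd X u (axis 2 1))) \<noteq> 0"
      unfolding A_def using has_derivative_linear[OF local_paramD(4)[OF X u]] local_paramD(5)[OF X u] y[OF u]
      by (intro cross_frame_nonzero) auto
    then have "A u \<noteq> 0" by auto
    moreover have "q u = A u \<bullet> A u" by (simp add: q_def inner_vec_def sum_3 power2_eq_square)
    ultimately show ?thesis by simp
  qed
  have sq: "smooth_on V q" unfolding q_def[abs_def] by (intro smooth_on_intros[OF V] sA)
  let ?e = "axis 1 1 :: real^2"
  \<comment> \<open>The inner product of the shape operator applied to \<open>A u\<close> with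
    \<open>A u\<close> itself; umbilicity makes it \<open>l u\<close> times the squared length
    \<open>q u\<close>.\<close>
  let ?n = "\<lambda>u. b u * (A u $ 1)\<^sup>2 - dd a u ?e * A u $ 1 - (dd b u ?e + a u * A u $ 1) * A u $ 2
      - dd \<nu> u ?e * A u $ 3"
  show ?thesis
  proof (rule that[of "\<lambda>u. ?n u / q u"])
    show "smooth_on V (\<lambda>u. ?n u / q u)"
      by (intro smooth_on_intros[OF V] sA sq sm smooth_on_deriv q0)
    show "\<forall>u\<in>V. ?n u / q u = l u"
    proof
      fix u assume u: "u \<in> V"
      have "?n u = l u * q u"
        using eqs[OF u, of ?e] unfolding A_def[symmetric] q_def by algebra
      then show "?n u / q u = l u" using q0[OF u] by simp
    qed
  qed
qed

text \<open>One small ball inside \<open>V\<close> is enough for density, so it may be chosen to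
  avoid mixed behaviour: either \<open>\<nu>\<close> is zero on all of \<open>V\<close>, or the ball
  surrounds a point where it is nonzero. The last conclusion is what the totally geodesic case
  uses.\<close>

lemma umbilical_piece:
  assumes X: "local_param M V X" and M: "M \<subseteq> H2R" and V0: "V \<noteq> {}"
    and sm: "smooth_on V a" "smooth_on V b" "smooth_on V \<nu>"
    and unit: "\<And>u. u \<in> V \<Longrightarrow> (a u)\<^sup>2 + (b u)\<^sup>2 + (\<nu> u)\<^sup>2 = 1"
    and orth: "\<And>u w. u \<in> V \<Longrightarrow> vector [a u, b u, \<nu> u] \<bullet> frame (X u) (dd X u w) = 0"
    and eqs: "\<And>u w. u \<in> V \<Longrightarrow> dd a u w = (b u - l u) * frame (X u) (dd X u w) $ 1
        \<and> dd b u w = - a u * frame (X u) (dd X u w) $ 1 - l u * frame (X u) (dd X u w) $ 2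
        \<and> dd \<nu> u w = - l u * frame (X u) (dd X u w) $ 3"
  obtains u0 r S where "r > 0" "ball u0 r \<subseteq> V" "X ` ball u0 r \<subseteq> S"
    "S \<in> planes_and_cylinders \<union> umb_graphs"
    "(\<forall>u\<in>V. l u = 0) \<longrightarrow> S \<in> planes_and_cylinders"
proof -
  have V: "open V" and sX: "smooth_on V X" using local_paramD[OF X] by auto
  have XV: "X ` V \<subseteq> H2R" using openin_imp_subset[OF local_paramD(3)[OF X]] M by blast
  obtain l' where l': "smooth_on V l'" "\<forall>u\<in>V. l' u = l u"
    by (rule umbilical_factor_smooth[OF X M sm eqs])
  have ddX: "dd (\<lambda>u. X u $ i) u w = dd X u w $ i" if "u \<in> V" for i u w
    by (rule frechet_derivative_vec_nth[OF local_paramD(4)[OF X that]])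
  have smX: "smooth_on V (\<lambda>u. X u $ i)" for i
    using smooth_on_vec_iff[OF V, THEN iffD1, OF sX] by blast
  have patch: "umbilical_patch u0 r (\<lambda>u. X u $ 1) (\<lambda>u. X u $ 2) (\<lambda>u. X u $ 3) a b \<nu> l'"
    if r: "r > 0" "ball u0 r \<subseteq> V" for u0 r
  proof
    fix u w assume "u \<in> ball u0 r"
    then have u: "u \<in> V" using r by blast
    show "X u $ 2 > 0" using XV u by (auto simp: H2R_def)
    show "(a u)\<^sup>2 + (b u)\<^sup>2 + (\<nu> u)\<^sup>2 = 1" by (rule unit[OF u])
    show "a u * (dd (\<lambda>u. X u $ 1) u w / X u $ 2) + b u * (dd (\<lambda>u. X u $ 2) u w / X u $ 2)
        + \<nu> u * dd (\<lambda>u. X u $ 3) u w = 0"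
      using orth[OF u, of w] by (simp add: inner_vec_def sum_3 vector_3 ddX[OF u])
    show "dd a u w = (b u - l' u) * (dd (\<lambda>u. X u $ 1) u w / X u $ 2)"
      "dd b u w = - a u * (dd (\<lambda>u. X u $ 1) u w / X u $ 2) - l' u * (dd (\<lambda>u. X u $ 2) u w / X u $ 2)"
      "dd \<nu> u w = - l' u * dd (\<lambda>u. X u $ 3) u w"
      using eqs[OF u, of w] u l'(2) by (simp_all add: ddX[OF u])
    have "vector [dd (\<lambda>u. X u $ 1) u w, dd (\<lambda>u. X u $ 2) u w, dd (\<lambda>u. X u $ 3) u w] = dd X u w" for w
      by (simp add: ddX[OF u] vec_eq_iff forall_3 vector_3)
    then show "cross3 (vector [dd (\<lambda>u. X u $ 1) u (axis 1 1), dd (\<lambda>u. X u $ 2) u (axis 1 1),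
        dd (\<lambda>u. X u $ 3) u (axis 1 1)]) (vector [dd (\<lambda>u. X u $ 1) u (axis 2 1),
        dd (\<lambda>u. X u $ 2) u (axis 2 1), dd (\<lambda>u. X u $ 3) u (axis 2 1)]) \<noteq> 0"
      using cross_derivatives_nonzero[OF X u] by simp
  qed (use r smX sm l'(1) in \<open>auto intro: smooth_on_subset\<close>)
  have Xeq: "vector [X u $ 1, X u $ 2, X u $ 3] = X u" for u
    by (simp add: vec_eq_iff forall_3 vector_3)
  show ?thesis
  proof (cases "\<forall>u\<in>V. \<nu> u = 0")
    case True
    obtain u0 r where r: "r > 0" "ball u0 r \<subseteq> V"
      using V V0 open_contains_ball by blast
    have "\<nu> u = 0" if "u \<in> ball u0 r" for u using True r(2) that by blast
    then obtain c1 c2 c3 where "c2\<^sup>2 + 2 * c1 * c3 = 1"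
      and "\<forall>u\<in>ball u0 r. vector [X u $ 1, X u $ 2, X u $ 3] \<in> geodesic_cylinder c1 c2 c3"
      by (rule umbilical_patch.cylinder_piece[OF patch[OF r]])
    then have "geodesic_cylinder c1 c2 c3 \<in> planes_and_cylinders" "X ` ball u0 r \<subseteq> geodesic_cylinder c1 c2 c3"
      unfolding planes_and_cylinders_eq Xeq by blast+
    then show ?thesis using that[OF r] by blast
  next
    case False
    then obtain u0 where u0: "u0 \<in> V" "\<nu> u0 \<noteq> 0" by blast
    \<comment> \<open>The product with \<open>\<nu> u0\<close> expresses constancy of sign for both
      signs at once.\<close>
    have "open (V \<inter> \<nu> -` {t. t * \<nu> u0 > 0})"
      by (intro continuous_open_preimage smooth_on_imp_continuous_on[OF sm(3)] V
          open_Collect_less continuous_intros)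
    moreover have "u0 \<in> V \<inter> \<nu> -` {t. t * \<nu> u0 > 0}" using u0 by (simp add: zero_less_mult_iff) linarith
    ultimately obtain r where r: "r > 0" "ball u0 r \<subseteq> V \<inter> \<nu> -` {t. t * \<nu> u0 > 0}"
      using open_contains_ball by blast
    then have rV: "ball u0 r \<subseteq> V" and sign: "\<And>u. u \<in> ball u0 r \<Longrightarrow> \<nu> u * \<nu> u0 > 0" by auto
    show ?thesis
    proof (cases "\<forall>u\<in>V. l u = 0")
      case True
      have "\<nu> u \<noteq> 0" "l' u = 0" if "u \<in> ball u0 r" for u
        using sign[OF that] True l'(2) rV that by auto
      then obtain c where "\<forall>u\<in>ball u0 r. vector [X u $ 1, X u $ 2, X u $ 3] \<in> horizontal_plane c"
        by (rule umbilical_patch.plane_piece[OF patch[OF r(1) rV]])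
      then have "X ` ball u0 r \<subseteq> horizontal_plane c" unfolding Xeq by blast
      moreover have "horizontal_plane c \<in> planes_and_cylinders" unfolding planes_and_cylinders_def by blast
      ultimately show ?thesis using that[OF r(1) rV] by blast
    next
      case nz: False
      have "\<exists>S\<in>umb_graphs. \<forall>u\<in>ball u0 r. vector [X u $ 1, X u $ 2, X u $ 3] \<in> S"
      proof (cases "\<nu> u0 > 0")
        case True
        then have "\<nu> u > 0" if "u \<in> ball u0 r" for u using sign[OF that] by (simp add: zero_less_mult_iff)
        from umbilical_patch.graph_piece[OF patch[OF r(1) rV] this] show ?thesis by metis
      next
        case False
        then have "- \<nu> u > 0" if "u \<in> ball u0 r" for u
          using sign[OF that] by (auto simp: zero_less_mult_iff)
        from umbilical_patch.graph_piece[OF umbilical_patch_uminus[OF patch[OF r(1) rV]] this]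
        show ?thesis by metis
      qed
      then obtain S where "S \<in> umb_graphs" "X ` ball u0 r \<subseteq> S" unfolding Xeq by blast
      then show ?thesis using that[OF r(1) rV] nz by blast
    qed
  qed
qed

text \<open>Umbilicity is applied to the patch itself with the normal constructed on it; the factor
  \<open>l\<close> becomes \<open>lam\<close> composed with \<open>X\<close>, about which no
  regularity is known at this stage.\<close>

lemma umbilical_imp_pieces:
  assumes M: "umbilical M" and X: "local_param M V X" and V0: "V \<noteq> {}"
  obtains u0 r S where "r > 0" "ball u0 r \<subseteq> V" "X ` ball u0 r \<subseteq> S"
    "S \<in> planes_and_cylinders \<union> umb_graphs"
proof -
  have MH: "M \<subseteq> H2R" using M by (simp add: umbilical_def regular_surface_def)
  have V: "open V" using local_paramD(1)[OF X] .
  have X': "local_param (X ` V) V X" using local_param_restrict(2)[OF X V] by simp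
  obtain a b \<nu> \<xi> where sm: "smooth_on V a" "smooth_on V b" "smooth_on V \<nu>"
    and unit: "\<And>u. u \<in> V \<Longrightarrow> (a u)\<^sup>2 + (b u)\<^sup>2 + (\<nu> u)\<^sup>2 = 1"
    and orth: "\<And>u w. u \<in> V \<Longrightarrow> vector [a u, b u, \<nu> u] \<bullet> frame (X u) (dd X u w) = 0"
    and \<xi>: "unit_normal_field (X ` V) \<xi>"
    and shape: "\<And>u w. u \<in> V \<Longrightarrow> frame (X u) (shape_operator (X ` V) \<xi> (X u) (dd X u w))
      = vector [- (dd a u w - b u * frame (X u) (dd X u w) $ 1),
          - (dd b u w + a u * frame (X u) (dd X u w) $ 1), - dd \<nu> u w]"
    by (rule local_param_unit_normal[OF X MH]) blast
  obtain u1 where "u1 \<in> V" using V0 by blast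
  then obtain lam where lam: "\<And>q v. q \<in> X ` V \<Longrightarrow> v \<in> tangent_plane (X ` V) q \<Longrightarrow>
      shape_operator (X ` V) \<xi> q v = lam q *\<^sub>R v"
    using M \<xi> local_paramD(3)[OF X] unfolding umbilical_def
    by (metis imageI openin_imp_subset subsetD)
  have "dd a u w = (b u - lam (X u)) * frame (X u) (dd X u w) $ 1
        \<and> dd b u w = - a u * frame (X u) (dd X u w) $ 1 - lam (X u) * frame (X u) (dd X u w) $ 2
        \<and> dd \<nu> u w = - lam (X u) * frame (X u) (dd X u w) $ 3" if u: "u \<in> V" for u w
  proof -
    have "shape_operator (X ` V) \<xi> (X u) (dd X u w) = lam (X u) *\<^sub>R dd X u w"
      using u tangent_plane_eq[OF X' u] by (intro lam) auto
    then have "frame (X u) (shape_operator (X ` V) \<xi> (X u) (dd X u w)) = lam (X u) *\<^sub>R frame (X u) (dd X u w)"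
      by (simp add: linear_cmul[OF linear_frame])
    from this[unfolded shape[OF u]]
    have "- (dd a u w - b u * frame (X u) (dd X u w) $ 1) = lam (X u) * frame (X u) (dd X u w) $ 1
        \<and> - (dd b u w + a u * frame (X u) (dd X u w) $ 1) = lam (X u) * frame (X u) (dd X u w) $ 2
        \<and> - dd \<nu> u w = lam (X u) * frame (X u) (dd X u w) $ 3"
      by (simp add: vec_eq_iff forall_3 vector_3 del: frame_nth)
    then show ?thesis
      unfolding left_diff_distrib mult_minus_left by linarith
  qed
  from umbilical_piece[OF X MH V0 sm unit orth this] show ?thesis using that by metis
qed

text \<open>The covariant derivative of a unit normal is tangent, so it vanishes when the second
  fundamental form does.\<close>

lemma totally_geodesic_imp_pieces:
  assumes M: "totally_geodesic M" and X: "local_param M V X" and V0: "V \<noteq> {}"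
  obtains u0 r S where "r > 0" "ball u0 r \<subseteq> V" "X ` ball u0 r \<subseteq> S" "S \<in> planes_and_cylinders"
proof -
  have MH: "M \<subseteq> H2R" using M by (simp add: totally_geodesic_def regular_surface_def)
  have V: "open V" using local_paramD(1)[OF X] .
  have X': "local_param (X ` V) V X" using local_param_restrict(2)[OF X V] by simp
  have XV: "X ` V \<subseteq> H2R" using openin_imp_subset[OF local_paramD(3)[OF X]] MH by blast
  obtain a b \<nu> \<xi> where sm: "smooth_on V a" "smooth_on V b" "smooth_on V \<nu>"
    and unit: "\<And>u. u \<in> V \<Longrightarrow> (a u)\<^sup>2 + (b u)\<^sup>2 + (\<nu> u)\<^sup>2 = 1"
    and orth: "\<And>u w. u \<in> V \<Longrightarrow> vector [a u, b u, \<nu> u] \<bullet> frame (X u) (dd X u w) = 0"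
    and \<xi>: "unit_normal_field (X ` V) \<xi>"
    and shape: "\<And>u w. u \<in> V \<Longrightarrow> frame (X u) (shape_operator (X ` V) \<xi> (X u) (dd X u w))
      = vector [- (dd a u w - b u * frame (X u) (dd X u w) $ 1),
          - (dd b u w + a u * frame (X u) (dd X u w) $ 1), - dd \<nu> u w]"
    by (rule local_param_unit_normal[OF X MH]) blast
  have zero: "vector [- (dd a u w - b u * frame (X u) (dd X u w) $ 1),
          - (dd b u w + a u * frame (X u) (dd X u w) $ 1), - dd \<nu> u w] = (0 :: real^3)" (is "?s = 0")
    if u: "u \<in> V" for u w
  proof -
    have tp: "dd X u w \<in> tangent_plane (X ` V) (X u)" for w
      using tangent_plane_eq[OF X' u] by simp
    have "?s \<bullet> frame (X u) (dd X u w') = 0" for w'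
    proof -
      have "second_fundamental_form (X ` V) \<xi> (X u) (dd X u w) (dd X u w') = 0"
        by (rule M[unfolded totally_geodesic_def, THEN conjunct2, rule_format,
              OF conjI[OF local_paramD(3)[OF X] \<xi>] imageI[OF u] tp tp])
      then show ?thesis
        unfolding second_fundamental_form_def inner_frame[symmetric] shape[OF u] .
    qed
    moreover have k0: "cross3 (frame (X u) (dd X u (axis 1 1))) (frame (X u) (dd X u (axis 2 1))) \<noteq> 0"
      using has_derivative_linear[OF local_paramD(4)[OF X u]] local_paramD(5)[OF X u] XV u
      by (intro cross_frame_nonzero) (auto simp: H2R_def)
    ultimately obtain c d where c: "?s = c *\<^sub>R cross3 (frame (X u) (dd X u (axis 1 1))) (frame (X u) (dd X u (axis 2 1)))"
      and d: "vector [a u, b u, \<nu> u] = d *\<^sub>R cross3 (frame (X u) (dd X u (axis 1 1))) (frame (X u) (dd X u (axis 2 1)))"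
      using orth[OF u] orthogonal_pair_imp_parallel_cross by metis
    have "vector [a u, b u, \<nu> u] \<noteq> (0 :: real^3)"
      using unit[OF u] by (auto simp: vec_eq_iff forall_3 vector_3)
    then have "d \<noteq> 0" using d by auto
    \<comment> \<open>Differentiating the constant squared length shows that \<open>?s\<close> is
      orthogonal to the normal. It is also parallel to it, by \<open>c\<close> and \<open>d\<close>,
      hence zero.\<close>
    have "((\<lambda>u. (a u)\<^sup>2 + (b u)\<^sup>2 + (\<nu> u)\<^sup>2) has_derivative
        (\<lambda>w. 2 * (a u * dd a u w + b u * dd b u w + \<nu> u * dd \<nu> u w))) (at u)"
      by (auto intro!: derivative_eq_intros smooth_on_has_derivative[OF sm(1) u]
          smooth_on_has_derivative[OF sm(2) u] smooth_on_has_derivative[OF sm(3) u] simp: algebra_simps)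
    moreover have "((\<lambda>u. (a u)\<^sup>2 + (b u)\<^sup>2 + (\<nu> u)\<^sup>2) has_derivative (\<lambda>w. 0)) (at u)"
      by (rule has_derivative_transform_within_open[OF has_derivative_const V u]) (simp add: unit)
    ultimately have "(\<lambda>w. 2 * (a u * dd a u w + b u * dd b u w + \<nu> u * dd \<nu> u w)) = (\<lambda>w. 0)"
      by (rule has_derivative_unique)
    from fun_cong[OF this, of w] have "a u * dd a u w + b u * dd b u w + \<nu> u * dd \<nu> u w = 0" by simp
    then have "?s \<bullet> vector [a u, b u, \<nu> u] = 0"
      by (simp add: inner_vec_def sum_3 vector_3 algebra_simps)
    then have "c = 0" using \<open>d \<noteq> 0\<close> k0 unfolding c d by simp
    then show ?thesis using c by simp
  qed
  have "dd a u w = (b u - 0) * frame (X u) (dd X u w) $ 1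
        \<and> dd b u w = - a u * frame (X u) (dd X u w) $ 1 - 0 * frame (X u) (dd X u w) $ 2
        \<and> dd \<nu> u w = - 0 * frame (X u) (dd X u w) $ 3" if u: "u \<in> V" for u w
    using zero[OF u, of w] by (simp add: vec_eq_iff forall_3 vector_3 del: frame_nth)
  from umbilical_piece[where l = "\<lambda>u. 0", OF X MH V0 sm unit orth this] show ?thesis using that by metis
qed

section \<open>From pieces to an open dense subset\<close>

text \<open>A maximal disjoint family of pieces gives the required dense set, so that no pieces have to be
  glued.\<close>

lemma components_Union_disjoint:
  assumes W: "\<And>D. D \<in> \<D> \<Longrightarrow> openin (top_of_set (\<Union>\<D>)) D" and conn: "\<And>D. D \<in> \<D> \<Longrightarrow> connected D"
    and disj: "pairwise disjnt \<D>" and C: "C \<in> components (\<Union>\<D>)"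
  shows "C \<in> \<D>"
proof -
  have C': "C \<noteq> {}" "C \<subseteq> \<Union>\<D>" "connected C"
    using in_components_nonempty[OF C] in_components_subset[OF C] in_components_connected[OF C] by auto
  then obtain p D where p: "p \<in> C" "p \<in> D" "D \<in> \<D>" by blast
  have "E \<inter> D = {}" if "E \<in> \<D> - {D}" for E
    using disj p(3) that by (auto simp: pairwise_def disjnt_def)
  \<comment> \<open>What lies outside \<open>D\<close> is covered by the other members, so
    \<open>D\<close> meets \<open>C\<close> in a clopen set; connectedness gives
    \<open>C \<subseteq> D\<close> and maximality of components the converse.\<close>
  then have "C - C \<inter> D = C \<inter> \<Union>(\<D> - {D})"
    using C'(2) p(3) by blast
  moreover have "openin (top_of_set (\<Union>\<D>)) (\<Union>(\<D> - {D}))" using W by blast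
  ultimately have "openin (top_of_set C) (C - C \<inter> D)"
    using openin_Int_relative C'(2) by metis
  then have "closedin (top_of_set C) (C \<inter> D)"
    by (simp add: closedin_def)
  moreover have "openin (top_of_set C) (C \<inter> D)"
    using openin_Int_relative[OF W[OF p(3)] C'(2)] .
  ultimately have "C \<subseteq> D"
    using C'(3) p unfolding connected_clopen by blast
  moreover have "D \<subseteq> C"
    using components_maximal[OF C conn[OF p(3)]] p by blast
  ultimately show ?thesis using p(3) by simp
qed

text \<open>Zorn's lemma gives a maximal disjoint family. If its union were not dense, the
  complement of the closure would contain one more piece. By disjointness and connectedness the
  components of the union are members of the family.\<close>

lemma locally_one_ofI:
  assumes "\<And>U. openin (top_of_set M) U \<Longrightarrow> U \<noteq> {} \<Longrightarrow>
    \<exists>C S. C \<noteq> {} \<and> C \<subseteq> U \<and> connected C \<and> openin (top_of_set M) C \<and> S \<in> F \<and> openin (top_of_set S) C"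
  shows "locally_one_of F M"
proof -
  define P where "P C \<longleftrightarrow> C \<noteq> {} \<and> connected C \<and> openin (top_of_set M) C
      \<and> (\<exists>S\<in>F. openin (top_of_set S) C)" for C
  define \<A> where "\<A> = {\<D>. \<D> \<subseteq> Collect P \<and> pairwise disjnt \<D>}"
  have "\<exists>\<D>\<in>\<A>. \<forall>\<E>\<in>\<A>. \<D> \<subseteq> \<E> \<longrightarrow> \<E> = \<D>"
  proof (rule subset_Zorn_nonempty)
    show "\<A> \<noteq> {}" unfolding \<A>_def by (auto intro: exI[of _ "{}"])
    show "\<Union>\<C> \<in> \<A>" if "\<C> \<noteq> {}" "subset.chain \<A> \<C>" for \<C>
    proof -
      have "chain\<^sub>\<subseteq> \<C>" using that(2) unfolding subset.chain_def chain_subset_def by blast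
      moreover have "\<D> \<subseteq> Collect P \<and> pairwise disjnt \<D>" if "\<D> \<in> \<C>" for \<D>
        using that \<open>subset.chain \<A> \<C>\<close> unfolding \<A>_def subset.chain_def by blast
      ultimately show ?thesis
        using pairwise_chain_Union[of \<C> disjnt] unfolding \<A>_def by blast
    qed
  qed
  then obtain \<D> where "\<D> \<in> \<A>" and max: "\<forall>\<E>\<in>\<A>. \<D> \<subseteq> \<E> \<longrightarrow> \<E> = \<D>"
    by (elim bexE)
  then have \<D>: "\<D> \<subseteq> Collect P" "pairwise disjnt \<D>" by (auto simp: \<A>_def)
  define W where "W = \<Union>\<D>"
  have oM: "openin (top_of_set M) D" if "D \<in> \<D>" for D using \<D>(1) that by (auto simp: P_def)
  have W: "openin (top_of_set M) W" unfolding W_def using oM by blast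
  have "M \<subseteq> closure W"
  proof (rule ccontr)
    assume "\<not> M \<subseteq> closure W"
    then have "M - closure W \<noteq> {}" by blast
    moreover have "openin (top_of_set M) (M - closure W)"
      by (metis Diff_eq closed_closure open_Compl openin_open)
    ultimately obtain C where C: "P C" "C \<subseteq> M - closure W"
      using assms[of "M - closure W"] unfolding P_def by blast
    then have CW: "C \<inter> W = {}" using closure_subset by blast
    have "pairwise disjnt (insert C \<D>)"
      using \<D>(2) CW by (auto simp: pairwise_insert disjnt_def W_def)
    then have "insert C \<D> \<in> \<A>" using C(1) \<D>(1) by (auto simp: \<A>_def)
    then have "insert C \<D> = \<D>" using max by blast
    then have "C \<subseteq> W" unfolding W_def by blast
    then show False using CW C(1) by (auto simp: P_def)
  qed
  moreover have "\<exists>S\<in>F. openin (top_of_set S) C" if "C \<in> components W" for C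
  proof -
    have "C \<in> \<D>"
    proof (rule components_Union_disjoint[OF _ _ \<D>(2)])
      show "openin (top_of_set (\<Union>\<D>)) D" if "D \<in> \<D>" for D
        using openin_subset_trans[OF oM[OF that], of W] that openin_imp_subset[OF W] by (auto simp: W_def)
    qed (use \<D>(1) that in \<open>auto simp: P_def W_def\<close>)
    then show ?thesis using \<D>(1) by (auto simp: P_def)
  qed
  ultimately show ?thesis unfolding locally_one_of_def using W by blast
qed

text \<open>A chart is first cut down to the given open set \<open>U\<close>. The ball makes the
  piece connected, and its openness in the model \<open>S\<close> follows from mere inclusion by
  \<open>local_param_image_openin\<close>.\<close>

lemma locally_one_of_pieces:
  assumes M: "regular_surface M" and F: "\<And>S. S \<in> F \<Longrightarrow> regular_surface S"
    and pieces: "\<And>V X. local_param M V X \<Longrightarrow> V \<noteq> {} \<Longrightarrow>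
      \<exists>u0 r S. r > 0 \<and> ball u0 r \<subseteq> V \<and> X ` ball u0 r \<subseteq> S \<and> S \<in> F"
  shows "locally_one_of F M"
proof (rule locally_one_ofI)
  fix U assume U: "openin (top_of_set M) U" "U \<noteq> {}"
  then obtain p where p: "p \<in> U" "p \<in> M" using openin_imp_subset by blast
  then obtain V X where X: "local_param M V X" "p \<in> X ` V"
    using M unfolding regular_surface_def by blast
  define V' where "V' = V \<inter> X -` U"
  have "openin (top_of_set (X ` V)) (X ` V \<inter> U)"
    by (rule openin_Int_relative[OF U(1) openin_imp_subset[OF local_paramD(3)[OF X(1)]]])
  then have "openin (top_of_set V) (V \<inter> X -` (X ` V \<inter> U))"
    using continuous_on_open[of V X] smooth_on_imp_continuous_on[OF local_paramD(2)[OF X(1)]] by blast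
  moreover have "V \<inter> X -` (X ` V \<inter> U) = V'" by (auto simp: V'_def)
  ultimately have V': "open V'" using local_paramD(1)[OF X(1)] openin_open_trans by metis
  have X': "local_param M V' X"
    by (rule local_param_restrict(1)[OF X(1) V']) (simp add: V'_def)
  have "V' \<noteq> {}" using X(2) p(1) by (auto simp: V'_def)
  then obtain u0 r S where S: "r > 0" "ball u0 r \<subseteq> V'" "X ` ball u0 r \<subseteq> S" "S \<in> F"
    using pieces[OF X'] by blast
  have B: "local_param M (ball u0 r) X"
    by (rule local_param_restrict(1)[OF X' open_ball S(2)])
  show "\<exists>C S. C \<noteq> {} \<and> C \<subseteq> U \<and> connected C \<and> openin (top_of_set M) C \<and> S \<in> F \<and> openin (top_of_set S) C"
  proof (intro exI conjI)
    show "X ` ball u0 r \<noteq> {}" using S(1) by simp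
    show "X ` ball u0 r \<subseteq> U" using S(2) by (auto simp: V'_def)
    show "connected (X ` ball u0 r)"
      by (intro connected_continuous_image smooth_on_imp_continuous_on local_paramD(2)[OF B] connected_ball)
    show "openin (top_of_set M) (X ` ball u0 r)" by (rule local_paramD(3)[OF B])
    show "openin (top_of_set S) (X ` ball u0 r)"
      by (rule local_param_image_openin[OF F[OF S(4)] B S(3)])
  qed (rule S(4))
qed

text \<open>The first two conjuncts express the word "namely" in (i): planes and cylinders are
  totally geodesic, and locally they are the only totally geodesic surfaces.\<close>

theorem theorem4p4:
  shows "(\<forall>S \<in> planes_and_cylinders. totally_geodesic S)
    \<and> (\<forall>M. totally_geodesic M \<longrightarrow> locally_one_of planes_and_cylinders M)
    \<and> (\<forall>S \<in> planes_and_cylinders \<union> umb_graphs. umbilical S)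
    \<and> (\<forall>M. umbilical M \<longrightarrow> locally_one_of (planes_and_cylinders \<union> umb_graphs) M)"
proof (intro conjI ballI allI impI)
  show tg: "totally_geodesic S" if "S \<in> planes_and_cylinders" for S
    by (rule model_surfaces(2)[OF that])
  show umb: "umbilical S" if "S \<in> planes_and_cylinders \<union> umb_graphs" for S
    using that model_surfaces(1) umb_graphs_umbilical by blast
  show "locally_one_of planes_and_cylinders M" if M: "totally_geodesic M" for M
  proof (rule locally_one_of_pieces)
    show "regular_surface M" using M by (simp add: totally_geodesic_def)
    show "regular_surface S" if "S \<in> planes_and_cylinders" for S
      using tg[OF that] by (simp add: totally_geodesic_def)
    show "\<exists>u0 r S. r > 0 \<and> ball u0 r \<subseteq> V \<and> X ` ball u0 r \<subseteq> S \<and> S \<in> planes_and_cylinders"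
      if "local_param M V X" "V \<noteq> {}" for V X
      using totally_geodesic_imp_pieces[OF M that] by metis
  qed
  show "locally_one_of (planes_and_cylinders \<union> umb_graphs) M" if M: "umbilical M" for M
  proof (rule locally_one_of_pieces)
    show "regular_surface M" using M by (simp add: umbilical_def)
    show "regular_surface S" if "S \<in> planes_and_cylinders \<union> umb_graphs" for S
      using umb[OF that] by (simp add: umbilical_def)
    show "\<exists>u0 r S. r > 0 \<and> ball u0 r \<subseteq> V \<and> X ` ball u0 r \<subseteq> S
        \<and> S \<in> planes_and_cylinders \<union> umb_graphs"
      if "local_param M V X" "V \<noteq> {}" for V X
      using umbilical_imp_pieces[OF M that] by metis
  qed
qed

end
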